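(* For all integers $n \ge 2$ and $0 \le k \le n$ with $n-k$ even, there exists a CMDRR$(n,k)$, except for $(n,k) \in \{(2,2),(3,3),(4,2),(6,6)\}$ and possibly excepting the following 31 pairs: $(5,3)$, $(6,2)$, $(12,2)$, $(12,6)$, $(12,8)$, $(13,3)$, $(13,7)$, $(14,2)$, $(14,6)$, $(15,3)$, $(15,7)$, $(15,9)$, $(16,2)$, $(16,10)$, $(17,3)$, $(17,7)$, $(17,11)$, $(18,2)$, $(18,10)$, $(19,3)$, $(19,11)$, $(20,2)$, $(20,14)$, $(21,3)$, $(21,11)$, $(22,2)$, $(22,14)$, $(23,15)$, $(24,2)$, $(24,14)$, $(25,15)$.
   Context: A mixed doubles game is a match between two teams, each team consisting of one man and one woman; in a game $M_a F_b$ v $M_c F_d$, $M_a$ and $F_b$ are partners, $M_c$ and $F_d$ are partners, and each player of one team opposes each player of the other team. A complete mixed doubles round robin tournament CMDRR$(n,k)$ is a schedule (set) of mixed doubles games for $n$ men and $n$ women, of which $k$ men and $k$ women are paired into $k$ spouse pairs (a spouse pair is one man and one woman), such that: spouses never play in a game together as partners or opponents; every man and woman who are not spouses are partners exactly once and opponents exactly once; each player who has a spouse opposes every other player of the same sex exactly once; each player who does not have a spouse opposes some other same-sex player who does not have a spouse exactly twice and opposes all other same-sex players exactly once. *)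

theory Defs
  imports Main
begin

text \<open>Men and women are both numbered 0,...,n-1. A game (a,b,c,d) stands for
  M_a F_b v M_c F_d. A spouse relation S is a set of pairs (man, woman).
  A schedule is a finite set of games.\<close>

type_synonym game = "nat \<times> nat \<times> nat \<times> nat"

definition spouse_matching :: "nat \<Rightarrow> nat \<Rightarrow> (nat \<times> nat) set \<Rightarrow> bool" where
  "spouse_matching n k S \<longleftrightarrow>
     S \<subseteq> {..<n} \<times> {..<n} \<and> card S = k \<and>
     (\<forall>m w w'. (m, w) \<in> S \<and> (m, w') \<in> S \<longrightarrow> w = w') \<and>
     (\<forall>m m' w. (m, w) \<in> S \<and> (m', w) \<in> S \<longrightarrow> m = m')"

definition wf_game :: "nat \<Rightarrow> game \<Rightarrow> bool" where
  "wf_game n g = (case g of (a, b, c, d) \<Rightarrow>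
     a < n \<and> b < n \<and> c < n \<and> d < n \<and> a \<noteq> c \<and> b \<noteq> d)"

definition partners_count :: "game set \<Rightarrow> nat \<Rightarrow> nat \<Rightarrow> nat" where
  "partners_count G m w = card {g \<in> G. case g of (a, b, c, d) \<Rightarrow>
     (a = m \<and> b = w) \<or> (c = m \<and> d = w)}"

definition mw_opp_count :: "game set \<Rightarrow> nat \<Rightarrow> nat \<Rightarrow> nat" where
  "mw_opp_count G m w = card {g \<in> G. case g of (a, b, c, d) \<Rightarrow>
     (a = m \<and> d = w) \<or> (c = m \<and> b = w)}"

definition men_opp_count :: "game set \<Rightarrow> nat \<Rightarrow> nat \<Rightarrow> nat" where
  "men_opp_count G m m' = card {g \<in> G. case g of (a, b, c, d) \<Rightarrow>
     (a = m \<and> c = m') \<or> (a = m' \<and> c = m)}"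

definition women_opp_count :: "game set \<Rightarrow> nat \<Rightarrow> nat \<Rightarrow> nat" where
  "women_opp_count G w w' = card {g \<in> G. case g of (a, b, c, d) \<Rightarrow>
     (b = w \<and> d = w') \<or> (b = w' \<and> d = w)}"

text \<open>Same-sex opposition condition, for a generic opposition count on players {..<n},
  where P is the set of players of that sex having a spouse.\<close>
definition same_sex_ok :: "nat \<Rightarrow> nat set \<Rightarrow> (nat \<Rightarrow> nat \<Rightarrow> nat) \<Rightarrow> bool" where
  "same_sex_ok n P opp \<longleftrightarrow>
     (\<forall>x<n. x \<in> P \<longrightarrow> (\<forall>y<n. y \<noteq> x \<longrightarrow> opp x y = 1)) \<and>
     (\<forall>x<n. x \<notin> P \<longrightarrow>
        (\<exists>z<n. z \<noteq> x \<and> z \<notin> P \<and> opp x z = 2 \<and>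
           (\<forall>y<n. y \<noteq> x \<and> y \<noteq> z \<longrightarrow> opp x y = 1)))"

definition is_CMDRR :: "nat \<Rightarrow> nat \<Rightarrow> (nat \<times> nat) set \<Rightarrow> game set \<Rightarrow> bool" where
  "is_CMDRR n k S G \<longleftrightarrow>
     spouse_matching n k S \<and> finite G \<and> (\<forall>g\<in>G. wf_game n g) \<and>
     (\<forall>(a, b, c, d)\<in>G. (a, b) \<notin> S \<and> (a, d) \<notin> S \<and> (c, b) \<notin> S \<and> (c, d) \<notin> S) \<and>
     (\<forall>m<n. \<forall>w<n. (m, w) \<notin> S \<longrightarrow> partners_count G m w = 1 \<and> mw_opp_count G m w = 1) \<and>
     same_sex_ok n (fst ` S) (men_opp_count G) \<and>
     same_sex_ok n (snd ` S) (women_opp_count G)"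

definition CMDRR_exists :: "nat \<Rightarrow> nat \<Rightarrow> bool" where
  "CMDRR_exists n k \<longleftrightarrow> (\<exists>S G. is_CMDRR n k S G)"

end

theory Submission
  imports Defs "HOL-Library.Multiset" "HOL-Library.Disjoint_Sets"
begin

text \<open>Rename the women so that the spouse of man x is woman x, and count for a multiset of games how
  often each ordered pair meets in each of the four roles. These counts are additive. Hence, if every
  two points of a set lie in exactly one block of a family and every block carries a tournament, with
  the sets of unmarried players of the blocks disjoint, then the union is a tournament. In the same
  way a hole can be filled. Deleting points from one group of a transversal design with five groups
  of size m leaves blocks of size 4 and 5 and groups of sizes m, m, m, m, x, so tournaments with m
  and with x men yield tournaments with 4m + x men whose numbers of spouse pairs add up. Linear
  transversal designs of order u exist for u coprime to 6, and products with those of orders 4 and 8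
  give enough even orders to reach every n above 111. What remains is finite: these tournaments, up
  to a hole, are developed from base games over a cyclic group, and only the differences of the base
  games have to be checked.

  The two nontrivial impossible cases, (4,2) and (6,6), are excluded by a backtracking search over
  the games of the pairs of opposing men.\<close>

section \<open>Schedules with holes\<close>

text \<open>Two gaps decide how much has to be tabulated. A tournament with an odd number m of men
  has at least one spouse pair, so four groups of odd size contribute at least 4, and for m = 16 and
  m = 20 no tournament with 2 spouse pairs is at hand. Small k therefore needs its own starters up
  to n = 111; from n = 112 on even group sizes m \<ge> 28 are used, which lie above all exceptional
  orders and may have no spouse pairs. At the other end, k = n forces every group to be fully
  married, which is impossible if the truncated group has 2, 3 or 6 men; such n are split with
  another m or get a starter. Games form multisets so that unions need no disjointness proof; that
  no game is repeated follows at the end from the partner counts. An unmarried man partners and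
  opposes the woman of his own name, which lets one counting condition describe all four
  roles.\<close>

type_synonym 'a match = "'a \<times> 'a \<times> 'a \<times> 'a"

datatype meeting = Partners | Opponents | Men | Women

text \<open>Each role gets two ordered pairs per game, the same-sex roles by listing both orders.
  All four roles can then obey the same counting condition.\<close>

fun meets :: "meeting \<Rightarrow> 'a match \<Rightarrow> ('a \<times> 'a) list" where
  "meets Partners (a, b, c, d) = [(a, b), (c, d)]"
| "meets Opponents (a, b, c, d) = [(a, d), (c, b)]"
| "meets Men (a, b, c, d) = [(a, c), (c, a)]"
| "meets Women (a, b, c, d) = [(b, d), (d, b)]"

fun map_match :: "('a \<Rightarrow> 'b) \<Rightarrow> 'a match \<Rightarrow> 'b match" where
  "map_match f (a, b, c, d) = (f a, f b, f c, f d)"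

lemma meets_map_match: "meets \<kappa> (map_match f g) = map (map_prod f f) (meets \<kappa> g)"
  by (cases \<kappa>; cases g) auto

definition meetings :: "meeting \<Rightarrow> 'a match multiset \<Rightarrow> ('a \<times> 'a) multiset" where
  "meetings \<kappa> G = (\<Sum>g\<in>#G. mset (meets \<kappa> g))"

lemma meetings_empty [simp]: "meetings \<kappa> {#} = {#}"
  by (simp add: meetings_def)

lemma meetings_add_mset [simp]: "meetings \<kappa> (add_mset g G) = mset (meets \<kappa> g) + meetings \<kappa> G"
  by (simp add: meetings_def)

lemma meetings_union [simp]: "meetings \<kappa> (G + G') = meetings \<kappa> G + meetings \<kappa> G'"
  by (simp add: meetings_def)

lemma meetings_sum: "meetings \<kappa> (\<Sum>i\<in>I. G i) = (\<Sum>i\<in>I. meetings \<kappa> (G i))"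
  by (induction I rule: infinite_finite_induct) auto

lemma meetings_image_mset:
  "meetings \<kappa> (image_mset (map_match f) G) = image_mset (map_prod f f) (meetings \<kappa> G)"
  by (induction G) (auto simp: meets_map_match)

lemma meetings_mset: "meetings \<kappa> (mset gs) = mset (concat (map (meets \<kappa>) gs))"
  by (induction gs) auto

text \<open>An unmarried man is not kept apart from the woman of his own name. So the meeting that a
  player \<open>x\<close> of \<open>U\<close> has on top of those with other names is with
  \<open>x\<close> itself in the mixed roles, and with \<open>\<sigma> x\<close> in the same-sex
  roles.\<close>

definition mate :: "meeting \<Rightarrow> ('a \<Rightarrow> 'a) \<Rightarrow> 'a \<Rightarrow> 'a" where
  "mate \<kappa> \<sigma> = (if \<kappa> = Men \<or> \<kappa> = Women then \<sigma> else id)"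

definition joined :: "'a set \<Rightarrow> 'a set \<Rightarrow> 'a \<Rightarrow> 'a \<Rightarrow> bool" where
  "joined X H x y \<longleftrightarrow> x \<noteq> y \<and> x \<in> X \<and> y \<in> X \<and> \<not> (x \<in> H \<and> y \<in> H)"

text \<open>The points of X outside H and U are couples, those of U are pairs of unmarried players. Players of H
  do not meet each other, and \<sigma> maps every unmarried player to the one opposed twice.\<close>

definition schedule :: "'a set \<Rightarrow> 'a set \<Rightarrow> 'a set \<Rightarrow> ('a \<Rightarrow> 'a) \<Rightarrow> 'a match multiset \<Rightarrow> bool" where
  "schedule X H U \<sigma> G \<longleftrightarrow>
     finite X \<and> H \<subseteq> X \<and> U \<subseteq> X - H \<and>
     (\<forall>x\<in>U. \<sigma> x \<in> U \<and> \<sigma> x \<noteq> x \<and> \<sigma> (\<sigma> x) = x) \<and>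
     (\<forall>\<kappa> x y. count (meetings \<kappa> G) (x, y) =
        of_bool (joined X H x y) + of_bool (x \<in> U \<and> y = mate \<kappa> \<sigma> x))"

definition design :: "'a set \<Rightarrow> 'a set \<Rightarrow> 'a set \<Rightarrow> bool" where
  "design X H U \<longleftrightarrow> (\<exists>\<sigma> G. schedule X H U \<sigma> G)"

text \<open>The outer schedule leaves out precisely the pairs inside \<open>H\<close>, and the inner
  one supplies them. Since \<open>U\<close> avoids \<open>H\<close> and \<open>V\<close> lies in it,
  the two involutions can be glued.\<close>

lemma design_fill:
  assumes "design X H U" and "design H {} V"
  shows "design X {} (U \<union> V)"
proof -
  obtain \<sigma> G \<tau> T where G: "schedule X H U \<sigma> G" and T: "schedule H {} V \<tau> T"
    using assms by (auto simp: design_def)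
  define \<rho> where "\<rho> x = (if x \<in> U then \<sigma> x else \<tau> x)" for x
  have sub: "H \<subseteq> X" "U \<subseteq> X - H" "V \<subseteq> H" "U \<inter> V = {}"
    using G T by (auto simp: schedule_def)
  have cnt: "count (meetings \<kappa> (G + T)) (x, y) =
      of_bool (joined X {} x y) + of_bool (x \<in> U \<union> V \<and> y = mate \<kappa> \<rho> x)" for \<kappa> x y
  proof -
    have "count (meetings \<kappa> (G + T)) (x, y) =
        of_bool (joined X H x y) + of_bool (x \<in> U \<and> y = mate \<kappa> \<sigma> x) +
        (of_bool (joined H {} x y) + of_bool (x \<in> V \<and> y = mate \<kappa> \<tau> x))"
      using G T by (simp add: schedule_def)
    also have "\<dots> = of_bool (joined X {} x y) + of_bool (x \<in> U \<union> V \<and> y = mate \<kappa> \<rho> x)"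
      using sub by (auto simp: joined_def mate_def \<rho>_def)
    finally show ?thesis .
  qed
  have "schedule X {} (U \<union> V) \<rho> (G + T)"
    unfolding schedule_def
  proof (intro conjI allI)
    show "\<forall>x\<in>U \<union> V. \<rho> x \<in> U \<union> V \<and> \<rho> x \<noteq> x \<and> \<rho> (\<rho> x) = x"
      using G T sub by (auto simp: schedule_def \<rho>_def)
  qed (use G T sub cnt in \<open>auto simp: schedule_def\<close>)
  thus ?thesis by (auto simp: design_def)
qed

text \<open>Turns uniqueness of a block, or of a shift, into a count that is 0 or 1.\<close>

lemma sum_of_bool_unique:
  assumes "finite I" and "\<And>i j. i \<in> I \<Longrightarrow> j \<in> I \<Longrightarrow> P i \<Longrightarrow> P j \<Longrightarrow> i = j"
  shows "(\<Sum>i\<in>I. of_bool (P i)) = (of_bool (\<exists>i\<in>I. P i) :: nat)"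
proof (cases "\<exists>i\<in>I. P i")
  case True
  then obtain i where i: "i \<in> I" "P i" by blast
  hence "(\<Sum>j\<in>I. of_bool (P j)) = (\<Sum>j\<in>I. if j = i then 1 else (0 :: nat))"
    using assms(2) by (intro sum.cong) auto
  thus ?thesis using i assms(1) by (auto simp: sum.delta)
qed auto

text \<open>A pair of distinct points is counted by its one block, and the additional meeting of an
  unmarried player by the one \<open>U i\<close> that contains it.\<close>

lemma design_pbd:
  assumes fin: "finite I" "finite X"
    and des: "\<And>i. i \<in> I \<Longrightarrow> design (B i) {} (U i)"
    and sub: "\<And>i. i \<in> I \<Longrightarrow> B i \<subseteq> X"
    and pair: "\<And>x y. x \<in> X \<Longrightarrow> y \<in> X \<Longrightarrow> x \<noteq> y \<Longrightarrow> \<exists>!i. i \<in> I \<and> x \<in> B i \<and> y \<in> B i"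
    and disj: "disjoint_family_on U I"
  shows "design X {} (\<Union>i\<in>I. U i)"
proof -
  have "\<forall>i\<in>I. \<exists>\<sigma> G. schedule (B i) {} (U i) \<sigma> G"
    using des by (auto simp: design_def)
  then obtain \<sigma> G where G: "\<And>i. i \<in> I \<Longrightarrow> schedule (B i) {} (U i) (\<sigma> i) (G i)"
    by metis
  \<comment> \<open>Disjointness of the \<open>U i\<close> makes the block of an unmarried player
    unique, so the local involutions combine to \<open>\<rho>\<close>; elsewhere \<open>ix\<close>
    is unspecified.\<close>
  define ix where "ix x = (THE i. i \<in> I \<and> x \<in> U i)" for x
  have ix: "ix x = i" if "i \<in> I" "x \<in> U i" for x i
    unfolding ix_def using that disj by (intro the_equality) (auto simp: disjoint_family_on_def)
  define \<rho> where "\<rho> x = \<sigma> (ix x) x" for x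
  have \<rho>: "\<rho> x = \<sigma> i x" if "i \<in> I" "x \<in> U i" for x i
    using ix[OF that] by (simp add: \<rho>_def)
  have UB: "U i \<subseteq> B i" if "i \<in> I" for i
    using G[OF that] by (auto simp: schedule_def)
  have cnt: "count (meetings \<kappa> (\<Sum>i\<in>I. G i)) (x, y) =
      of_bool (joined X {} x y) + of_bool (x \<in> (\<Union>i\<in>I. U i) \<and> y = mate \<kappa> \<rho> x)" for \<kappa> x y
  proof -
    have "count (meetings \<kappa> (\<Sum>i\<in>I. G i)) (x, y) =
        (\<Sum>i\<in>I. of_bool (joined (B i) {} x y) + of_bool (x \<in> U i \<and> y = mate \<kappa> (\<sigma> i) x))"
      unfolding meetings_sum count_sum using G by (intro sum.cong) (auto simp: schedule_def)
    also have "\<dots> = (\<Sum>i\<in>I. of_bool (joined (B i) {} x y)) +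
        (\<Sum>i\<in>I. of_bool (x \<in> U i \<and> y = mate \<kappa> (\<sigma> i) x))"
      by (rule sum.distrib)
    also have "(\<Sum>i\<in>I. of_bool (joined (B i) {} x y)) = (of_bool (\<exists>i\<in>I. joined (B i) {} x y) :: nat)"
    proof (rule sum_of_bool_unique[OF fin(1)])
      fix i j assume "i \<in> I" "j \<in> I" "joined (B i) {} x y" "joined (B j) {} x y"
      moreover from this have "x \<in> X" "y \<in> X" "x \<noteq> y" using sub by (auto simp: joined_def)
      ultimately show "i = j" using pair[of x y] by (auto simp: joined_def)
    qed
    also have "(\<exists>i\<in>I. joined (B i) {} x y) \<longleftrightarrow> joined X {} x y"
      using sub pair[of x y] by (auto simp: joined_def)
    also have "(\<Sum>i\<in>I. of_bool (x \<in> U i \<and> y = mate \<kappa> (\<sigma> i) x)) =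
        (of_bool (\<exists>i\<in>I. x \<in> U i \<and> y = mate \<kappa> (\<sigma> i) x) :: nat)"
      using disj by (intro sum_of_bool_unique[OF fin(1)]) (auto simp: disjoint_family_on_def)
    also have "(\<exists>i\<in>I. x \<in> U i \<and> y = mate \<kappa> (\<sigma> i) x) \<longleftrightarrow> x \<in> (\<Union>i\<in>I. U i) \<and> y = mate \<kappa> \<rho> x"
      using \<rho> by (auto simp: mate_def)
    finally show ?thesis .
  qed
  have "schedule X {} (\<Union>i\<in>I. U i) \<rho> (\<Sum>i\<in>I. G i)"
    unfolding schedule_def
  proof (intro conjI allI)
    show "\<forall>x\<in>\<Union>i\<in>I. U i. \<rho> x \<in> (\<Union>i\<in>I. U i) \<and> \<rho> x \<noteq> x \<and> \<rho> (\<rho> x) = x"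
    proof
      fix x assume "x \<in> (\<Union>i\<in>I. U i)"
      then obtain i where i: "i \<in> I" "x \<in> U i" by blast
      hence "\<sigma> i x \<in> U i" "\<sigma> i x \<noteq> x" "\<sigma> i (\<sigma> i x) = x" using G by (auto simp: schedule_def)
      thus "\<rho> x \<in> (\<Union>i\<in>I. U i) \<and> \<rho> x \<noteq> x \<and> \<rho> (\<rho> x) = x"
        using \<rho>[OF i] \<rho>[OF i(1) \<open>\<sigma> i x \<in> U i\<close>] i by auto
    qed
    show "(\<Union>i\<in>I. U i) \<subseteq> X - {}" using UB sub by blast
  qed (use fin cnt in auto)
  thus ?thesis by (auto simp: design_def)
qed

section \<open>Renaming the players\<close>

lemma count_image_map_prod:
  assumes "inj_on f X" and "set_mset M \<subseteq> X \<times> X" and "x \<in> X" and "y \<in> X"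
  shows "count (image_mset (map_prod f f) M) (f x, f y) = count M (x, y)"
proof -
  have "a \<in> X \<and> b \<in> X" if "(a, b) \<in># M" for a b
    using assms(2) that by auto
  hence "map_prod f f -` {(f x, f y)} \<inter> set_mset M = {(x, y)} \<inter> set_mset M"
    using assms(3,4) by (auto simp: inj_on_eq_iff[OF assms(1)])
  thus ?thesis by (cases "(x, y) \<in># M") (auto simp: count_image_mset not_in_iff)
qed

lemma design_bij:
  assumes des: "design X H U" and f: "bij_betw f X Y"
  shows "design Y (f ` H) (f ` U)"
proof -
  obtain \<sigma> G where G: "schedule X H U \<sigma> G" using des by (auto simp: design_def)
  define h where "h = inv_into X f"
  have inj: "inj_on f X" and im: "f ` X = Y" using f by (auto simp: bij_betw_def)
  have h: "h (f x) = x" if "x \<in> X" for x using inj that by (simp add: h_def)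
  have sub: "H \<subseteq> X" "U \<subseteq> X - H" and fin: "finite X"
    and \<sigma>: "\<And>x. x \<in> U \<Longrightarrow> \<sigma> x \<in> U \<and> \<sigma> x \<noteq> x \<and> \<sigma> (\<sigma> x) = x"
    and cnt: "\<And>\<kappa> x y. count (meetings \<kappa> G) (x, y) =
        of_bool (joined X H x y) + of_bool (x \<in> U \<and> y = mate \<kappa> \<sigma> x)"
    using G by (auto simp: schedule_def)
  define \<rho> where "\<rho> = f \<circ> \<sigma> \<circ> h"
  have \<rho>: "\<rho> (f x) = f (\<sigma> x)" if "x \<in> U" for x using that sub h by (auto simp: \<rho>_def)
  \<comment> \<open>\<open>f\<close> is injective on \<open>X\<close> only. All pairs that meet lie
    in \<open>X \<times> X\<close>, so no two of them collide under \<open>f\<close>.\<close>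
  have supp: "set_mset (meetings \<kappa> G) \<subseteq> X \<times> X" for \<kappa>
  proof
    fix p assume p: "p \<in># meetings \<kappa> G"
    obtain x y where [simp]: "p = (x, y)" by (cases p)
    have "count (meetings \<kappa> G) (x, y) > 0" using p by simp
    hence "joined X H x y \<or> x \<in> U \<and> y = mate \<kappa> \<sigma> x" unfolding cnt by (auto split: if_splits)
    thus "p \<in> X \<times> X" using sub \<sigma>[of x] by (auto simp: joined_def mate_def split: if_splits)
  qed
  have inX: "f x \<in> f ` A \<longleftrightarrow> x \<in> A" if "A \<subseteq> X" "x \<in> X" for x A
    using inj_on_image_mem_iff[OF inj that(2,1)] .
  have "count (meetings \<kappa> (image_mset (map_match f) G)) (x, y) =
      of_bool (joined Y (f ` H) x y) + of_bool (x \<in> f ` U \<and> y = mate \<kappa> \<rho> x)" for \<kappa> x y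
  proof (cases "x \<in> Y \<and> y \<in> Y")
    case True
    then obtain a b where ab: "a \<in> X" "b \<in> X" "x = f a" "y = f b" using im by blast
    have "count (meetings \<kappa> (image_mset (map_match f) G)) (x, y) = count (meetings \<kappa> G) (a, b)"
      unfolding meetings_image_mset ab by (rule count_image_map_prod[OF inj supp ab(1,2)])
    moreover have "joined Y (f ` H) x y = joined X H a b"
      using ab inX[OF sub(1) ab(1)] inX[OF sub(1) ab(2)] True
      by (simp add: joined_def inj_on_eq_iff[OF inj])
    moreover have "(x \<in> f ` U \<and> y = mate \<kappa> \<rho> x) = (a \<in> U \<and> b = mate \<kappa> \<sigma> a)"
    proof (cases "a \<in> U")
      case True
      hence "\<sigma> a \<in> X" using \<sigma> sub by blast
      hence "f b = f (\<sigma> a) \<longleftrightarrow> b = \<sigma> a" "f b = f a \<longleftrightarrow> b = a"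
        using ab by (simp_all add: inj_on_eq_iff[OF inj])
      thus ?thesis using True ab \<rho>[OF True] by (simp add: mate_def)
    next
      case False
      hence "x \<notin> f ` U" using ab inX[of U a] sub by auto
      thus ?thesis using False by simp
    qed
    ultimately show ?thesis using cnt by simp
  next
    case False
    have "(x, y) \<notin># meetings \<kappa> (image_mset (map_match f) G)"
      unfolding meetings_image_mset using supp[of \<kappa>] False im by auto
    moreover have "\<not> (x \<in> f ` U \<and> y = mate \<kappa> \<rho> x)"
    proof
      assume asm: "x \<in> f ` U \<and> y = mate \<kappa> \<rho> x"
      then obtain a where a: "a \<in> U" "x = f a" by blast
      hence "a \<in> X" "\<sigma> a \<in> X" using sub \<sigma>[of a] by auto
      thus False using asm a \<rho>[OF a(1)] False im by (auto simp: mate_def split: if_splits)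
    qed
    ultimately show ?thesis using False by (auto simp: not_in_iff joined_def)
  qed
  moreover have "\<forall>x\<in>f ` U. \<rho> x \<in> f ` U \<and> \<rho> x \<noteq> x \<and> \<rho> (\<rho> x) = x"
  proof
    fix x assume "x \<in> f ` U"
    then obtain a where a: "a \<in> U" "x = f a" by blast
    moreover from a have "a \<in> X" "\<sigma> a \<in> X" using \<sigma>[of a] sub by auto
    hence "f (\<sigma> a) \<noteq> f a" using a \<sigma>[of a] by (simp add: inj_on_eq_iff[OF inj])
    ultimately show "\<rho> x \<in> f ` U \<and> \<rho> x \<noteq> x \<and> \<rho> (\<rho> x) = x"
      using \<rho>[of a] \<rho>[of "\<sigma> a"] \<sigma>[of a] by simp
  qed
  moreover have "f ` U \<subseteq> Y - f ` H"
  proof -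
    have "f ` (U \<inter> H) = f ` U \<inter> f ` H" using sub by (intro inj_on_image_Int[OF inj]) auto
    thus ?thesis using sub im by blast
  qed
  ultimately have "schedule Y (f ` H) (f ` U) \<rho> (image_mset (map_match f) G)"
    using fin im sub by (auto simp: schedule_def)
  thus ?thesis by (auto simp: design_def)
qed

text \<open>Only the numbers of players and of unmarried players matter, so the unmarried ones are
  taken to be the last \<open>n - k\<close>. The bound on \<open>k\<close> is stated because the
  interval would silently be empty for larger values.\<close>

definition tournament :: "nat \<Rightarrow> nat \<Rightarrow> bool" where
  "tournament n k \<longleftrightarrow> k \<le> n \<and> design {..<n} {} {k..<n}"

text \<open>A bijection of the unmarried and one of the married players glue to a bijection carrying
  \<open>X\<close> to \<open>Y\<close> and \<open>U\<close> to \<open>V\<close>.\<close>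

lemma design_same_card:
  assumes des: "design X {} U" and fin: "finite Y" and card: "card Y = card X"
    and V: "V \<subseteq> Y" "card V = card U"
  shows "design Y {} V"
proof -
  have X: "finite X" "U \<subseteq> X" using des by (auto simp: design_def schedule_def)
  obtain f where f: "bij_betw f U V"
    using V(2) finite_subset[OF V(1) fin] finite_subset[OF X(2,1)] finite_same_card_bij by metis
  have "card (X - U) = card (Y - V)"
    using X V card fin by (simp add: card_Diff_subset finite_subset)
  then obtain g where g: "bij_betw g (X - U) (Y - V)"
    using X(1) fin finite_same_card_bij by (metis finite_Diff)
  define h where "h x = (if x \<in> U then f x else g x)" for x
  have hU: "bij_betw h U V" using f by (subst bij_betw_cong[of _ h f]) (auto simp: h_def)
  have "bij_betw h (X - U) (Y - V)" using g by (subst bij_betw_cong[of _ h g]) (auto simp: h_def)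
  from bij_betw_combine[OF hU this] have "bij_betw h X Y" using X V by (simp add: Un_absorb1)
  from design_bij[OF des this] show ?thesis using hU by (simp add: bij_betw_def)
qed

lemma design_tournament:
  assumes "design X {} U" and "card X = n" and "card U + k = n"
  shows "tournament n k"
proof -
  have "design {..<n} {} {k..<n}"
    by (rule design_same_card[OF assms(1)]) (use assms(2,3) in auto)
  thus ?thesis using assms(3) by (simp add: tournament_def)
qed

lemma tournament_design:
  assumes "tournament n k" and "finite Y" and "card Y = n" and "V \<subseteq> Y" and "card V + k = n"
  shows "design Y {} V"
proof (rule design_same_card)
  show "design {..<n} {} {k..<n}" using assms(1) by (simp add: tournament_def)
qed (use assms(2-5) in auto)

section \<open>From tournaments to CMDRRs\<close>

lemma tournament_imp_CMDRR_exists: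
  assumes "tournament n k"
  shows "CMDRR_exists n k"
proof -
  define U where "U = {k..<n}"
  obtain \<sigma> M where M: "schedule {..<n} {} U \<sigma> M" and kn: "k \<le> n"
    using assms by (auto simp: tournament_def design_def U_def)
  have \<sigma>: "\<And>x. x \<in> U \<Longrightarrow> \<sigma> x \<in> U \<and> \<sigma> x \<noteq> x \<and> \<sigma> (\<sigma> x) = x"
    and cnt: "\<And>\<kappa> x y. count (meetings \<kappa> M) (x, y) =
        of_bool (joined {..<n} {} x y) + of_bool (x \<in> U \<and> y = mate \<kappa> \<sigma> x)"
    using M by (auto simp: schedule_def)
  have Un: "x < n" if "x \<in> U" for x using that by (simp add: U_def)
  have fixfree: "x \<notin> U" if "x = \<sigma> x" for x using \<sigma>[of x] that by metis
  have mem: "joined {..<n} {} x y \<or> (x \<in> U \<and> y = mate \<kappa> \<sigma> x)"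
    if "g \<in># M" "(x, y) \<in> set (meets \<kappa> g)" for g \<kappa> x y
  proof -
    from that have "(x, y) \<in># meetings \<kappa> M" by (auto simp: meetings_def)
    hence "count (meetings \<kappa> M) (x, y) > 0" by simp
    thus ?thesis by (auto simp: cnt split: if_splits)
  qed
  have wf: "a < n \<and> b < n \<and> c < n \<and> d < n \<and> a \<noteq> c \<and> b \<noteq> d \<and>
      (a = b \<longrightarrow> a \<in> U) \<and> (a = d \<longrightarrow> a \<in> U) \<and> (c = b \<longrightarrow> c \<in> U) \<and> (c = d \<longrightarrow> c \<in> U)"
    if g: "(a, b, c, d) \<in># M" for a b c d
    using mem[OF g, of a b Partners] mem[OF g, of c d Partners] mem[OF g, of a d Opponents]
      mem[OF g, of c b Opponents] mem[OF g, of a c Men] mem[OF g, of b d Women]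
    using \<sigma> Un fixfree by (auto simp: joined_def mate_def)
  \<comment> \<open>The counts of \<open>is_CMDRR\<close> range over a set of games. A repeated game
    would make its first team partners twice, but a partner count is at most 1:
    \<open>joined\<close> asks for distinct names, the mate in this role for equal ones.\<close>
  have single: "M = mset_set (set_mset M)"
  proof (rule multiset_eqI)
    fix g :: "nat match"
    obtain a b c d where g: "g = (a, b, c, d)" by (cases g)
    have "\<not> Suc 1 \<le> count M g"
    proof
      assume "Suc 1 \<le> count M g"
      hence "replicate_mset 2 g \<subseteq># M"
        unfolding count_le_replicate_mset_subset_eq[symmetric] by simp
      then obtain N where "M = replicate_mset 2 g + N" by (metis mset_subset_eq_exists_conv)
      hence "M = {#g, g#} + N" by (simp add: numeral_2_eq_2)
      hence "count (meetings Partners M) (a, b) \<ge> 2" by (simp add: g)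
      moreover have "count (meetings Partners M) (a, b) \<le> 1"
        unfolding cnt by (auto simp: joined_def mate_def)
      ultimately show False by simp
    qed
    hence "g \<in># M \<Longrightarrow> count M g = 1"
      unfolding count_greater_zero_iff[symmetric] by linarith
    thus "count M g = count (mset_set (set_mset M)) g"
      by (cases "g \<in># M") (auto simp: not_in_iff)
  qed
  define A where "A = set_mset M"
  have finA: "finite A" by (simp add: A_def)
  have sumA: "count (meetings \<kappa> M) p = (\<Sum>g\<in>A. count_list (meets \<kappa> g) p)" for \<kappa> p
  proof -
    have "meetings \<kappa> M = (\<Sum>g\<in>A. mset (meets \<kappa> g))"
      by (subst single) (simp add: meetings_def sum_unfold_sum_mset A_def)
    thus ?thesis by (simp add: count_sum count_mset)
  qed
  have neq: "a \<noteq> c" "b \<noteq> d" if "(a, b, c, d) \<in> A" for a b c d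
    using wf[of a b c d] that by (simp_all add: A_def)
  \<comment> \<open>Because \<open>a \<noteq> c\<close> and \<open>b \<noteq> d\<close>, the two
    pairs of a game are distinct in every role, so that the number of occurrences in its list is 0
    or 1.\<close>
  have card_eq: "card {g \<in> A. P g} = count (meetings \<kappa> M) p"
    if "\<And>g. g \<in> A \<Longrightarrow> count_list (meets \<kappa> g) p = of_bool (P g)" for P \<kappa> p
  proof -
    have "count (meetings \<kappa> M) p = (\<Sum>g\<in>A. of_bool (P g))"
      unfolding sumA using that by (intro sum.cong) auto
    also have "\<dots> = card {g \<in> A. P g}" using finA by (simp add: sum_of_bool_eq Int_def)
    finally show ?thesis ..
  qed
  have pc: "partners_count A m w = count (meetings Partners M) (m, w)" for m w
    unfolding partners_count_def
      by (intro card_eq) (auto simp: of_bool_def dest: neq split: if_splits)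
  have oc: "mw_opp_count A m w = count (meetings Opponents M) (m, w)" for m w
    unfolding mw_opp_count_def
      by (intro card_eq) (auto simp: of_bool_def dest: neq split: if_splits)
  have mc: "men_opp_count A x y = count (meetings Men M) (x, y)" if "x \<noteq> y" for x y
    unfolding men_opp_count_def
      using that by (intro card_eq) (auto simp: of_bool_def dest: neq split: if_splits)
  have wc: "women_opp_count A x y = count (meetings Women M) (x, y)" if "x \<noteq> y" for x y
    unfolding women_opp_count_def
      using that by (intro card_eq) (auto simp: of_bool_def dest: neq split: if_splits)
  define S where "S = (\<lambda>x. (x, x)) ` {..<k}"
  have fstS: "fst ` S = {..<k}" and sndS: "snd ` S = {..<k}" by (auto simp: S_def image_image)
  have same: "same_sex_ok n {..<k} opp"
    if "\<And>x y. x \<noteq> y \<Longrightarrow> opp x y = count (meetings \<kappa> M) (x, y)" "\<kappa> = Men \<or> \<kappa> = Women" for opp \<kappa>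
    unfolding same_sex_ok_def
  proof (intro conjI allI impI)
    fix x y assume "x < n" "x \<in> {..<k}" "y < n" "y \<noteq> x"
    thus "opp x y = 1" using that by (auto simp: cnt joined_def U_def)
  next
    fix x assume x: "x < n" "x \<notin> {..<k}"
    hence "x \<in> U" by (simp add: U_def)
    note z = \<sigma>[OF this]
    have opp: "opp x y = of_bool (y < n) + of_bool (y = \<sigma> x)" if "y \<noteq> x" for y
      using that x(1) \<open>x \<in> U\<close> that \<open>\<kappa> = Men \<or> \<kappa> = Women\<close>
        \<open>\<And>x y. x \<noteq> y \<Longrightarrow> opp x y = count (meetings \<kappa> M) (x, y)\<close>[of x y]
      by (simp add: cnt joined_def mate_def)
    have "\<sigma> x < n" "\<sigma> x \<notin> {..<k}" using z by (auto simp: U_def)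
    thus "\<exists>z<n. z \<noteq> x \<and> z \<notin> {..<k} \<and> opp x z = 2 \<and> (\<forall>y<n. y \<noteq> x \<and> y \<noteq> z \<longrightarrow> opp x y = 1)"
      using z opp by (intro exI[of _ "\<sigma> x"]) auto
  qed
  have "is_CMDRR n k S A"
    unfolding is_CMDRR_def fstS sndS
  proof (intro conjI)
    show "spouse_matching n k S"
      using kn by (auto simp: spouse_matching_def S_def card_image inj_on_def)
    show "\<forall>g\<in>A. wf_game n g" using wf by (auto simp: wf_game_def A_def)
    show "\<forall>(a, b, c, d)\<in>A. (a, b) \<notin> S \<and> (a, d) \<notin> S \<and> (c, b) \<notin> S \<and> (c, d) \<notin> S"
    proof (clarify, goal_cases)
      case (1 a b c d)
      have "(x, y) \<in> S \<longleftrightarrow> x = y \<and> x \<notin> U" if "x < n" for x y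
        using that by (auto simp: S_def U_def)
      thus ?case using wf[of a b c d] 1 by (simp add: A_def)
    qed
    show "\<forall>m<n. \<forall>w<n. (m, w) \<notin> S \<longrightarrow> partners_count A m w = 1 \<and> mw_opp_count A m w = 1"
      by (auto simp: pc oc cnt joined_def mate_def U_def S_def)
    show "same_sex_ok n {..<k} (men_opp_count A)" using mc by (intro same[of _ Men]) auto
    show "same_sex_ok n {..<k} (women_opp_count A)" using wc by (intro same[of _ Women]) auto
  qed (rule finA)
  thus ?thesis by (auto simp: CMDRR_exists_def)
qed

section \<open>Cyclic starters\<close>

text \<open>Sorting is used only to compare two lists as multisets; sortedness is never needed.\<close>

fun merge_by :: "('a \<Rightarrow> int) \<Rightarrow> 'a list \<Rightarrow> 'a list \<Rightarrow> 'a list" where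
  "merge_by f [] ys = ys"
| "merge_by f xs [] = xs"
| "merge_by f (x # xs) (y # ys) =
     (if f x \<le> f y then x # merge_by f xs (y # ys) else y # merge_by f (x # xs) ys)"

fun merge_pairs :: "('a \<Rightarrow> int) \<Rightarrow> 'a list list \<Rightarrow> 'a list list" where
  "merge_pairs f (xs # ys # zss) = merge_by f xs ys # merge_pairs f zss"
| "merge_pairs f zss = zss"

lemma length_merge_pairs: "length (merge_pairs f zss) \<le> length zss"
  by (induction f zss rule: merge_pairs.induct) auto

function merge_all :: "('a \<Rightarrow> int) \<Rightarrow> 'a list list \<Rightarrow> 'a list" where
  "merge_all f [] = []"
| "merge_all f [xs] = xs"
| "merge_all f (xs # ys # zss) = merge_all f (merge_pairs f (xs # ys # zss))"
  by pat_completeness auto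
termination
  by (relation "measure (\<lambda>(f, zss). length zss)") (auto intro: le_less_trans[OF length_merge_pairs])

text \<open>Merging neighbouring lists bottom-up keeps the number of comparisons small when the long
  tables below are sorted by rewriting.\<close>

definition merge_sort_by :: "('a \<Rightarrow> int) \<Rightarrow> 'a list \<Rightarrow> 'a list" where
  "merge_sort_by f xs = merge_all f (map (\<lambda>x. [x]) xs)"

lemma mset_merge_by: "mset (merge_by f xs ys) = mset xs + mset ys"
  by (induction f xs ys rule: merge_by.induct) auto

lemma mset_merge_pairs: "mset (concat (merge_pairs f zss)) = mset (concat zss)"
  by (induction f zss rule: merge_pairs.induct) (auto simp: mset_merge_by)

lemma mset_merge_all: "mset (merge_all f zss) = mset (concat zss)"
  by (induction f zss rule: merge_all.induct) (auto simp: mset_merge_pairs mset_merge_by)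

lemma mset_merge_sort_by: "mset (merge_sort_by f xs) = mset xs"
proof -
  have "concat (map (\<lambda>x. [x]) xs) = xs" by (induction xs) auto
  thus ?thesis by (simp add: merge_sort_by_def mset_merge_all)
qed

text \<open>A point (a, i) with a < t is the residue i in the orbit a of the cyclic group of order m. The
  points (a, 0) with a \<ge> t are fixed by the group and form the hole.\<close>

type_synonym point = "int \<times> int"

fun shift :: "int \<Rightarrow> int \<Rightarrow> int \<Rightarrow> point \<Rightarrow> point" where
  "shift m t j (a, i) = (if a < t then (a, (i + j) mod m) else (a, i))"

fun is_point :: "int \<Rightarrow> int \<Rightarrow> int \<Rightarrow> point \<Rightarrow> bool" where
  "is_point m t N (a, i) \<longleftrightarrow> 0 \<le> a \<and> 0 \<le> i \<and> (if a < t then i < m else a < N \<and> i = 0)"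

text \<open>The invariant that separates the orbits of ordered pairs. If one point is fixed, the
  pairs between its orbit and that of the other point form a single orbit, whose difference is set
  to 0. The inner conditional is the residue of \<open>j - i\<close> without a division, as
  \<open>residue_shift_diff\<close> shows.\<close>

fun diff_class :: "int \<Rightarrow> int \<Rightarrow> point \<times> point \<Rightarrow> int \<times> int \<times> int" where
  "diff_class m t ((a, i), (b, j)) =
     (a, b, if a < t \<and> b < t then if i \<le> j then j - i else j - i + m else 0)"

lemma shift_shift: "shift m t j (shift m t k p) = shift m t (k + j) p"
  by (cases p) (auto simp: mod_add_left_eq add.assoc)

section \<open>Orbits of ordered pairs under the cyclic group\<close>

lemma residue_shift_unique:
  fixes m i i' :: int
  assumes "0 \<le> i" "i < m" "0 \<le> i'" "i' < m" "0 \<le> j" "j < m"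
  shows "(i + j) mod m = i' \<longleftrightarrow> j = (i' - i) mod m"
proof
  assume "(i + j) mod m = i'"
  hence "(i' - i) mod m = (i + j - i) mod m" by (metis mod_diff_left_eq)
  thus "j = (i' - i) mod m" using assms by simp
next
  assume "j = (i' - i) mod m"
  hence "(i + j) mod m = (i + (i' - i)) mod m" by (metis mod_add_right_eq)
  thus "(i + j) mod m = i'" using assms by simp
qed

lemma residue_shift_diff:
  fixes m i k :: int
  assumes "0 \<le> i" "i < m" "0 \<le> k" "k < m"
  shows "(if i \<le> k then k - i else k - i + m) = (k - i) mod m"
proof (cases "i \<le> k")
  case False
  have "(k - i) mod m = (k - i + m) mod m" by simp
  also have "\<dots> = k - i + m" using assms False by (intro mod_pos_pos_trivial) auto
  finally show ?thesis using False by simp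
qed (use assms in auto)

text \<open>One of the two points moves, so at most one shift carries the pair to a given one. Such
  a shift exists exactly when the orbits match and, if both points move, both residues ask for the
  same shift, which means equal differences.\<close>

lemma sum_shifts:
  assumes m: "0 < m" and t: "t \<le> N"
    and p: "is_point m t N p" "is_point m t N q" "is_point m t N p'" "is_point m t N q'"
    and fin: "fst p < t \<or> fst q < t"
  shows "(\<Sum>j\<in>{0..<m}. of_bool ((shift m t j p, shift m t j q) = (p', q'))) =
    (of_bool (diff_class m t (p, q) = diff_class m t (p', q')) :: nat)"
proof -
  obtain a i b k a' i' b' k' where [simp]: "p = (a, i)" "q = (b, k)" "p' = (a', i')" "q' = (b', k')"
    by (metis surj_pair)
  define J where "J j \<longleftrightarrow> (shift m t j p, shift m t j q) = (p', q')" for j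
  have J: "J j \<longleftrightarrow> a = a' \<and> b = b' \<and> (a < t \<longrightarrow> j = (i' - i) mod m) \<and> (b < t \<longrightarrow> j = (k' - k) mod m)"
    if "j \<in> {0..<m}" for j
    using that p residue_shift_unique[of i m i' j] residue_shift_unique[of k m k' j]
    by (auto simp: J_def)
  have "(\<Sum>j\<in>{0..<m}. of_bool (J j)) = (of_bool (\<exists>j\<in>{0..<m}. J j) :: nat)"
    using fin by (intro sum_of_bool_unique) (auto simp: J)
  moreover have "(\<exists>j\<in>{0..<m}. J j) \<longleftrightarrow> diff_class m t (p, q) = diff_class m t (p', q')"
  proof -
    have ex: "(\<exists>j\<in>{0..<m}. J j) \<longleftrightarrow> a = a' \<and> b = b' \<and> (a < t \<and> b < t \<longrightarrow>
        (i' - i) mod m = (k' - k) mod m)"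
      (is "?L \<longleftrightarrow> ?R")
    proof
      assume ?L thus ?R using J by auto
    next
      assume R: ?R
      show ?L
      proof (cases "a < t")
        case True
        thus ?L using R J[of "(i' - i) mod m"] m by (intro bexI[of _ "(i' - i) mod m"]) auto
      next
        case False
        thus ?L using R J[of "(k' - k) mod m"] m by (intro bexI[of _ "(k' - k) mod m"]) auto
      qed
    qed
    have "(i' - i) mod m = (k' - k) mod m \<longleftrightarrow> (k - i) mod m = (k' - i') mod m"
      by (auto simp: mod_eq_dvd_iff algebra_simps)
    thus ?thesis
      unfolding ex using p residue_shift_diff[of i m k] residue_shift_diff[of i' m k'] by auto
  qed
  ultimately show ?thesis unfolding J_def by simp
qed

text \<open>The games in shorts are invariant, up to exchanging the teams, under the shift by m div 2, so that half
  of the group develops them.\<close>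

definition develop :: "int \<Rightarrow> int \<Rightarrow> point match list \<Rightarrow> point match list \<Rightarrow> point match multiset" where
  "develop m t base shorts =
     (\<Sum>j\<in>{0..<m}. image_mset (map_match (shift m t j)) (mset base)) +
     (\<Sum>j\<in>{0..<m div 2}. image_mset (map_match (shift m t j)) (mset shorts))"

text \<open>In every role the second pair of a short game is its first pair shifted by half the
  group. Listing the first pair alone and developing it over the whole group therefore counts the
  half orbit of the game correctly.\<close>

definition base_meets :: "meeting \<Rightarrow> 'a match list \<Rightarrow> 'a match list \<Rightarrow> ('a \<times> 'a) list" where
  "base_meets \<kappa> base shorts = concat (map (meets \<kappa>) base) @ map (\<lambda>g. hd (meets \<kappa> g)) shorts"

fun is_short :: "int \<Rightarrow> int \<Rightarrow> point match \<Rightarrow> bool" where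
  "is_short m t (a, b, c, d) \<longleftrightarrow> even m \<and> fst a < t \<and> fst b < t \<and>
     c = shift m t (m div 2) a \<and> d = shift m t (m div 2) b"

fun on_points :: "('a \<Rightarrow> bool) \<Rightarrow> 'a match \<Rightarrow> bool" where
  "on_points P (a, b, c, d) \<longleftrightarrow> P a \<and> P b \<and> P c \<and> P d"

abbreviation shift_pair :: "int \<Rightarrow> int \<Rightarrow> int \<Rightarrow> point \<times> point \<Rightarrow> point \<times> point" where
  "shift_pair m t j \<equiv> map_prod (shift m t j) (shift m t j)"

lemma shift_self: "is_point m t N p \<Longrightarrow> fst p < t \<Longrightarrow> shift m t m p = p"
  by (cases p) auto

text \<open>Shifting twice by \<open>m div 2\<close> is the identity, so the half shift interchanges
  the two teams.\<close>

lemma meets_short: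
  assumes "is_short m t g" and "on_points (is_point m t N) g"
  shows "meets \<kappa> g = [hd (meets \<kappa> g), shift_pair m t (m div 2) (hd (meets \<kappa> g))]"
proof -
  obtain a b c d where g: "g = (a, b, c, d)" by (cases g)
  have "m div 2 + m div 2 = m" using assms by (auto simp: g)
  hence "shift m t (m div 2) c = a" "shift m t (m div 2) d = b"
    using assms by (auto simp: g shift_shift shift_self)
  thus ?thesis using assms by (cases \<kappa>) (auto simp: g)
qed

text \<open>The shifts from \<open>m div 2\<close> on are the lower ones composed with the half
  shift, and so produce the second pairs.\<close>

lemma meetings_short_orbit:
  assumes "is_short m t g" and "on_points (is_point m t N) g" and "0 < m"
  shows "(\<Sum>j\<in>{0..<m div 2}. mset (meets \<kappa> (map_match (shift m t j) g))) =
    (\<Sum>j\<in>{0..<m}. {#shift_pair m t j (hd (meets \<kappa> g))#})"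
proof -
  define e where "e = hd (meets \<kappa> g)"
  define h where "h = m div 2"
  have "even m" using assms(1) by (cases g) auto
  hence m: "m = h + h" and h: "0 \<le> h" using assms(3) by (auto simp: h_def)
  have e: "meets \<kappa> g = [e, shift_pair m t h e]"
    using meets_short[OF assms(1,2), of \<kappa>] by (simp add: e_def h_def)
  have "(\<Sum>j\<in>{0..<m}. {#shift_pair m t j e#}) =
      (\<Sum>j\<in>{0..<h}. {#shift_pair m t j e#}) + (\<Sum>j\<in>{h..<m}. {#shift_pair m t j e#})"
    using h m by (subst sum.union_disjoint[symmetric]) (auto intro!: sum.cong)
  also have "(\<Sum>j\<in>{h..<m}. {#shift_pair m t j e#}) = (\<Sum>j\<in>{0..<h}. {#shift_pair m t (h + j) e#})"
    by (rule sum.reindex_bij_witness[of _ "\<lambda>j. h + j" "\<lambda>j. j - h"]) (auto simp: m)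
  finally have "(\<Sum>j\<in>{0..<m}. {#shift_pair m t j e#}) =
      (\<Sum>j\<in>{0..<h}. {#shift_pair m t j e#} + {#shift_pair m t (h + j) e#})"
    by (simp only: sum.distrib)
  also have "\<dots> = (\<Sum>j\<in>{0..<h}. mset (meets \<kappa> (map_match (shift m t j) g)))"
  proof -
    have "shift_pair m t j (shift_pair m t h e) = shift_pair m t (h + j) e" for j
      by (cases e) (simp only: map_prod_simp shift_shift)
    thus ?thesis unfolding meets_map_match e by (simp add: add_mset_commute)
  qed
  finally show ?thesis by (simp add: h_def e_def)
qed

lemma meetings_develop:
  assumes "\<forall>g\<in>set shorts. is_short m t g \<and> on_points (is_point m t N) g" and "0 < m"
  shows "meetings \<kappa> (develop m t base shorts) =
    (\<Sum>j\<in>{0..<m}. image_mset (shift_pair m t j) (mset (base_meets \<kappa> base shorts)))"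
proof -
  have "(\<Sum>j\<in>{0..<m div 2}. image_mset (shift_pair m t j) (meetings \<kappa> (mset shorts))) =
      (\<Sum>j\<in>{0..<m}. image_mset (shift_pair m t j) (mset (map (\<lambda>g. hd (meets \<kappa> g)) shorts)))"
    using assms(1)
  proof (induction shorts)
    case (Cons g gs)
    hence "is_short m t g" "on_points (is_point m t N) g" by auto
    note g = meetings_short_orbit[OF this assms(2), of \<kappa>]
    have "(\<Sum>j\<in>{0..<m div 2}. image_mset (shift_pair m t j) (meetings \<kappa> (mset (g # gs)))) =
        (\<Sum>j\<in>{0..<m div 2}. mset (meets \<kappa> (map_match (shift m t j) g))) +
        (\<Sum>j\<in>{0..<m div 2}. image_mset (shift_pair m t j) (meetings \<kappa> (mset gs)))"
      by (simp add: sum.distrib meets_map_match)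
    also have "\<dots> = (\<Sum>j\<in>{0..<m}. {#shift_pair m t j (hd (meets \<kappa> g))#}) +
        (\<Sum>j\<in>{0..<m}. image_mset (shift_pair m t j) (mset (map (\<lambda>g. hd (meets \<kappa> g)) gs)))"
      using g Cons by simp
    finally show ?case by (simp flip: sum.distrib)
  qed simp
  thus ?thesis
    by (simp add: develop_def base_meets_def meetings_sum meetings_image_mset meetings_mset sum.distrib)
qed

lemma count_mset_map: "count (mset (map f xs)) z = (\<Sum>x\<leftarrow>xs. of_bool (f x = z))"
  by (induction xs) auto

text \<open>The method of differences: after the two sums are exchanged, each pair of
  \<open>R\<close> has one translate equal to \<open>(x, y)\<close> if the classes agree and none
  otherwise.\<close>

lemma count_develop:
  assumes m: "0 < m" and t: "t \<le> N"
    and R: "\<forall>(p, q)\<in>set R. is_point m t N p \<and> is_point m t N q \<and> (fst p < t \<or> fst q < t)"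
    and p: "is_point m t N x" "is_point m t N y"
  shows "count (\<Sum>j\<in>{0..<m}. image_mset (shift_pair m t j) (mset R)) (x, y) =
    count (mset (map (diff_class m t) R)) (diff_class m t (x, y))"
proof -
  have "count (\<Sum>j\<in>{0..<m}. image_mset (shift_pair m t j) (mset R)) (x, y) =
      (\<Sum>j\<in>{0..<m}. \<Sum>e\<leftarrow>R. of_bool (shift_pair m t j e = (x, y)))"
    by (simp only: count_sum mset_map[symmetric] count_mset_map)
  also have "\<dots> = (\<Sum>e\<leftarrow>R. \<Sum>j\<in>{0..<m}. of_bool (shift_pair m t j e = (x, y)))"
    by (induction R) (simp_all add: sum.distrib)
  also have "\<dots> = (\<Sum>e\<leftarrow>R. of_bool (diff_class m t e = diff_class m t (x, y)))"
  proof (intro arg_cong[of _ _ sum_list] map_cong refl)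
    fix e assume "e \<in> set R"
    moreover obtain p q where e: "e = (p, q)" by (cases e)
    ultimately have "is_point m t N p" "is_point m t N q" "fst p < t \<or> fst q < t" using R by auto
    from sum_shifts[OF m t this(1,2) p this(3)] show "(\<Sum>j\<in>{0..<m}. of_bool (shift_pair m t j e =
        (x, y))) =
        (of_bool (diff_class m t e = diff_class m t (x, y)) :: nat)"
      by (simp only: e map_prod_simp)
  qed
  finally show ?thesis by (simp only: count_mset_map)
qed

text \<open>The differences that have to occur between the orbits a and b. The players of the orbits below s are
  married. Unmarried players are paired with their shift by m div 2, or, if cross holds, with the
  player of the same residue in the neighbouring orbit.\<close>

definition diffs :: "int \<Rightarrow> int \<Rightarrow> int \<Rightarrow> bool \<Rightarrow> meeting \<Rightarrow> int \<Rightarrow> int \<Rightarrow> int list" where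
  "diffs m t s cross \<kappa> a b =
    (if a < t \<and> b < t then
       (if a = b \<and> (a < s \<or> \<kappa> = Men \<or> \<kappa> = Women) then [1..m - 1] else [0..m - 1]) @
       (if (\<kappa> = Men \<or> \<kappa> = Women) \<and> s \<le> a then
          if cross then if b = (if even (a - s) then a + 1 else a - 1) then [0] else []
          else if a = b then [m div 2] else []
        else [])
     else if a < t \<or> b < t then [0] else [])"

section \<open>Comparison with the required differences\<close>

definition target :: "int \<Rightarrow> int \<Rightarrow> int \<Rightarrow> int \<Rightarrow> bool \<Rightarrow> meeting \<Rightarrow> (int \<times> int \<times> int) list" where
  "target m t s N cross \<kappa> = concat (map (\<lambda>a. concat (map (\<lambda>b. map (\<lambda>d. (a, b, d))
     (diffs m t s cross \<kappa> a b)) [0..N - 1])) [0..N - 1])"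

text \<open>The entries of \<open>F x\<close> have key \<open>x\<close>, so only the section
  belonging to \<open>f z\<close> can contain \<open>z\<close>.\<close>

lemma count_concat_map_key:
  assumes "distinct xs" and "\<And>x y. y \<in> set (F x) \<Longrightarrow> f y = x" and "f z \<in> set xs"
  shows "count (mset (concat (map F xs))) z = count (mset (F (f z))) z"
  using assms
proof (induction xs)
  case (Cons x xs)
  show ?case
  proof (cases "f z = x")
    case True
    hence "z \<notin> set (concat (map F xs))" using Cons.prems by auto
    thus ?thesis using True by (simp add: count_mset_0_iff)
  next
    case False
    hence "z \<notin> set (F x)" using Cons.prems by auto
    thus ?thesis using False Cons by (simp add: count_mset_0_iff)
  qed
qed simp

lemma count_target:
  assumes "0 \<le> a" "a < N" "0 \<le> b" "b < N"
  shows "count (mset (target m t s N cross \<kappa>)) (a, b, d) = count (mset (diffs m t s cross \<kappa> a b)) d"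
proof -
  have "count (mset (target m t s N cross \<kappa>)) (a, b, d) =
      count (mset (concat (map (\<lambda>b. map (\<lambda>d. (a, b, d))
     (diffs m t s cross \<kappa> a b)) [0..N - 1]))) (a, b, d)"
    unfolding target_def using assms by (subst count_concat_map_key[where f = fst]) auto
  also have "\<dots> = count (mset (map (\<lambda>d. (a, b, d)) (diffs m t s cross \<kappa> a b))) (a, b, d)"
    using assms by (subst count_concat_map_key[where f = "fst \<circ> snd"]) auto
  also have "\<dots> = count (mset (diffs m t s cross \<kappa> a b)) d"
  proof -
    have "count (mset (map (\<lambda>d. (a, b, d)) ds)) (a, b, d) = count (mset ds) d" for ds
      by (induction ds) auto
    thus ?thesis .
  qed
  finally show ?thesis .
qed

text \<open>The number in front is the sort key. It is harmless if two triples share a key: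
  \<open>snd\<close> recovers the triples from equal sorted lists, and ties could only make a check
  fail.\<close>

fun tag :: "int \<Rightarrow> int \<Rightarrow> int \<times> int \<times> int \<Rightarrow> int \<times> int \<times> int \<times> int" where
  "tag m N (a, b, d) = ((a * N + b) * m + d, a, b, d)"

lemma mset_eq_if_tagged_eq:
  assumes "mset (map (tag m N) xs) = mset (map (tag m N) ys)"
  shows "mset xs = mset ys"
proof -
  have "image_mset snd (mset (map (tag m N) zs)) = mset zs" for zs
    by (induction zs) auto
  thus ?thesis using assms by metis
qed

text \<open>The parity condition makes the pairing of the unmarried players an involution without
  fixed points: pairing neighbouring orbits needs an even number of them, pairing by the half shift
  an even \<open>m\<close>. Equality of sorted lists is the executable form of equality of
  multisets.\<close>

definition is_starter :: "int \<Rightarrow> int \<Rightarrow> int \<Rightarrow> int \<Rightarrow> bool \<Rightarrow> point match list \<Rightarrow> point match list \<Rightarrow>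
    bool" where
  "is_starter m t s N cross base shorts \<longleftrightarrow>
     0 < m \<and> 0 \<le> s \<and> s \<le> t \<and> t \<le> N \<and> (if cross then even (t - s) else s = t \<or> even m) \<and>
     list_all (on_points (is_point m t N)) base \<and>
     list_all (on_points (is_point m t N)) shorts \<and>
     list_all (is_short m t) shorts \<and>
     list_all (\<lambda>\<kappa>.
        merge_sort_by fst (map (tag m N) (map (diff_class m t) (base_meets \<kappa> base shorts))) =
        merge_sort_by fst (map (tag m N) (target m t s N cross \<kappa>))) [Partners, Opponents, Men, Women]"

text \<open>By \<open>count_develop\<close> the count of a pair is the number of occurrences of its
  difference class in the base games, and \<open>diffs\<close> lists what a schedule with hole
  prescribes for this class.\<close>

lemma starter_design:
  assumes st: "is_starter m t s N cross base shorts"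
  shows "design {p. is_point m t N p} {p. is_point m t N p \<and> t \<le> fst p}
    {p. is_point m t N p \<and> s \<le> fst p \<and> fst p < t}" (is "design ?X ?H ?U")
proof -
  have m: "0 < m" and st': "0 \<le> s" "s \<le> t" "t \<le> N"
    and par: "if cross then even (t - s) else s = t \<or> even m"
    and base: "\<forall>g\<in>set base. on_points (is_point m t N) g"
    and shorts: "\<forall>g\<in>set shorts. is_short m t g \<and> on_points (is_point m t N) g"
    using st by (auto simp: is_starter_def list_all_iff)
  \<comment> \<open>Exchanges neighbouring unmarried orbits, which are numbered from
    \<open>s\<close> on.\<close>
  define pr where "pr a = (if even (a - s) then a + 1 else a - 1)" for a :: int
  define \<sigma> where "\<sigma> p = (if cross then (pr (fst p), snd p) else (fst p, (snd p + m div 2) mod m))"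
    for p
  have pr: "s \<le> pr a \<and> pr a < t \<and> pr a \<noteq> a \<and> pr (pr a) = a" if "s \<le> a" "a < t" cross for a
  proof (cases "even (a - s)")
    case True
    hence "a + 1 \<noteq> t" using par that by auto
    thus ?thesis using True that by (simp add: pr_def)
  next
    case False
    hence "a \<noteq> s" by auto
    thus ?thesis using False that by (simp add: pr_def)
  qed
  have \<sigma>U: "\<sigma> x \<in> ?U \<and> \<sigma> x \<noteq> x \<and> \<sigma> (\<sigma> x) = x" if "x \<in> ?U" for x
  proof (cases cross)
    case True
    obtain a i where x: "x = (a, i)" by (cases x)
    show ?thesis using that True pr[of a] st'(1) by (auto simp: \<sigma>_def x)
  next
    case False
    obtain a i where x: "x = (a, i)" by (cases x)
    have a: "s \<le> a" "a < t" "0 \<le> i" "i < m" using that by (auto simp: x)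
    hence "even m" using par False by auto
    hence mm: "m div 2 + m div 2 = m" "0 < m div 2" "m div 2 < m" using m by auto
    have "((i + m div 2) mod m + m div 2) mod m = (i + (m div 2 + m div 2)) mod m"
      by (simp only: mod_add_left_eq add.assoc)
    also have "\<dots> = i" unfolding mm(1) using a by simp
    finally have inv: "((i + m div 2) mod m + m div 2) mod m = i" .
    have "(i + m div 2) mod m \<noteq> i"
      using residue_shift_unique[of i m i "m div 2"] a mm by auto
    thus ?thesis using False a inv m st' by (auto simp: \<sigma>_def x)
  qed
  have diffs_eq: "mset (map (diff_class m t) (base_meets \<kappa> base shorts)) =
      mset (target m t s N cross \<kappa>)" for \<kappa>
  proof (rule mset_eq_if_tagged_eq)
    have "merge_sort_by fst (map (tag m N) (map (diff_class m t) (base_meets \<kappa> base shorts))) =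
        merge_sort_by fst (map (tag m N) (target m t s N cross \<kappa>))"
      using st unfolding is_starter_def by (cases \<kappa>) auto
    thus "mset (map (tag m N) (map (diff_class m t) (base_meets \<kappa> base shorts))) =
        mset (map (tag m N) (target m t s N cross \<kappa>))"
      by (metis mset_merge_sort_by)
  qed
  have R: "\<forall>(p, q)\<in>set (base_meets \<kappa> base shorts). is_point m t N p \<and> is_point m t N q \<and>
      (fst p < t \<or> fst q < t)" for \<kappa>
  proof clarify
    fix p q assume pq: "(p, q) \<in> set (base_meets \<kappa> base shorts)"
    have "on_points (is_point m t N) g \<Longrightarrow> (p, q) \<in> set (meets \<kappa> g) \<Longrightarrow>
        is_point m t N p \<and> is_point m t N q" for g
      by (cases \<kappa>; cases g) auto
    moreover have "hd (meets \<kappa> g) \<in> set (meets \<kappa> g)" for g :: "point match"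
      by (cases \<kappa>; cases g) auto
    moreover from pq
      have "(\<exists>g\<in>set base. (p, q) \<in> set (meets \<kappa> g)) \<or> (\<exists>g\<in>set shorts. (p, q) = hd (meets \<kappa> g))"
      unfolding base_meets_def set_append set_concat set_map by blast
    ultimately have "is_point m t N p \<and> is_point m t N q"
      using base shorts by metis
    \<comment> \<open>The target has no class of two fixed points, hence no pair of the base games
      consists of two fixed points; this is what \<open>count_develop\<close> asks for.\<close>
    moreover have "diff_class m t (p, q) \<in># mset (target m t s N cross \<kappa>)"
      using pq unfolding diffs_eq[symmetric] by force
    hence "fst p < t \<or> fst q < t"
      by (cases p; cases q) (auto simp: target_def diffs_def split: if_splits)
    ultimately show "is_point m t N p \<and> is_point m t N q \<and> (fst p < t \<or> fst q < t)" by blast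
  qed
  have cnt: "count (meetings \<kappa> (develop m t base shorts)) (x, y) =
      of_bool (joined ?X ?H x y) + of_bool (x \<in> ?U \<and> y = mate \<kappa> \<sigma> x)" for \<kappa> x y
  proof (cases "is_point m t N x \<and> is_point m t N y \<and> (fst x < t \<or> fst y < t)")
    case True
    obtain a i b k where xy: "x = (a, i)" "y = (b, k)" by (metis surj_pair)
    define d where "d = (if a < t \<and> b < t then if i \<le> k then k - i else k - i + m else 0)"
    have "count (meetings \<kappa> (develop m t base shorts)) (x, y) =
        count (mset (target m t s N cross \<kappa>)) (diff_class m t (x, y))"
      unfolding meetings_develop[OF shorts m] diffs_eq[symmetric]
      using True by (intro count_develop[OF m st'(3) R]) auto
    also have "diff_class m t (x, y) = (a, b, d)" by (simp add: xy d_def)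
    also have "count (mset (target m t s N cross \<kappa>)) (a, b, d) =
        count (mset (diffs m t s cross \<kappa> a b)) d"
      using True st' by (intro count_target) (auto simp: xy split: if_splits)
    also have "\<dots> = of_bool (joined ?X ?H x y) + of_bool (x \<in> ?U \<and> y = mate \<kappa> \<sigma> x)"
    proof (cases "a < t \<and> b < t")
      case both: True
      hence ik: "0 \<le> i" "i < m" "0 \<le> k" "k < m" "0 \<le> a" "0 \<le> b" using True by (auto simp: xy)
      have d: "d = (k - i) mod m" using residue_shift_diff[of i m k] ik both by (simp add: d_def)
      have d0: "d = 0 \<longleftrightarrow> i = k" using ik both by (auto simp: d_def)
      have dr: "0 \<le> d" "d < m" using ik both by (auto simp: d_def)
      \<comment> \<open>Without \<open>cross\<close>, this difference characterises the player
        opposed twice.\<close>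
      have dh: "m div 2 = d \<longleftrightarrow> k = (i + m div 2) mod m"
        using residue_shift_unique[of i m k "m div 2"] ik d by auto
      have up: "count (mset [0..m - 1]) d = 1" "count (mset [1..m - 1]) d = of_bool (d \<noteq> 0)"
        using dr by (auto simp: distinct_count_atmost_1[THEN iffD1, OF distinct_upto])
      have j: "joined ?X ?H x y \<longleftrightarrow> \<not> (a = b \<and> d = 0)"
        using True both d0 by (auto simp: joined_def xy)
      have U: "x \<in> ?U \<longleftrightarrow> s \<le> a" using True both by (auto simp: xy)
      show ?thesis
      proof (cases "\<kappa> = Men \<or> \<kappa> = Women")
        case same: True
        have "y = mate \<kappa> \<sigma> x \<longleftrightarrow> (if cross then b = pr a \<and> d = 0 else a = b \<and> m div 2 = d)"
          unfolding dh d0 using same by (auto simp: mate_def \<sigma>_def xy)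
        thus ?thesis unfolding j U using both same up d0 by (auto simp: diffs_def pr_def)
      next
        case False
        hence "y = mate \<kappa> \<sigma> x \<longleftrightarrow> a = b \<and> d = 0" unfolding d0 by (auto simp: mate_def xy)
        thus ?thesis unfolding j U using both False up by (auto simp: diffs_def)
      qed
    next
      case False
      hence "d = 0" by (auto simp: d_def)
      moreover have "x \<notin> ?U \<or> y \<noteq> mate \<kappa> \<sigma> x"
      proof (rule ccontr)
        assume "\<not> (x \<notin> ?U \<or> y \<noteq> mate \<kappa> \<sigma> x)"
        hence "x \<in> ?U" "y \<in> ?U" using \<sigma>U[of x] by (auto simp: mate_def split: if_splits)
        thus False using False by (simp add: xy)
      qed
      moreover have "joined ?X ?H x y" using False True by (auto simp: joined_def xy)
      moreover have "diffs m t s cross \<kappa> a b = [0]" using False True by (auto simp: diffs_def xy)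
      ultimately show ?thesis by simp
    qed
    finally show ?thesis .
  next
    case False
    \<comment> \<open>Shifts preserve points and their orbits, so two players that meet are always
      points and not both fixed.\<close>
    have "(x, y) \<notin># meetings \<kappa> (develop m t base shorts)"
    proof
      assume "(x, y) \<in># meetings \<kappa> (develop m t base shorts)"
      then obtain j p q where j: "(p, q) \<in> set (base_meets \<kappa> base shorts)"
        "x = shift m t j p" "y = shift m t j q"
        unfolding meetings_develop[OF shorts m] by (auto simp: set_mset_sum)
      have sh: "is_point m t N (shift m t j p') \<and> fst (shift m t j p') = fst p'"
        if "is_point m t N p'" for p'
        using that m by (cases p') auto
      have "is_point m t N p" "is_point m t N q" "fst p < t \<or> fst q < t" using R[of \<kappa>] j(1) by auto
      thus False using sh[of p] sh[of q] j(2,3) False by simp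
    qed
    moreover have "\<not> joined ?X ?H x y" using False by (auto simp: joined_def)
    moreover have "x \<notin> ?U \<or> y \<noteq> mate \<kappa> \<sigma> x" using False \<sigma>U[of x] by (auto simp: mate_def)
    ultimately show ?thesis by (auto simp: not_in_iff)
  qed
  have "finite ?X"
  proof (rule finite_subset)
    show "?X \<subseteq> {0..<N} \<times> {0..<m}" using m st' by (auto split: if_splits)
  qed auto
  hence "schedule ?X ?H ?U \<sigma> (develop m t base shorts)"
    unfolding schedule_def
  proof (intro conjI ballI allI)
    show "?H \<subseteq> ?X" "?U \<subseteq> ?X - ?H" by auto
    show "\<sigma> x \<in> ?U" "\<sigma> x \<noteq> x" "\<sigma> (\<sigma> x) = x" if "x \<in> ?U" for x
      using \<sigma>U[OF that] by simp_all
  qed (use cnt in simp_all)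
  thus ?thesis by (auto simp: design_def)
qed

text \<open>In the tables of base games a point is a single number: p < m * t stands for (p div m, p mod m), and
  the r numbers from m * t on stand for the fixed points. A table lists only the women: the opposing
  men are those of men_pairs, which runs through their differences.\<close>

fun point_of :: "int \<Rightarrow> int \<Rightarrow> int \<Rightarrow> point" where
  "point_of m t p = (if p < m * t then (p div m, p mod m) else (p - m * t + t, 0))"

text \<open>One representative for each orbit of opposing men. Inside an orbit \<open>d\<close> and
  \<open>-d\<close> come from the same pair, so half of the differences suffice. The difference
  \<open>m div 2\<close> of an unmarried orbit then arises twice, as wanted when
  \<open>cross\<close> is false; that of a married orbit is left to the short games. When
  \<open>cross\<close> holds, the tables use odd \<open>m\<close>, and the second opposition is the
  additional pair of difference 0 between neighbouring orbits.\<close>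

definition men_pairs :: "int \<Rightarrow> int \<Rightarrow> int \<Rightarrow> int \<Rightarrow> bool \<Rightarrow> (int \<times> int) list" where
  "men_pairs m t s r cross =
     concat (map (\<lambda>a.
       map (\<lambda>d. (a * m, a * m + d)) [1..if even m \<and> s \<le> a then m div 2 else (m - 1) div 2] @
       concat (map (\<lambda>b. map (\<lambda>d. (a * m, b * m + d)) [0..m - 1]) [a + 1..t - 1]) @
       (if cross \<and> s \<le> a \<and> even (a - s) then [(a * m, (a + 1) * m)] else [])) [0..t - 1]) @
     concat (map (\<lambda>j. map (\<lambda>a. (m * t + j, a * m)) [0..t - 1]) [0..r - 1])"

definition short_men_pairs :: "int \<Rightarrow> int \<Rightarrow> (int \<times> int) list" where
  "short_men_pairs m s = map (\<lambda>a. (a * m, a * m + m div 2)) [0..s - 1]"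

text \<open>The list that ends first ends the table, so an empty list of women means that there are
  no short games, as for odd \<open>m\<close>. A table of wrong length is caught by
  \<open>is_starter\<close>.\<close>

fun base_games :: "int \<Rightarrow> int \<Rightarrow> (int \<times> int) list \<Rightarrow> int list \<Rightarrow> point match list" where
  "base_games m t ((a, c) # ms) (b # d # ws) =
     map_match (point_of m t) (a, b, c, d) # base_games m t ms ws"
| "base_games m t _ _ = []"

definition starter ::
  "int \<Rightarrow> int \<Rightarrow> int \<Rightarrow> int \<Rightarrow> bool \<Rightarrow> int list \<Rightarrow> int list \<Rightarrow> bool" where
  "starter m t s r cross ws vs \<longleftrightarrow> 0 \<le> r \<and>
     is_starter m t s (t + r) cross (base_games m t (men_pairs m t s r cross) ws)
       (base_games m t (short_men_pairs m s) vs)"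

text \<open>The fixed points are a hole of size \<open>r\<close>. A tournament on them fills it and
  adds its \<open>k\<close> spouse pairs to the \<open>m * s\<close> married orbit points.\<close>

lemma tournament_starter:
  assumes st: "starter m t s r cross ws vs" and k: "tournament (nat r) k"
  shows "tournament (nat (m * t + r)) (nat (m * s) + k)"
proof -
  define X where "X = {p. is_point m t (t + r) p}"
  define H where "H = {p. is_point m t (t + r) p \<and> t \<le> fst p}"
  define U where "U = {p. is_point m t (t + r) p \<and> s \<le> fst p \<and> fst p < t}"
  have st': "0 < m" "0 \<le> s" "s \<le> t" "0 \<le> r"
    and des: "design X H U"
    using st starter_design[of m t s "t + r" cross] unfolding starter_def X_def H_def U_def
    by (auto simp: is_starter_def)
  have H: "H = {t..<t + r} \<times> {0}" and U: "U = {s..<t} \<times> {0..<m}" and X: "X = {0..<t} \<times> {0..<m} \<union> H"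
    using st' by (auto simp: H_def U_def X_def split: if_splits)
  have cH: "card H = nat r" and fH: "finite H" by (simp_all add: H)
  have "card X = nat t * nat m + nat r"
    unfolding X using cH fH by (subst card_Un_disjoint) (auto simp: H card_cartesian_product)
  also have "\<dots> = nat (m * t + r)"
    using st' by (simp add: nat_add_distrib nat_mult_distrib mult.commute)
  finally have cX: "card X = nat (m * t + r)" .
  have kr: "k \<le> nat r" using k by (simp add: tournament_def)
  then obtain V where V: "V \<subseteq> H" "card V = nat r - k"
    using obtain_subset_with_card_n[of "nat r - k" H] cH by auto
  have "design H {} V" using V kr cH fH by (intro tournament_design[OF k]) auto
  from design_fill[OF des this] have d: "design X {} (U \<union> V)" .
  have "card (U \<union> V) = card U + card V"
    using V fH by (intro card_Un_disjoint) (auto simp: U H intro: finite_subset)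
  also have "card U = nat (t - s) * nat m" by (simp add: U card_cartesian_product)
  also have "nat (t - s) * nat m = nat (m * t) - nat (m * s)"
    using st' by (simp add: nat_diff_distrib nat_mult_distrib diff_mult_distrib2 mult.commute)
  finally have cU: "card (U \<union> V) = nat (m * t) - nat (m * s) + (nat r - k)" using V by simp
  have "nat (m * s) \<le> nat (m * t)" using st' by (intro nat_mono mult_left_mono) auto
  moreover have "nat (m * t + r) = nat (m * t) + nat r"
    using st' by (intro nat_add_distrib) auto
  ultimately show ?thesis using cU kr by (intro design_tournament[OF d cX]) linarith
qed

section \<open>Transversal designs\<close>

text \<open>A transversal design with five groups of size m: the block z meets the group p in c p z.\<close>

definition td5 :: "nat \<Rightarrow> bool" where
  "td5 m \<longleftrightarrow> (\<exists>c :: nat \<Rightarrow> nat \<times> nat \<Rightarrow> nat.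
     (\<forall>p<5. \<forall>z\<in>{..<m} \<times> {..<m}. c p z < m) \<and>
     (\<forall>p<5. \<forall>q<5. p \<noteq> q \<longrightarrow> inj_on (\<lambda>z. (c p z, c q z)) ({..<m} \<times> {..<m})))"

text \<open>If two blocks share two points, \<open>m\<close> divides a multiple of the difference of
  their second parameters by 1, 2 or 3 up to sign, or this difference itself. These factors are
  invertible modulo an \<open>m\<close> coprime to 6, so the blocks agree.\<close>

lemma td5_coprime:
  assumes m: "coprime m 6"
  shows "td5 m"
proof -
  \<comment> \<open>The block \<open>z\<close> is the line with intercept \<open>fst z\<close> and
    slope \<open>snd z\<close>: groups 0 to 3 record its values at these arguments, group 4 its
    slope.\<close>
  define c :: "nat \<Rightarrow> nat \<times> nat \<Rightarrow> nat"
    where "c p z = (if p = 4 then snd z else fst z + p * snd z) mod m" for p z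
  have m0: "m > 0" using m by (cases m) auto
  have cop: "coprime (int m) e" if "e \<in> {1, 2, 3, -1, -2, -3}" for e
  proof -
    have "coprime (int m) 6" using m by (metis coprime_int_iff of_nat_numeral)
    hence "coprime (int m) (2 * 3)" by simp
    thus ?thesis using that by (auto simp del: numeral_times_numeral)
  qed
  have dvdc: "int m dvd (int (fst z) + int p * int (snd z)) - (int (fst z') + int p * int (snd z'))"
    if "c p z = c p z'" "p \<noteq> 4" for p z z'
  proof -
    have "(fst z + p * snd z) mod m = (fst z' + p * snd z') mod m"
      using that by (simp add: c_def)
    hence "int (fst z + p * snd z) mod int m = int (fst z' + p * snd z') mod int m"
      by (metis zmod_int)
    thus ?thesis by (simp add: mod_eq_dvd_iff)
  qed
  have small: "x = y" if "int m dvd int x - int y" "x < m" "y < m" for x y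
  proof -
    have "int x mod int m = int y mod int m" using that(1) by (simp add: mod_eq_dvd_iff)
    thus ?thesis using that(2,3) by (simp flip: of_nat_mod)
  qed
  have inj: "z = z'" if z: "z \<in> {..<m} \<times> {..<m}" "z' \<in> {..<m} \<times> {..<m}"
    and pq: "p < q" "q < 5" and eq: "c p z = c p z'" "c q z = c q z'" for p q z z'
  proof -
    define X Y where "X = int (fst z) - int (fst z')" and "Y = int (snd z) - int (snd z')"
    have p: "int m dvd X + int p * Y"
      using dvdc[OF eq(1)] pq by (simp add: X_def Y_def algebra_simps)
    have Y: "int m dvd Y"
    proof (cases "q = 4")
      case True
      hence "snd z = snd z'" using eq(2) z by (auto simp: c_def)
      thus ?thesis by (simp add: Y_def)
    next
      case False
      hence "int m dvd X + int q * Y" using dvdc[OF eq(2)] by (simp add: X_def Y_def algebra_simps)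
      from dvd_diff[OF this p] have "int m dvd (int q - int p) * Y" by (simp add: algebra_simps)
      moreover have "int q - int p \<in> {1, 2, 3, -1, -2, -3}" using pq False by auto
      ultimately show ?thesis using cop by (metis coprime_dvd_mult_right_iff)
    qed
    hence "int m dvd X" using p by (metis dvd_add_left_iff dvd_mult)
    thus ?thesis using Y z small by (auto simp: X_def Y_def prod_eq_iff)
  qed
  show ?thesis unfolding td5_def
  proof (intro exI[of _ c] conjI allI impI)
    fix p q :: nat assume pq: "p < 5" "q < 5" "p \<noteq> q"
    show "inj_on (\<lambda>z. (c p z, c q z)) ({..<m} \<times> {..<m})"
    proof (rule inj_onI)
      fix z z' assume z: "z \<in> {..<m} \<times> {..<m}" "z' \<in> {..<m} \<times> {..<m}"
        and eq: "(c p z, c q z) = (c p z', c q z')"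
      show "z = z'"
        using inj[OF z, of p q] inj[OF z, of q p] eq pq by (cases "p < q") auto
    qed
  qed (use m0 in \<open>auto simp: c_def\<close>)
qed

text \<open>MacNeish's product: a number below \<open>a * b\<close> is split into quotient and
  remainder by \<open>b\<close>, and the two designs act on these two digits separately.\<close>

lemma td5_mult:
  assumes "td5 a" and "td5 b"
  shows "td5 (a * b)"
proof (cases "b = 0")
  case False
  obtain f :: "nat \<Rightarrow> nat \<times> nat \<Rightarrow> nat" where f: "\<forall>p<5. \<forall>z\<in>{..<a} \<times> {..<a}. f p z < a"
    "\<forall>p<5. \<forall>q<5. p \<noteq> q \<longrightarrow> inj_on (\<lambda>z. (f p z, f q z)) ({..<a} \<times> {..<a})"
    using assms(1) unfolding td5_def by blast
  obtain g :: "nat \<Rightarrow> nat \<times> nat \<Rightarrow> nat" where g: "\<forall>p<5. \<forall>z\<in>{..<b} \<times> {..<b}. g p z < b"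
    "\<forall>p<5. \<forall>q<5. p \<noteq> q \<longrightarrow> inj_on (\<lambda>z. (g p z, g q z)) ({..<b} \<times> {..<b})"
    using assms(2) unfolding td5_def by blast
  define hi where "hi z = (fst z div b, snd z div b)" for z :: "nat \<times> nat"
  define lo where "lo z = (fst z mod b, snd z mod b)" for z :: "nat \<times> nat"
  have hi: "hi z \<in> {..<a} \<times> {..<a}" and lo: "lo z \<in> {..<b} \<times> {..<b}"
    if "z \<in> {..<a * b} \<times> {..<a * b}" for z
    using that False by (auto simp: hi_def lo_def less_mult_imp_div_less)
  have hilo: "z = z'" if "hi z = hi z'" "lo z = lo z'" for z z'
    using that by (auto simp: hi_def lo_def prod_eq_iff) (metis div_mult_mod_eq)+
  define c where "c p z = f p (hi z) * b + g p (lo z)" for p z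
  have split: "f p (hi z) = f p (hi z')" "g p (lo z) = g p (lo z')"
    if "c p z = c p z'" "p < 5" "z \<in> {..<a * b} \<times> {..<a * b}" "z' \<in> {..<a * b} \<times> {..<a * b}"
      for p z z'
  proof -
    have "g p (lo z) < b" "g p (lo z') < b" using g(1) lo that by blast+
    moreover have "c p z div b = c p z' div b" "c p z mod b = c p z' mod b" using that by auto
    ultimately show "f p (hi z) = f p (hi z')" "g p (lo z) = g p (lo z')" by (auto simp: c_def)
  qed
  show ?thesis unfolding td5_def
  proof (intro exI[of _ c] conjI allI impI ballI)
    fix p z assume p: "p < (5 :: nat)" "z \<in> {..<a * b} \<times> {..<a * b}"
    have "f p (hi z) < a" "g p (lo z) < b" using p f(1) g(1) hi lo by blast+
    hence "f p (hi z) * b + g p (lo z) < Suc (f p (hi z)) * b" by simp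
    also have "\<dots> \<le> a * b" using \<open>f p (hi z) < a\<close> by (intro mult_right_mono) auto
    finally show "c p z < a * b" by (simp add: c_def)
  next
    fix p q :: nat assume pq: "p < 5" "q < 5" "p \<noteq> q"
    show "inj_on (\<lambda>z. (c p z, c q z)) ({..<a * b} \<times> {..<a * b})"
    proof (rule inj_onI)
      fix z z' assume z: "z \<in> {..<a * b} \<times> {..<a * b}" "z' \<in> {..<a * b} \<times> {..<a * b}"
        and eq: "(c p z, c q z) = (c p z', c q z')"
      hence "f p (hi z) = f p (hi z')" "g p (lo z) = g p (lo z')" "f q (hi z) =
          f q (hi z')" "g q (lo z) = g q (lo z')"
        using split[OF _ pq(1) z] split[OF _ pq(2) z] eq by blast+
      hence "hi z = hi z'" "lo z = lo z'"
        using pq inj_onD[OF f(2)[rule_format, OF pq], of "hi z" "hi z'"]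
          inj_onD[OF g(2)[rule_format, OF pq], of "lo z" "lo z'"] hi[OF z(1)] hi[OF z(2)] lo[OF z(1)] lo[OF z(2)] by auto
      thus "z = z'" by (rule hilo)
    qed
  qed
qed (simp add: td5_def)

text \<open>The index pair only enumerates the \<open>m * m\<close> rows of a table, so the property
  becomes a finite check on the ten pairs of columns.\<close>

lemma td5_list:
  assumes len: "length bs = m * m"
    and ran: "\<forall>b\<in>set bs. length b = 5 \<and> (\<forall>v\<in>set b. v < m)"
    and dist: "\<forall>(p, q)\<in>set [(0, 1), (0, 2), (0, 3), (0, 4), (1, 2), (1, 3), (1, 4), (2, 3), (2, 4),
        (3, 4 :: nat)].
      distinct (map (\<lambda>b. (b ! p, b ! q)) bs)"
  shows "td5 m"
proof -
  define ix where "ix z = fst z * m + snd z" for z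
  have ix: "ix z < m * m" if "z \<in> {..<m} \<times> {..<m}" for z
  proof -
    have "ix z < Suc (fst z) * m" using that by (auto simp: ix_def)
    also have "\<dots> \<le> m * m" using that by (intro mult_right_mono) auto
    finally show ?thesis .
  qed
  have ixinj: "z = z'" if "ix z = ix z'" "z \<in> {..<m} \<times> {..<m}" "z' \<in> {..<m} \<times> {..<m}" for z z'
  proof -
    have "fst y = ix y div m \<and> snd y = ix y mod m" if "y \<in> {..<m} \<times> {..<m}" for y
      using that by (auto simp: ix_def)
    thus ?thesis using that by (metis prod_eq_iff)
  qed
  define c where "c p z = bs ! ix z ! p" for p z
  have inj: "inj_on (\<lambda>z. (c p z, c q z)) ({..<m} \<times> {..<m})" if "p < q" "q < 5" for p q
  proof -
    have "p \<in> {0, 1, 2, 3}" "q \<in> {1, 2, 3, 4}" using that by auto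
    hence "(p, q) \<in> set [(0, 1), (0, 2), (0, 3), (0, 4), (1, 2), (1, 3), (1, 4), (2, 3), (2, 4),
        (3, 4)]"
      using that(1) by auto
    from bspec[OF dist this] have dist: "distinct (map (\<lambda>b. (b ! p, b ! q)) bs)"
      by (simp only: prod.case)
    show ?thesis
    proof (rule inj_onI)
      fix z z' assume z: "z \<in> {..<m} \<times> {..<m}" "z' \<in> {..<m} \<times> {..<m}"
        and eq: "(c p z, c q z) = (c p z', c q z')"
      have lt: "ix z < length bs" "ix z' < length bs" using ix[OF z(1)] ix[OF z(2)] len by simp_all
      with eq have "map (\<lambda>b. (b ! p, b ! q)) bs ! ix z = map (\<lambda>b. (b ! p, b ! q)) bs ! ix z'"
        by (simp add: c_def)
      hence "ix z = ix z'" using nth_eq_iff_index_eq[OF dist, of "ix z" "ix z'"] lt by simp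
      thus "z = z'" using z by (rule ixinj)
    qed
  qed
  show ?thesis unfolding td5_def
  proof (intro exI[of _ c] conjI allI impI ballI)
    fix p z assume "p < (5 :: nat)" "z \<in> {..<m} \<times> {..<m}"
    hence "bs ! ix z \<in> set bs" using ix len by auto
    hence "length (bs ! ix z) = 5" "\<forall>v\<in>set (bs ! ix z). v < m" using ran by auto
    thus "c p z < m" using \<open>p < 5\<close> by (simp add: c_def)
  next
    fix p q :: nat assume "p < 5" "q < 5" "p \<noteq> q"
    thus "inj_on (\<lambda>z. (c p z, c q z)) ({..<m} \<times> {..<m})"
      using inj[of p q] inj[of q p] by (cases "p < q") (auto simp: inj_on_def)
  qed
qed

text \<open>Every block carries a tournament in which all 4 or 5 players are married, so unmarried
  players arise in the groups only. As the groups are disjoint, \<open>design_pbd\<close>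
  applies.\<close>

lemma tournament_td5:
  assumes td: "td5 m" and x: "x \<le> m"
    and k: "tournament m k0" "tournament m k1" "tournament m k2" "tournament m k3" "tournament x k4"
    and idem: "tournament 4 4" "tournament 5 5"
  shows "tournament (4 * m + x) (k0 + k1 + k2 + k3 + k4)"
proof -
  obtain c :: "nat \<Rightarrow> nat \<times> nat \<Rightarrow> nat" where c': "\<forall>p<5. \<forall>z\<in>{..<m} \<times> {..<m}. c p z < m"
    and inj': "\<forall>p<5. \<forall>q<5. p \<noteq> q \<longrightarrow> inj_on (\<lambda>z. (c p z, c q z)) ({..<m} \<times> {..<m})"
    using td unfolding td5_def by blast
  note c = c'[rule_format] and inj = inj'[rule_format]
  define g where "g p = (if p = 4 then x else m)" for p :: nat
  define ks where "ks = (\<lambda>p. [k0, k1, k2, k3, k4] ! p)"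
  have five: "{..<5} = {0, 1, 2, 3, 4 :: nat}" by auto
  have four: "{..<4} = {0, 1, 2, 3 :: nat}" by auto
  have ks: "tournament (g p) (ks p)" if "p < 5" for p
  proof -
    have "p \<in> {0, 1, 2, 3, 4}" using that by auto
    thus ?thesis using k by (auto simp: g_def ks_def)
  qed
  define X where "X = Sigma {..<5} (\<lambda>p. {..<g p})"
  \<comment> \<open>\<open>Inl z\<close> stands for a block of the transversal design,
    \<open>Inr p\<close> for a group, which also serves as a block of the pairwise balanced
    design.\<close>
  define I :: "(nat \<times> nat + nat) set" where "I = Inl ` ({..<m} \<times> {..<m}) \<union> Inr ` {..<5}"
  define B
    where "B = case_sum (\<lambda>z. (\<lambda>p. (p, c p z)) ` {p. p < 5 \<and> c p z < g p}) (\<lambda>p. {p} \<times> {..<g p})"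
  define U :: "nat \<times> nat + nat \<Rightarrow> (nat \<times> nat) set"
    where "U = case_sum (\<lambda>_. {}) (\<lambda>p. {p} \<times> {ks p..<g p})"
  have "design X {} (\<Union>i\<in>I. U i)"
  proof (rule design_pbd)
    show "finite I" "finite X" by (auto simp: I_def X_def)
    show "disjoint_family_on U I"
      by (auto simp: disjoint_family_on_def U_def split: sum.splits)
  next
    fix i assume i: "i \<in> I"
    show "B i \<subseteq> X" using i by (cases i) (auto simp: I_def B_def X_def)
    show "design (B i) {} (U i)"
    proof (cases i)
      case (Inl z)
      define P where "P = {p. p < 5 \<and> c p z < g p}"
      have "z \<in> {..<m} \<times> {..<m}" using i Inl by (auto simp: I_def)
      hence "c p z < m" if "p < 5" for p using c that by blast
      \<comment> \<open>A block meets the four full groups and misses at most the truncated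
        one.\<close>
      hence "{..<4} \<subseteq> P" "P \<subseteq> {..<5}" by (auto simp: P_def g_def)
      hence "P = {..<4} \<or> P = {..<5}"
        using five four by (cases "4 \<in> P") auto
      hence "tournament (card P) (card P)" "finite P" using idem by auto
      moreover have "B i = (\<lambda>p. (p, c p z)) ` P" "U i = {}"
        by (simp_all add: B_def U_def P_def Inl)
      moreover have "card ((\<lambda>p. (p, c p z)) ` P) = card P" by (intro card_image inj_onI) simp
      ultimately show ?thesis using tournament_design[of "card P" "card P" "B i" "{}"] by simp
    next
      case (Inr p)
      hence "p < 5" using i by (auto simp: I_def)
      moreover have "ks p \<le> g p" using ks[OF \<open>p < 5\<close>] by (simp add: tournament_def)
      ultimately show ?thesis unfolding B_def U_def Inr
        by (intro tournament_design[OF ks[of p]]) (auto simp: card_cartesian_product)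
    qed
  next
    fix a b assume ab: "a \<in> X" "b \<in> X" "a \<noteq> b"
    obtain p v q w where pq: "a = (p, v)" "b = (q, w)" by (metis surj_pair)
    have lt: "p < 5" "q < 5" "v < g p" "w < g q" using ab by (auto simp: pq X_def)
    show "\<exists>!i. i \<in> I \<and> a \<in> B i \<and> b \<in> B i"
    proof (cases "p = q")
      case True
      show ?thesis
        by (rule ex1I[of _ "Inr p"]) (use True lt ab in \<open>auto simp: I_def B_def pq\<close>)
    next
      case False
      \<comment> \<open>An injection from the \<open>m * m\<close> blocks into the
        \<open>m * m\<close> pairs of points is onto, so two points of different groups lie in a
        common block; injectivity makes this block unique.\<close>
      have "(\<lambda>z. (c p z, c q z)) ` ({..<m} \<times> {..<m}) = {..<m} \<times> {..<m}"
      proof (rule card_subset_eq)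
        show "(\<lambda>z. (c p z, c q z)) ` ({..<m} \<times> {..<m}) \<subseteq> {..<m} \<times> {..<m}"
          using c lt(1,2) by blast
        show "card ((\<lambda>z. (c p z, c q z)) ` ({..<m} \<times> {..<m})) = card ({..<m} \<times> {..<m})"
          by (rule card_image[OF inj[OF lt(1,2) False]])
      qed simp
      moreover have "v < m" "w < m" using lt x by (auto simp: g_def split: if_splits)
      ultimately have "(v, w) \<in> (\<lambda>z. (c p z, c q z)) ` ({..<m} \<times> {..<m})" by simp
      then obtain z where z: "z \<in> {..<m} \<times> {..<m}" "c p z = v" "c q z = w" by blast
      show ?thesis
      proof (rule ex1I[of _ "Inl z"])
        show "Inl z \<in> I \<and> a \<in> B (Inl z) \<and> b \<in> B (Inl z)"
          using z lt by (auto simp: I_def B_def pq)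
      next
        fix i assume i: "i \<in> I \<and> a \<in> B i \<and> b \<in> B i"
        show "i = Inl z"
        proof (cases i)
          case (Inl z')
          hence "z' \<in> {..<m} \<times> {..<m}" "c p z' = v" "c q z' = w"
            using i by (auto simp: I_def B_def pq)
          thus ?thesis using z inj_onD[OF inj[OF lt(1,2) False], of z' z] Inl by auto
        next
          case (Inr r)
          thus ?thesis using i False by (auto simp: B_def pq)
        qed
      qed
    qed
  qed
  moreover have "(\<Union>i\<in>I. U i) = Sigma {..<5} (\<lambda>p. {ks p..<g p})"
    by (auto simp: I_def U_def)
  ultimately have des: "design X {} (Sigma {..<5} (\<lambda>p. {ks p..<g p}))" by simp
  show ?thesis
  proof (rule design_tournament[OF des])
    show "card X = 4 * m + x"
      by (simp add: X_def five g_def)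
    show "card (Sigma {..<5} (\<lambda>p. {ks p..<g p})) + (k0 + k1 + k2 + k3 + k4) = 4 * m + x"
      using k by (simp add: five g_def ks_def tournament_def)
  qed
qed

text \<open>The columns are \<open>x\<close>, \<open>y\<close>, \<open>x + y\<close>,
  \<open>2 x + y\<close>, \<open>3 x + y\<close> over the field with 4 elements, coded by their
  binary digits; distinct slopes make any two columns independent. The tables for 8 and 9 have the
  same form, with ternary digits for 9.\<close>

lemma td5_4: "td5 4"
  by (rule td5_list[of
   "[[0,0,0,0,0],[1,0,1,2,3],[2,0,2,3,1],[3,0,3,1,2],[0,1,1,1,1],[1,1,0,3,2],[2,1,3,2,0],
    [3,1,2,0,3],[0,2,2,2,2],[1,2,3,0,1],[2,2,0,1,3],[3,2,1,3,0],[0,3,3,3,3],[1,3,2,1,0],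
    [2,3,1,0,2],[3,3,0,2,1]]"]) code_simp+

lemma td5_8: "td5 8"
  by (rule td5_list[of
   "[[0,0,0,0,0],[1,0,1,2,3],[2,0,2,4,6],[3,0,3,6,5],[4,0,4,3,7],[5,0,5,1,4],[6,0,6,7,1],
    [7,0,7,5,2],[0,1,1,1,1],[1,1,0,3,2],[2,1,3,5,7],[3,1,2,7,4],[4,1,5,2,6],[5,1,4,0,5],
    [6,1,7,6,0],[7,1,6,4,3],[0,2,2,2,2],[1,2,3,0,1],[2,2,0,6,4],[3,2,1,4,7],[4,2,6,1,5],
    [5,2,7,3,6],[6,2,4,5,3],[7,2,5,7,0],[0,3,3,3,3],[1,3,2,1,0],[2,3,1,7,5],[3,3,0,5,6],
    [4,3,7,0,4],[5,3,6,2,7],[6,3,5,4,2],[7,3,4,6,1],[0,4,4,4,4],[1,4,5,6,7],[2,4,6,0,2],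
    [3,4,7,2,1],[4,4,0,7,3],[5,4,1,5,0],[6,4,2,3,5],[7,4,3,1,6],[0,5,5,5,5],[1,5,4,7,6],
    [2,5,7,1,3],[3,5,6,3,0],[4,5,1,6,2],[5,5,0,4,1],[6,5,3,2,4],[7,5,2,0,7],[0,6,6,6,6],
    [1,6,7,4,5],[2,6,4,2,0],[3,6,5,0,3],[4,6,2,5,1],[5,6,3,7,2],[6,6,0,1,7],[7,6,1,3,4],
    [0,7,7,7,7],[1,7,6,5,4],[2,7,5,3,1],[3,7,4,1,2],[4,7,3,4,0],[5,7,2,6,3],[6,7,1,0,6],
    [7,7,0,2,5]]"]) code_simp+

lemma td5_9: "td5 9"
  by (rule td5_list[of
   "[[0,0,0,0,0],[1,0,1,2,3],[2,0,2,1,6],[3,0,3,6,2],[4,0,4,8,5],[5,0,5,7,8],[6,0,6,3,1],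
    [7,0,7,5,4],[8,0,8,4,7],[0,1,1,1,1],[1,1,2,0,4],[2,1,0,2,7],[3,1,4,7,0],[4,1,5,6,3],
    [5,1,3,8,6],[6,1,7,4,2],[7,1,8,3,5],[8,1,6,5,8],[0,2,2,2,2],[1,2,0,1,5],[2,2,1,0,8],
    [3,2,5,8,1],[4,2,3,7,4],[5,2,4,6,7],[6,2,8,5,0],[7,2,6,4,3],[8,2,7,3,6],[0,3,3,3,3],
    [1,3,4,5,6],[2,3,5,4,0],[3,3,6,0,5],[4,3,7,2,8],[5,3,8,1,2],[6,3,0,6,4],[7,3,1,8,7],
    [8,3,2,7,1],[0,4,4,4,4],[1,4,5,3,7],[2,4,3,5,1],[3,4,7,1,3],[4,4,8,0,6],[5,4,6,2,0],
    [6,4,1,7,5],[7,4,2,6,8],[8,4,0,8,2],[0,5,5,5,5],[1,5,3,4,8],[2,5,4,3,2],[3,5,8,2,4],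
    [4,5,6,1,7],[5,5,7,0,1],[6,5,2,8,3],[7,5,0,7,6],[8,5,1,6,0],[0,6,6,6,6],[1,6,7,8,0],
    [2,6,8,7,3],[3,6,0,3,8],[4,6,1,5,2],[5,6,2,4,5],[6,6,3,0,7],[7,6,4,2,1],[8,6,5,1,4],
    [0,7,7,7,7],[1,7,8,6,1],[2,7,6,8,4],[3,7,1,4,6],[4,7,2,3,0],[5,7,0,5,3],[6,7,4,1,8],
    [7,7,5,0,2],[8,7,3,2,5],[0,8,8,8,8],[1,8,6,7,2],[2,8,7,6,5],[3,8,2,5,7],[4,8,0,4,1],
    [5,8,1,3,4],[6,8,5,2,6],[7,8,3,1,0],[8,8,4,0,3]]"]) code_simp+

section \<open>Tables of base games\<close>

text \<open>One starter serves every number of spouse pairs that is available in its hole.\<close>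

lemma tournament_starters:
  assumes "starter m t s r cross ws vs" and "\<forall>k\<in>K. tournament n k" and "r = int n"
  shows "\<forall>k\<in>K. tournament (nat (m * t + r)) (nat (m * s) + k)"
  using assms(2) tournament_starter[OF assms(1)] by (simp add: assms(3))

text \<open>All unmarried orbit points form one orbit, whose length is even for either parity of
  \<open>n\<close>, as the half shift requires. Holes of size 7 and 8 admit every number of spouse
  pairs of the right parity, so a single table settles all k \<le> 8.\<close>

definition low_starter :: "nat \<Rightarrow> int list \<Rightarrow> bool" where
  "low_starter n ws \<longleftrightarrow>
     (let r = (if even n then 8 else 7) in starter (int n - r) 1 0 r False ws [])"

section \<open>Tournaments with at most 31 men\<close>

lemma tournament_0: "\<forall>k\<in>{0}. tournament 0 k"
proof -
  have "schedule {} {} {} id {#}"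
    by (simp add: schedule_def joined_def)
  thus ?thesis by (auto simp: tournament_def design_def)
qed

lemma tournament_1: "\<forall>k\<in>{1}. tournament 1 k"
proof -
  have "schedule {..<1 :: nat} {} {} id {#}"
    by (auto simp: schedule_def joined_def)
  thus ?thesis by (auto simp: tournament_def design_def)
qed

text \<open>The name of a starter records \<open>m\<close>, \<open>s\<close>, \<open>t - s\<close>
  and \<open>r\<close>. It gives \<open>m * t + r\<close> men and \<open>m * s\<close> spouse pairs
  besides those in the hole. For \<open>m = 1\<close> the group is trivial, and the table lists
  every game that is not inside the hole.\<close>

lemma starter_1_0_2_0: "starter 1 2 0 0 True
    [1,0,0,1] []"
  by code_simp

lemma tournament_2: "\<forall>k\<in>{0}. tournament 2 k"
  using tournament_starters[OF starter_1_0_2_0 tournament_0]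
  by simp

lemma starter_2_0_1_1: "starter 2 1 0 1 False
    [0,2,0,1] []"
  by code_simp

lemma tournament_3: "\<forall>k\<in>{1}. tournament 3 k"
  using tournament_starters[OF starter_2_0_1_1 tournament_1]
  by simp

lemma starter_4_0_1_0: "starter 4 1 0 0 False
    [0,2,3,0] []"
  by code_simp

lemma starter_3_1_0_1: "starter 3 1 1 1 False
    [3,2,1,2] []"
  by code_simp

lemma tournament_4: "\<forall>k\<in>{0, 4}. tournament 4 k"
  using tournament_starters[OF starter_4_0_1_0 tournament_0]
    tournament_starters[OF starter_3_1_0_1 tournament_1]
  by simp

lemma starter_5_1_0_0: "starter 5 1 1 0 False
    [2,4,4,3] []"
  by code_simp

lemma starter_1_1_4_0: "starter 1 5 1 0 True
    [2,4,1,3,4,1,3,2,3,4,0,3,1,0,2,1,2,0,0,4,2,1,4,3] []"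
  by code_simp

lemma tournament_5: "\<forall>k\<in>{1, 5}. tournament 5 k"
  using tournament_starters[OF starter_5_1_0_0 tournament_0]
    tournament_starters[OF starter_1_1_4_0 tournament_0]
  by simp

lemma starter_4_0_1_2: "starter 4 1 0 2 False
    [2,4,1,5,0,3,2,0] []"
  by code_simp

lemma starter_1_4_2_0: "starter 1 6 4 0 True
    [3,4,4,5,1,2,2,3,5,1,3,0,0,5,5,2,2,4,4,1,1,0,3,5,4,5,0,2,1,3,4,0] []"
  by code_simp

lemma tournament_6: "\<forall>k\<in>{0, 4}. tournament 6 k"
  using tournament_starters[OF starter_4_0_1_2 tournament_2]
    tournament_starters[OF starter_1_4_2_0 tournament_0]
  by simp

lemma starter_7_1_0_0: "starter 7 1 1 0 False
    [3,5,6,3,2,1] []"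
  by code_simp

lemma starter_6_0_1_1: "starter 6 1 0 1 False
    [1,5,3,4,6,3,2,5] []"
  by code_simp

lemma starter_5_1_0_2: "starter 5 1 1 2 False
    [5,2,6,4,3,4,1,3] []"
  by code_simp

lemma starter_1_3_4_0: "starter 1 7 3 0 True
    [3,4,6,1,4,2,1,3,5,6,2,5,5,6,0,5,2,0,3,2,6,4,3,0,5,4,4,3,0,1,6,2,1,5,3,6,4,1,6,0,5,3,1,2,4,0] []"
  by code_simp

lemma tournament_7: "\<forall>k\<in>{1, 3, 5, 7}. tournament 7 k"
  using tournament_starters[OF starter_7_1_0_0 tournament_0]
    tournament_starters[OF starter_6_0_1_1 tournament_1]
    tournament_starters[OF starter_5_1_0_2 tournament_2]
    tournament_starters[OF starter_1_3_4_0 tournament_0]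
  by simp

lemma starter_7_1_0_1: "starter 7 1 1 1 False
    [6,3,7,6,5,4,1,3] []"
  by code_simp

lemma starter_6_0_1_2: "starter 6 1 0 2 False
    [5,2,3,6,0,7,0,2,5,4] []"
  by code_simp

lemma starter_2_2_2_0: "starter 2 4 2 0 False
    [5,3,7,1,6,7,2,5,4,6,1,4,7,3,4,7,5,4,6,1,0,4,1,2,2,0,3,6] [3,2,1,0]"
  by code_simp

lemma starter_1_6_2_0: "starter 1 8 6 0 True
    [2,7,4,1,7,6,6,3,3,4,1,5,5,2,0,4,5,0,3,5,2,3,4,6,6,7,6,5,5,7,0,6,7,3,3,1,1,0,4,2,2,1,7,4,1,7,
     6,2,2,0,0,7,1,6,0,3,4,5] []"
  by code_simp

lemma starter_1_2_6_0: "starter 1 8 2 0 True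
    [6,5,1,7,3,6,2,4,5,1,4,3,7,2,6,4,7,3,0,5,2,0,3,2,4,7,6,2,3,0,1,3,0,7,5,4,2,5,4,1,0,4,7,5,1,0,
     7,6,2,1,3,5,6,7,5,4,2,3,6,1,0,6] []"
  by code_simp

lemma tournament_8: "\<forall>k\<in>{0, 2, 4, 6, 8}. tournament 8 k"
  using tournament_starters[OF starter_7_1_0_1 tournament_1]
    tournament_starters[OF starter_6_0_1_2 tournament_2]
    tournament_starters[OF starter_2_2_2_0 tournament_0]
    tournament_starters[OF starter_1_6_2_0 tournament_0]
    tournament_starters[OF starter_1_2_6_0 tournament_0]
  by simp

lemma starter_8_1_0_1: "starter 8 1 1 1 False
    [4,6,6,1,2,8,2,3] [1,5]"
  by code_simp

lemma starter_7_1_0_2: "starter 7 1 1 2 False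
    [2,7,1,5,6,8,2,4,4,5] []"
  by code_simp

lemma starter_6_0_1_3: "starter 6 1 0 3 False
    [0,7,4,8,6,0,1,5,3,2,4,1] []"
  by code_simp

lemma starter_4_1_1_1: "starter 4 2 1 1 False
    [8,5,5,7,7,6,3,2,6,1,3,8,1,4,4,2,0,4] [1,3]"
  by code_simp

lemma starter_3_1_2_0: "starter 3 3 1 0 True
    [2,3,6,8,8,4,4,6,7,2,3,5,1,7,5,0,4,1,1,8,0,2,6,3,6,3] []"
  by code_simp

lemma tournament_9: "\<forall>k\<in>{1, 3, 5, 7, 9}. tournament 9 k"
  using tournament_starters[OF starter_8_1_0_1 tournament_1]
    tournament_starters[OF starter_7_1_0_2 tournament_2]
    tournament_starters[OF starter_6_0_1_3 tournament_3]
    tournament_starters[OF starter_4_1_1_1 tournament_1]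
    tournament_starters[OF starter_3_1_2_0 tournament_0]
  by simp

lemma starter_9_1_0_1: "starter 9 1 1 1 False
    [3,8,5,6,9,5,8,1,7,1] []"
  by code_simp

lemma starter_8_1_0_2: "starter 8 1 1 2 False
    [9,3,8,5,1,2,7,4,4,6] [5,1]"
  by code_simp

lemma starter_8_0_1_2: "starter 8 1 0 2 False
    [4,0,9,5,1,8,6,1,7,0,4,2] []"
  by code_simp

lemma starter_4_1_1_2: "starter 4 2 1 2 False
    [9,7,8,2,5,1,7,8,2,5,1,9,5,6,6,4,2,3,4,3,1,7] [1,3]"
  by code_simp

lemma starter_2_3_1_2: "starter 2 4 3 2 False
    [8,3,6,9,9,2,4,7,3,1,1,8,8,5,1,6,5,9,6,4,8,6,9,1,3,6,6,7,0,4,3,0,4,2,5,2,3,7,7,1,1,4] [5,4,0,1,3,2]"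
  by code_simp

lemma starter_1_2_8_0: "starter 1 10 2 0 True
    [7,5,8,4,6,7,5,9,1,8,3,1,2,3,9,2,4,6,2,8,8,9,0,6,9,4,7,3,4,2,3,0,6,5,5,3,3,4,7,9,2,5,6,7,1,6,
     0,1,9,0,2,3,6,2,4,0,1,4,5,1,8,7,2,1,8,6,5,8,7,4,1,9,0,7,5,4,0,5,6,3,3,8,7,1,8,9,2,0,9,6,0,8,
     9,3,7,2,5,4] []"
  by code_simp

lemma tournament_10: "\<forall>k\<in>{0, 2, 4, 6, 8, 10}. tournament 10 k"
  using tournament_starters[OF starter_9_1_0_1 tournament_1]
    tournament_starters[OF starter_8_1_0_2 tournament_2]
    tournament_starters[OF starter_8_0_1_2 tournament_2]
    tournament_starters[OF starter_4_1_1_2 tournament_2]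
    tournament_starters[OF starter_2_3_1_2 tournament_2]
    tournament_starters[OF starter_1_2_8_0 tournament_0]
  by simp

lemma starter_11_1_0_0: "starter 11 1 1 0 False
    [9,3,7,6,5,9,3,1,1,4] []"
  by code_simp

lemma starter_10_0_1_1: "starter 10 1 0 1 False
    [3,0,7,8,2,7,5,10,8,6,4,0] []"
  by code_simp

lemma starter_9_1_0_2: "starter 9 1 1 2 False
    [5,3,7,10,1,2,9,1,6,3,8,4] []"
  by code_simp

lemma starter_3_1_2_2: "starter 3 3 1 2 True
    [2,7,8,3,7,10,4,9,9,6,5,8,10,2,5,0,0,2,4,10,7,3,1,9,3,6,5,1,7,6,2,5,4,3,1,8,7,1] []"
  by code_simp

lemma starter_2_3_2_1: "starter 2 5 3 1 False
    [10,4,8,1,7,8,9,7,6,3,1,10,5,2,3,9,9,1,7,6,8,4,3,8,10,7,6,5,5,1,10,3,9,10,2,0,6,4,0,3,7,1,9,4,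
     6,2,3,5,5,0,9,8,1,6] [4,5,1,0,3,2]"
  by code_simp

lemma starter_2_2_3_1: "starter 2 5 2 1 False
    [8,4,10,7,9,1,6,9,3,10,5,8,4,5,1,2,1,6,10,4,7,5,8,3,3,9,9,7,4,3,10,8,9,0,7,4,3,6,0,6,6,2,4,0,
     0,10,6,7,0,5,2,0,5,3,9,8] [2,3,0,1]"
  by code_simp

lemma tournament_11: "\<forall>k\<in>{1, 3, 5, 7, 9, 11}. tournament 11 k"
  using tournament_starters[OF starter_11_1_0_0 tournament_0]
    tournament_starters[OF starter_10_0_1_1 tournament_1]
    tournament_starters[OF starter_9_1_0_2 tournament_2]
    tournament_starters[OF starter_3_1_2_2 tournament_2]
    tournament_starters[OF starter_2_3_2_1 tournament_1]
    tournament_starters[OF starter_2_2_3_1 tournament_1]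
  by simp

lemma starter_11_1_0_1: "starter 11 1 1 1 False
    [4,7,8,9,5,1,3,5,2,11,4,10] []"
  by code_simp

lemma starter_10_1_0_2: "starter 10 1 1 2 False
    [6,3,1,10,9,1,11,8,4,5,7,3] [7,2]"
  by code_simp

lemma starter_8_0_1_4: "starter 8 1 0 4 False
    [0,10,8,1,11,0,9,2,5,3,6,2,4,1,3,4] []"
  by code_simp

lemma tournament_12: "\<forall>k\<in>{0, 4, 10, 12}. tournament 12 k"
  using tournament_starters[OF starter_11_1_0_1 tournament_1]
    tournament_starters[OF starter_10_1_0_2 tournament_2]
    tournament_starters[OF starter_8_0_1_4 tournament_4]
  by simp

lemma starter_12_0_1_1: "starter 12 1 0 1 False
    [4,7,12,0,8,2,1,6,9,8,5,1,10,0] []"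
  by code_simp

lemma starter_11_1_0_2: "starter 11 1 1 2 False
    [9,3,12,9,4,6,6,5,11,10,7,10,4,8] []"
  by code_simp

lemma starter_9_1_0_4: "starter 9 1 1 4 False
    [8,10,3,11,7,12,9,5,3,2,6,4,8,5,2,6] []"
  by code_simp

lemma starter_4_1_2_1: "starter 4 3 1 1 False
    [3,10,4,12,7,11,11,4,10,8,12,1,2,6,8,9,6,5,4,1,2,3,5,10,8,12,11,5,7,2,9,3,0,6,7,5,8,3,0,8] [1,3]"
  by code_simp

lemma starter_3_1_2_4: "starter 3 3 1 4 True
    [6,9,3,11,12,5,11,2,2,10,7,12,10,4,7,10,9,4,12,1,5,7,1,9,6,11,7,4,2,6,5,2,1,5,8,2,4,7,6,8,5,3,
     0,1,3,1,0,8,7,3] []"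
  by code_simp

lemma tournament_13: "\<forall>k\<in>{1, 3, 5, 7, 9, 11, 13}. tournament 13 k"
  using tournament_starters[OF starter_12_0_1_1 tournament_1]
    tournament_starters[OF starter_11_1_0_2 tournament_2]
    tournament_starters[OF starter_9_1_0_4 tournament_4]
    tournament_starters[OF starter_4_1_2_1 tournament_1]
    tournament_starters[OF starter_3_1_2_4 tournament_4]
  by simp

lemma starter_13_1_0_1: "starter 13 1 1 1 False
    [7,9,5,4,11,2,3,10,13,1,4,7,5,10] []"
  by code_simp

lemma starter_12_1_0_2: "starter 12 1 1 2 False
    [5,9,12,11,11,6,7,10,10,13,2,4,1,2] [1,7]"
  by code_simp

lemma starter_10_0_1_4: "starter 10 1 0 4 False
    [8,11,12,9,6,10,4,6,13,8,1,0,2,5,5,1,4,9] []"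
  by code_simp

lemma starter_4_2_1_2: "starter 4 3 2 2 False
    [10,8,13,10,2,1,5,11,9,12,7,3,12,7,8,2,3,13,6,9,3,8,13,6,7,11,1,12,2,4,4,9,5,4,3,11,8,1,6,1,
     2,5,11,10] [6,4,2,0]"
  by code_simp

lemma starter_2_5_1_2: "starter 2 6 5 2 False
    [12,7,1,12,8,3,6,10,11,5,13,6,2,13,10,2,3,1,7,8,5,10,1,7,10,11,0,5,13,1,6,4,9,3,4,13,2,12,
     9,13,1,9,12,10,8,6,13,11,9,12,1,5,10,7,0,9,2,4,10,3,5,12,9,4,6,3,3,7,4,8,10,0,0,11,11,9,8,11,
     2,5,0,3,5,6,7,0] [5,4,8,9,0,1,2,3,7,6]"
  by code_simp

lemma tournament_14: "\<forall>k\<in>{0, 4, 8, 10, 12, 14}. tournament 14 k"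
  using tournament_starters[OF starter_13_1_0_1 tournament_1]
    tournament_starters[OF starter_12_1_0_2 tournament_2]
    tournament_starters[OF starter_10_0_1_4 tournament_4]
    tournament_starters[OF starter_4_2_1_2 tournament_2]
    tournament_starters[OF starter_2_5_1_2 tournament_2]
  by simp

lemma starter_13_1_0_2: "starter 13 1 1 2 False
    [12,9,6,12,4,6,11,13,7,14,9,8,10,5,5,1] []"
  by code_simp

lemma starter_11_1_0_4: "starter 11 1 1 4 False
    [9,14,13,10,6,12,2,7,10,11,1,5,2,1,6,4,4,7] []"
  by code_simp

lemma starter_10_0_1_5: "starter 10 1 0 5 False
    [3,13,12,0,14,4,11,3,6,10,8,2,7,0,9,4,6,5,5,7] []"
  by code_simp

lemma tournament_15: "\<forall>k\<in>{1, 5, 11, 13, 15}. tournament 15 k"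
  using tournament_starters[OF starter_13_1_0_2 tournament_2]
    tournament_starters[OF starter_11_1_0_4 tournament_4]
    tournament_starters[OF starter_10_0_1_5 tournament_5]
  by simp

lemma starter_14_1_0_2: "starter 14 1 1 2 False
    [15,11,3,4,1,10,14,9,11,3,8,5,7,9,8,4] [6,13]"
  by code_simp

lemma starter_12_1_0_4: "starter 12 1 1 4 False
    [15,9,5,12,13,1,3,5,9,14,2,6,8,11,6,7,7,2] [4,10]"
  by code_simp

lemma starter_12_0_1_4: "starter 12 1 0 4 False
    [14,6,11,3,7,15,9,13,3,12,6,8,11,4,1,0,7,10,2,8] []"
  by code_simp

lemma starter_6_1_1_4: "starter 6 2 1 4 False
    [12,6,6,11,13,2,14,9,15,8,2,14,5,15,7,13,1,12,9,6,0,2,1,8,10,4,5,10,11,3,7,3,4,7,3,4,9,11] [1,4]"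
  by code_simp

lemma starter_4_2_2_0: "starter 4 4 2 0 False
    [7,13,8,2,14,10,9,4,13,11,11,3,15,14,2,7,5,9,10,15,1,5,4,12,6,8,3,12,10,7,13,15,1,10,14,3,5,6,
     12,0,11,9,0,1,2,5,6,13,11,8,9,2,1,7,12,9,13,4,12,2] [3,1,7,5]"
  by code_simp

lemma tournament_16: "\<forall>k\<in>{0, 4, 6, 8, 10, 12, 14, 16}. tournament 16 k"
  using tournament_starters[OF starter_14_1_0_2 tournament_2]
    tournament_starters[OF starter_12_1_0_4 tournament_4]
    tournament_starters[OF starter_12_0_1_4 tournament_4]
    tournament_starters[OF starter_6_1_1_4 tournament_4]
    tournament_starters[OF starter_4_2_2_0 tournament_0]
  by simp

lemma starter_15_1_0_2: "starter 15 1 1 2 False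
    [2,16,11,15,9,11,12,3,3,10,10,7,4,14,2,13,5,6] []"
  by code_simp

lemma starter_13_1_0_4: "starter 13 1 1 4 False
    [11,2,6,11,15,5,3,13,16,9,12,14,3,5,8,7,1,8,7,10] []"
  by code_simp

lemma starter_12_0_1_5: "starter 12 1 0 5 False
    [9,14,4,10,10,15,1,13,16,0,5,12,4,11,6,2,3,0,5,6,1,3] []"
  by code_simp

lemma starter_8_1_1_1: "starter 8 2 1 1 False
    [6,14,12,8,16,2,2,15,8,9,15,13,11,4,1,3,5,11,4,1,9,12,12,3,16,12,9,7,0,1,6,10,9,6] [3,7]"
  by code_simp

lemma tournament_17: "\<forall>k\<in>{1, 5, 9, 13, 15, 17}. tournament 17 k"
  using tournament_starters[OF starter_15_1_0_2 tournament_2]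
    tournament_starters[OF starter_13_1_0_4 tournament_4]
    tournament_starters[OF starter_12_0_1_5 tournament_5]
    tournament_starters[OF starter_8_1_1_1 tournament_1]
  by simp

lemma starter_16_1_0_2: "starter 16 1 1 2 False
    [4,9,16,11,17,6,12,14,7,4,5,1,14,13,12,2,10,1] [13,5]"
  by code_simp

lemma starter_14_1_0_4: "starter 14 1 1 4 False
    [16,8,9,5,15,11,6,14,4,10,10,17,9,11,3,12,1,2,12,1] [13,6]"
  by code_simp

lemma starter_14_0_1_4: "starter 14 1 0 4 False
    [13,4,17,2,14,10,4,15,16,13,12,1,1,3,11,5,7,11,5,6,9,2] []"
  by code_simp

lemma starter_8_1_1_2: "starter 8 2 1 2 False
    [3,9,15,7,4,8,16,4,11,15,1,10,12,16,6,11,17,6,10,17,2,5,9,6,13,14,3,13,11,4,12,14,5,7,14,9,1,2] [7,3]"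
  by code_simp

lemma starter_6_2_1_0: "starter 6 3 2 0 False
    [6,2,15,7,13,5,5,15,14,17,10,16,9,8,16,6,7,14,17,4,3,12,8,3,2,10,12,9,17,5,2,3,3,9,0,2,8,10,
     12,1,16,15,9,14,12,14,2,9,5,8] [4,1,11,8]"
  by code_simp

lemma starter_5_1_2_3: "starter 5 3 1 3 True
    [11,2,14,7,3,6,16,9,10,16,8,5,17,13,13,15,15,3,12,11,4,1,7,17,9,15,3,2,5,10,10,0,13,9,17,4,
     1,12,12,6,0,16,8,7,14,9,7,2,3,11,4,6,11,4,9,12,8,2,14,11,0,9] []"
  by code_simp

lemma tournament_18: "\<forall>k\<in>{0, 4, 6, 8, 12, 14, 16, 18}. tournament 18 k"
  using tournament_starters[OF starter_16_1_0_2 tournament_2]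
    tournament_starters[OF starter_14_1_0_4 tournament_4]
    tournament_starters[OF starter_14_0_1_4 tournament_4]
    tournament_starters[OF starter_8_1_1_2 tournament_2]
    tournament_starters[OF starter_6_2_1_0 tournament_0]
    tournament_starters[OF starter_5_1_2_3 tournament_3]
  by simp

lemma starter_15_1_0_4: "starter 15 1 1 4 False
    [9,18,16,4,15,13,5,11,14,17,12,2,6,5,7,4,12,8,3,1,10,3] []"
  by code_simp

lemma starter_14_0_1_5: "starter 14 1 0 5 False
    [6,18,15,3,16,7,3,11,0,14,10,8,8,17,2,12,10,11,6,13,0,5,12,9] []"
  by code_simp

lemma starter_13_1_0_6: "starter 13 1 1 6 False
    [18,12,13,8,15,6,1,17,14,4,7,16,5,9,2,10,9,2,3,4,7,5,11,8] []"
  by code_simp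

lemma starter_8_1_1_3: "starter 8 2 1 3 False
    [12,18,1,6,9,1,5,17,14,10,16,2,15,13,10,16,17,12,8,9,3,5,8,6,2,18,14,2,3,9,4,13,8,1,8,11,3,4,
     15,2,1,12] [7,3]"
  by code_simp

lemma starter_6_1_2_1: "starter 6 3 1 1 False
    [4,14,9,18,2,17,16,15,3,10,15,13,8,16,11,6,10,2,14,9,7,1,6,12,5,8,17,5,1,11,0,17,13,5,6,9,9,7,
     5,18,3,8,11,14,18,13,3,5,12,15,17,4,11,12,3,4,17,7] [1,4]"
  by code_simp

lemma tournament_19: "\<forall>k\<in>{1, 5, 7, 9, 13, 15, 17, 19}. tournament 19 k"
  using tournament_starters[OF starter_15_1_0_4 tournament_4]
    tournament_starters[OF starter_14_0_1_5 tournament_5]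
    tournament_starters[OF starter_13_1_0_6 tournament_6]
    tournament_starters[OF starter_8_1_1_3 tournament_3]
    tournament_starters[OF starter_6_1_2_1 tournament_1]
  by simp

lemma starter_18_1_0_2: "starter 18 1 1 2 False
    [4,14,7,8,10,15,18,2,15,4,19,17,8,12,3,9,16,14,6,9] [2,11]"
  by code_simp

lemma starter_16_1_0_4: "starter 16 1 1 4 False
    [9,11,11,6,5,16,1,7,17,12,19,3,6,18,1,8,5,2,10,14,14,15] [12,4]"
  by code_simp

lemma starter_16_0_1_4: "starter 16 1 0 4 False
    [9,19,2,10,16,3,6,1,11,17,5,9,4,14,15,18,12,14,4,1,11,10,5,12] []"
  by code_simp

lemma starter_8_1_1_4: "starter 8 2 1 4 False
    [12,4,4,15,18,10,7,9,9,16,11,7,6,19,2,17,19,8,16,6,17,12,18,4,7,14,14,10,6,12,13,14,1,4,14,8,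
     0,1,1,10,15,2,3,5,13,10] [1,5]"
  by code_simp

lemma starter_5_1_2_5: "starter 5 3 1 5 True
    [9,16,18,4,17,2,7,15,19,5,13,1,8,13,3,7,5,17,10,6,4,19,15,11,0,16,10,8,18,5,19,14,9,12,12,18,
     4,15,17,11,0,2,16,11,3,6,7,13,10,4,10,12,2,7,8,2,9,14,3,5,12,3,14,1,1,11,6,8,12,11,0,1,5,6] []"
  by code_simp

lemma tournament_20: "\<forall>k\<in>{0, 4, 6, 8, 10, 12, 16, 18, 20}. tournament 20 k"
  using tournament_starters[OF starter_18_1_0_2 tournament_2]
    tournament_starters[OF starter_16_1_0_4 tournament_4]
    tournament_starters[OF starter_16_0_1_4 tournament_4]
    tournament_starters[OF starter_8_1_1_4 tournament_4]
    tournament_starters[OF starter_5_1_2_5 tournament_5]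
  by simp

lemma starter_17_1_0_4: "starter 17 1 1 4 False
    [17,15,7,11,19,13,3,6,6,4,13,20,18,12,1,2,14,8,8,15,3,12,9,4] []"
  by code_simp

lemma starter_15_1_0_6: "starter 15 1 1 6 False
    [2,5,18,11,12,16,19,3,7,15,13,17,20,8,6,5,4,11,14,8,12,10,10,6,13,3] []"
  by code_simp

lemma starter_14_0_1_7: "starter 14 1 0 7 False
    [5,15,3,17,16,12,14,3,12,19,6,18,20,9,13,10,5,1,6,7,2,11,10,8,11,4,8,0] []"
  by code_simp

lemma starter_8_1_1_5: "starter 8 2 1 5 False
    [20,5,17,12,16,9,9,10,8,19,12,8,1,6,18,15,5,18,11,14,19,1,17,2,6,16,15,20,5,3,11,6,5,12,2,3,
     11,13,13,2,7,9,4,13,8,4,7,15,14,0] [7,3]"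
  by code_simp

lemma tournament_21: "\<forall>k\<in>{1, 3, 5, 7, 9, 13, 15, 17, 19, 21}. tournament 21 k"
  using tournament_starters[OF starter_17_1_0_4 tournament_4]
    tournament_starters[OF starter_15_1_0_6 tournament_6]
    tournament_starters[OF starter_14_0_1_7 tournament_7]
    tournament_starters[OF starter_8_1_1_5 tournament_5]
  by simp

lemma starter_18_0_1_4: "starter 18 1 0 4 False
    [14,7,21,2,20,4,16,6,4,0,7,16,3,19,11,5,18,8,9,8,10,5,11,9,15,12] []"
  by code_simp

lemma starter_15_1_0_7: "starter 15 1 1 7 False
    [11,15,17,7,21,9,7,20,18,2,10,16,19,11,8,14,1,8,13,9,12,13,14,2,6,1,5,3] []"
  by code_simp

lemma starter_5_1_2_7: "starter 5 3 1 7 True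
    [4,15,1,19,8,16,10,17,20,7,21,14,12,20,16,11,17,8,5,21,18,9,14,18,18,2,19,10,3,17,7,11,10,15,
     21,4,0,16,15,5,0,20,19,5,6,13,0,8,12,4,1,7,12,2,9,12,10,11,6,9,0,3,2,6,7,12,14,2,5,9,3,4,
     11,14,12,3,1,6,7,13,13,2,9,14,2,9] []"
  by code_simp

lemma tournament_22: "\<forall>k\<in>{0, 4, 6, 8, 10, 12, 16, 18, 20, 22}. tournament 22 k"
  using tournament_starters[OF starter_18_0_1_4 tournament_4]
    tournament_starters[OF starter_15_1_0_7 tournament_7]
    tournament_starters[OF starter_5_1_2_7 tournament_7]
  by simp

lemma starter_16_1_0_7: "starter 16 1 1 7 False
    [17,9,21,12,6,16,18,8,22,4,7,20,2,19,13,9,10,11,7,13,15,1,5,12,14,3,2,5] [14,6]"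
  by code_simp

lemma starter_16_0_1_7: "starter 16 1 0 7 False
    [0,16,11,21,18,8,17,10,3,20,22,13,2,1,8,19,12,4,2,14,4,15,6,9,3,1,7,13,5,12] []"
  by code_simp

lemma starter_8_1_1_7: "starter 8 2 1 7 False
    [19,7,7,20,16,11,17,13,22,2,5,21,21,10,3,18,11,22,18,12,1,17,19,10,10,20,8,15,2,16,14,10,0,6,
     15,13,5,0,9,14,4,5,8,4,1,11,1,9,12,7,3,12,9,3,4,15,11,4] [2,6]"
  by code_simp

lemma tournament_23: "\<forall>k\<in>{1, 3, 5, 7, 9, 11, 13, 15, 17, 19, 21, 23}. tournament 23 k"
  using tournament_starters[OF starter_16_1_0_7 tournament_7]
    tournament_starters[OF starter_16_0_1_7 tournament_7]
    tournament_starters[OF starter_8_1_1_7 tournament_7]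
  by simp

lemma starter_17_1_0_7: "starter 17 1 1 7 False
    [15,6,11,18,7,17,14,20,12,19,23,5,21,16,2,22,13,10,3,8,8,1,2,6,12,13,15,4,1,3] []"
  by code_simp

lemma starter_16_0_1_8: "starter 16 1 0 8 False
    [5,20,0,21,22,2,14,19,10,17,18,12,23,0,16,9,3,11,1,8,8,13,15,2,13,7,6,4,11,12,7,3] []"
  by code_simp

lemma starter_10_1_1_4: "starter 10 2 1 4 False
    [6,21,12,19,11,20,16,17,9,14,1,23,19,3,23,15,14,7,18,9,22,13,8,4,10,16,5,22,6,3,21,11,0,18,
     13,2,9,20,6,4,14,16,1,2,16,11,2,15,15,5,11,7,8,10] [3,8]"
  by code_simp

lemma starter_6_2_1_6: "starter 6 3 2 6 False
    [14,19,11,18,23,12,5,1,16,20,10,16,13,21,8,10,20,11,22,2,4,5,2,23,6,22,21,4,17,22,1,19,15,18,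
     4,20,8,21,23,10,14,12,18,1,10,17,6,19,17,12,17,3,8,7,1,12,14,17,3,9,7,4,8,1,13,10,0,13,15,7,
     0,16,11,0,3,15,11,3,13,9,7,12,17,2,4,8] [9,6,5,2]"
  by code_simp

lemma tournament_24: "\<forall>k\<in>{0, 2, 4, 6, 8, 10, 12, 14, 16, 18, 20, 22, 24}. tournament 24 k"
  using tournament_starters[OF starter_17_1_0_7 tournament_7]
    tournament_starters[OF starter_16_0_1_8 tournament_8]
    tournament_starters[OF starter_10_1_1_4 tournament_4]
    tournament_starters[OF starter_6_2_1_6 tournament_6]
  by simp

lemma starter_18_0_1_7: "starter 18 1 0 7 False
    [9,24,3,7,16,23,19,0,18,2,22,16,20,9,21,14,13,10,12,7,5,4,3,11,11,0,17,8,15,17,6,12] []"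
  by code_simp

lemma starter_17_1_0_8: "starter 17 1 1 8 False
    [17,7,18,11,19,6,23,15,13,24,20,16,2,21,5,22,13,12,10,15,2,4,1,7,3,16,9,1,4,14,5,8] []"
  by code_simp

lemma starter_6_1_2_7: "starter 6 3 1 7 False
    [24,16,21,6,6,18,4,9,23,13,11,19,18,2,13,22,7,10,16,20,8,23,20,8,19,1,22,3,14,21,20,2,12,16,
     16,19,3,24,23,4,2,9,6,22,24,7,13,18,15,14,1,21,17,2,11,10,0,16,5,17,10,1,17,9,14,9,0,5,11,17,
     15,12,5,11,10,0,7,14,12,9,1,5,11,3,17,7,3,14,12,5,1,15,9,7] [1,4]"
  by code_simp

lemma tournament_25: "\<forall>k\<in>{1, 3, 5, 7, 9, 11, 13, 17, 19, 21, 23, 25}. tournament 25 k"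
  using tournament_starters[OF starter_18_0_1_7 tournament_7]
    tournament_starters[OF starter_17_1_0_8 tournament_8]
    tournament_starters[OF starter_6_1_2_7 tournament_7]
  by simp

lemma starter_19_1_0_7: "starter 19 1 1 7 False
    [11,22,13,6,20,9,9,25,1,4,5,21,15,24,19,3,23,17,12,10,7,2,14,3,1,16,13,7,2,12,16,17] []"
  by code_simp

lemma starter_18_0_1_8: "starter 18 1 0 8 False
    [7,20,25,5,24,11,16,21,18,17,2,23,10,22,5,7,11,19,1,13,16,1,8,0,10,6,13,14,0,9,9,4,4,15] []"
  by code_simp

lemma starter_10_1_1_6: "starter 10 2 1 6 False
    [24,10,14,21,6,2,13,20,25,1,22,18,18,13,3,22,5,17,23,9,4,5,17,15,12,25,10,23,3,20,6,24,12,18,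
     7,13,21,7,14,15,5,8,4,2,17,14,8,16,12,5,11,8,6,16,7,11,15,0,16,7,9,10] [1,6]"
  by code_simp

lemma starter_6_2_1_8: "starter 6 3 2 8 False
    [2,22,6,20,19,7,18,9,23,6,25,13,12,19,5,24,7,25,1,23,24,14,21,5,15,18,9,21,22,16,13,21,18,3,
     20,15,3,20,23,13,25,2,11,24,10,22,5,19,13,12,16,4,7,9,2,17,2,8,11,14,13,0,15,17,8,0,4,7,
     17,14,1,5,11,6,4,3,10,17,14,8,3,13,9,4,15,11,12,10,4,12,8,1,11,16,12,1,5,9] [11,8,2,5]"
  by code_simp

lemma tournament_26: "\<forall>k\<in>{0, 2, 4, 6, 8, 10, 12, 14, 16, 18, 20, 22, 24, 26}. tournament 26 k"
  using tournament_starters[OF starter_19_1_0_7 tournament_7]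
    tournament_starters[OF starter_18_0_1_8 tournament_8]
    tournament_starters[OF starter_10_1_1_6 tournament_6]
    tournament_starters[OF starter_6_2_1_8 tournament_8]
  by simp

lemma starter_19_1_0_8: "starter 19 1 1 8 False
    [10,7,12,21,5,20,19,1,22,14,26,4,3,24,25,3,1,23,12,8,5,11,13,2,6,7,18,13,16,4,8,18,17,15] []"
  by code_simp

lemma starter_18_0_1_9: "starter 18 1 0 9 False
    [7,21,18,15,2,26,15,20,6,19,8,23,5,22,16,24,4,25,3,17,4,12,10,3,14,9,9,0,12,14,7,10,0,1,5,11] []"
  by code_simp

lemma starter_10_1_1_7: "starter 10 2 1 7 False
    [20,10,14,22,5,25,7,23,11,9,13,19,9,8,21,14,6,24,3,21,24,15,17,26,26,5,15,16,15,23,3,22,2,20,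
     4,17,25,15,17,12,5,1,4,18,18,0,13,2,4,14,7,16,13,8,11,4,6,12,18,10,3,5,1,8,19,16] [1,6]"
  by code_simp

lemma tournament_27: "\<forall>k\<in>{1, 3, 5, 7, 9, 11, 13, 15, 17, 19, 21, 23, 25, 27}. tournament 27 k"
  using tournament_starters[OF starter_19_1_0_8 tournament_8]
    tournament_starters[OF starter_18_0_1_9 tournament_9]
    tournament_starters[OF starter_10_1_1_7 tournament_7]
  by simp

lemma starter_20_1_0_8: "starter 20 1 1 8 False
    [6,25,19,7,1,24,21,19,14,20,18,22,23,10,9,27,12,26,14,13,4,2,16,10,13,4,8,11,11,7,2,17,15,8] [16,6]"
  by code_simp

lemma starter_20_0_1_8: "starter 20 1 0 8 False
    [25,12,17,7,24,5,22,2,13,23,20,13,8,27,19,21,3,4,26,6,10,1,18,0,3,10,19,4,16,12,9,6,0,14,17,9] []"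
  by code_simp

lemma starter_10_1_1_8: "starter 10 2 1 8 False
    [17,26,12,15,11,25,7,22,14,27,23,17,27,2,15,20,21,6,24,19,20,4,10,21,3,23,8,24,5,7,26,6,19,15,
     13,22,25,2,12,1,3,15,5,18,17,9,11,5,8,17,13,9,1,11,8,2,11,10,9,16,18,3,14,19,0,1,7,4,10,18] [6,1]"
  by code_simp

lemma tournament_28: "\<forall>k\<in>{0, 2, 4, 6, 8, 10, 12, 14, 16, 18, 20, 22, 24, 26, 28}. tournament 28 k"
  using tournament_starters[OF starter_20_1_0_8 tournament_8]
    tournament_starters[OF starter_20_0_1_8 tournament_8]
    tournament_starters[OF starter_10_1_1_8 tournament_8]
  by simp

lemma starter_21_1_0_8: "starter 21 1 1 8 False
    [4,15,16,22,10,27,12,26,1,2,25,12,17,21,23,19,20,28,5,24,4,19,6,15,1,3,20,7,18,13,13,9,5,8,9,2] []"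
  by code_simp

lemma starter_20_0_1_9: "starter 20 1 0 9 False
    [14,27,20,19,10,21,9,26,22,18,24,6,28,10,23,4,25,0,2,14,8,1,16,6,2,7,3,12,9,8,15,19,17,15,
     11,5,1,18] []"
  by code_simp

lemma starter_10_1_1_9: "starter 10 2 1 9 False
    [19,22,1,25,24,15,23,6,16,21,3,26,28,11,27,5,7,20,21,8,20,19,26,14,15,27,5,28,14,12,25,18,
     12,23,24,1,9,22,4,13,15,1,10,9,7,10,13,14,9,6,7,6,14,18,1,18,10,8,17,10,0,4,12,4,5,15,16,11,
     8,0,2,17,11,5] [8,3]"
  by code_simp

lemma tournament_29: "\<forall>k\<in>{1, 3, 5, 7, 9, 11, 13, 15, 17, 19, 21, 23, 25, 27, 29}. tournament 29 k"
  using tournament_starters[OF starter_21_1_0_8 tournament_8]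
    tournament_starters[OF starter_20_0_1_9 tournament_9]
    tournament_starters[OF starter_10_1_1_9 tournament_9]
  by simp

lemma starter_22_1_0_8: "starter 22 1 1 8 False
    [13,5,20,29,2,28,7,27,16,23,1,24,26,19,25,4,15,20,22,7,2,8,15,17,8,9,1,10,14,21,9,6,10,14,13,3] [5,16]"
  by code_simp

lemma starter_20_0_1_10: "starter 20 1 0 10 False
    [21,15,23,1,27,3,24,11,28,16,22,12,25,8,2,20,29,18,26,6,13,12,10,13,5,3,0,15,9,18,17,4,19,5,
     7,17,4,8,2,10] []"
  by code_simp

lemma starter_10_2_1_0: "starter 10 3 2 0 False
    [2,24,11,22,22,4,25,16,9,23,3,6,8,18,28,14,27,25,29,20,6,13,19,27,26,9,4,12,18,28,14,15,7,5,
     21,26,10,17,5,11,17,3,16,7,13,2,24,8,19,4,18,14,0,29,2,22,27,15,4,27,24,11,15,13,14,21,29,26,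
     22,17,6,19,9,20,7,1,18,6,6,21,17,23,1,2,25,29] [15,10,8,3]"
  by code_simp

lemma starter_7_1_2_9: "starter 7 3 1 9 True
    [10,22,1,21,28,18,13,29,9,23,18,26,25,13,29,1,17,4,14,24,24,10,23,5,20,11,26,7,5,27,4,25,
     27,14,13,27,11,10,22,4,9,21,3,28,5,24,0,26,21,14,14,23,28,11,25,20,22,19,29,14,1,17,16,11,
     0,2,10,16,3,8,18,17,8,6,12,16,6,7,15,5,19,12,7,15,0,3,8,2,1,20,20,13,17,7,3,18,13,2,15,19,
     2,12,7,0,20,6,5,16,12,7,2,3,17,19,11,8] []"
  by code_simp

lemma starter_6_3_1_6: "starter 6 4 3 6 False
    [2,18,4,15,3,24,14,29,6,27,10,21,28,6,16,26,22,4,8,25,17,19,18,13,26,10,25,14,27,12,15,17,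
     12,28,24,11,29,22,1,9,16,2,23,25,9,18,11,1,3,29,5,11,28,20,7,4,21,26,10,14,13,8,22,23,20,27,
     14,24,27,3,19,24,10,11,28,0,9,29,20,18,17,20,26,5,19,12,25,3,4,5,20,7,12,0,4,21,6,15,23,20,
     0,15,13,3,11,9,3,5,9,19,17,11,20,14,5,19,16,17,19,7,8,3,16,9,19,4,6,14,4,23,7,21,22,12,14,1,
     0,7] [11,8,2,5,13,16]"
  by code_simp

lemma tournament_30: "\<forall>k\<in>{0, 2, 4, 6, 8, 10, 12, 14, 16, 18, 20, 22, 24, 26, 28,
    30}. tournament 30 k"
  using tournament_starters[OF starter_22_1_0_8 tournament_8]
    tournament_starters[OF starter_20_0_1_10 tournament_10]
    tournament_starters[OF starter_10_2_1_0 tournament_0]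
    tournament_starters[OF starter_7_1_2_9 tournament_9]
    tournament_starters[OF starter_6_3_1_6 tournament_6]
  by simp

lemma starter_24_0_1_7: "starter 24 1 0 7 False
    [28,3,22,6,10,16,1,30,7,26,11,29,27,10,16,25,9,24,0,22,5,17,21,11,19,20,23,14,1,8,4,17,12,15,
     15,19,13,18] []"
  by code_simp

lemma starter_21_1_0_10: "starter 21 1 1 10 False
    [17,21,26,1,16,25,27,15,14,23,24,10,19,28,22,14,7,30,29,18,6,10,11,2,5,18,2,5,8,15,4,3,20,9,
     17,12,7,13,3,1] []"
  by code_simp

lemma starter_12_1_1_7: "starter 12 2 1 7 False
    [3,27,29,4,26,20,28,9,22,11,8,25,12,18,23,13,10,8,21,12,19,15,7,6,24,16,30,21,1,24,25,22,9,30,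
     26,0,18,29,16,6,28,19,8,11,27,20,10,16,12,9,1,18,15,7,19,14,9,4,7,20,18,2,14,13,2,10,3,15,
     22,1,23,4,5,19] [11,5]"
  by code_simp

lemma starter_7_1_2_10: "starter 7 3 1 10 True
    [12,26,5,29,22,15,8,30,24,13,14,28,3,21,25,7,18,27,23,12,21,10,28,1,6,25,2,23,30,18,17,24,
     27,5,2,26,29,18,22,6,11,28,24,3,25,17,4,30,23,14,14,7,20,21,7,27,16,26,22,13,29,9,16,13,12,0,
     5,20,20,4,2,15,12,8,17,9,4,1,8,19,19,1,11,17,2,12,4,16,13,8,18,1,9,10,5,6,20,18,6,7,15,18,
     10,4,14,15,9,5,0,7,2,11,10,19,17,3,8,20,16,9,3,5] []"
  by code_simp

lemma tournament_31: "\<forall>k\<in>{1, 3, 5, 7, 9, 11, 13, 15, 17, 19, 21, 23, 25, 27, 29,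
    31}. tournament 31 k"
  using tournament_starters[OF starter_24_0_1_7 tournament_7]
    tournament_starters[OF starter_21_1_0_10 tournament_10]
    tournament_starters[OF starter_12_1_1_7 tournament_7]
    tournament_starters[OF starter_7_1_2_10 tournament_10]
  by simp

section \<open>Starters from 34 men on: all players married, or few spouse pairs\<close>

lemma starter_33_1_0_1: "starter 33 1 1 1 False
    [15,8,27,18,22,33,30,2,6,16,3,5,2,31,29,17,13,29,23,15,18,12,21,20,4,23,17,6,14,27,26,11,22,19] []"
  by code_simp

text \<open>Here n is 4 m + 2, with m = 8. The like-named lemmas below treat remainders 2, 3 and 6
  for the group size used at their order. No all-married tournament with 2, 3 or 6 men exists for
  the truncated group, so \<open>k = n\<close> needs a starter.\<close>

lemma sols_34: "tournament 34 34"
  using tournament_starters[OF starter_33_1_0_1 tournament_1] by simp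

lemma starter_37_1_0_1: "starter 37 1 1 1 False
    [32,9,5,37,17,34,22,32,35,23,25,22,24,13,36,5,15,36,20,24,12,21,4,33,11,16,26,27,30,11,23,8,
     19,26,1,25,4,2] []"
  by code_simp

lemma sols_38: "tournament 38 38"
  using tournament_starters[OF starter_37_1_0_1 tournament_1] by simp

lemma low_41: "\<exists>ws. low_starter 41 ws"
  by (rule exI[of _
   "[39,17,5,11,27,10,6,37,20,0,1,31,36,21,31,26,15,13,40,27,2,14,38,33,34,12,12,22,0,9,24,35,
     11,30,7,30,16,23,20,19,4,22,18,10,1,32,5,26]"])
    code_simp

lemma starter_41_1_0_1: "starter 41 1 1 1 False
    [29,20,11,36,13,40,21,26,35,37,28,4,30,33,2,14,27,1,17,11,8,15,10,21,3,25,16,29,20,12,24,34,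
     36,16,41,32,25,24,23,27,13,31] []"
  by code_simp

lemma sols_42: "tournament 42 42"
  using tournament_starters[OF starter_41_1_0_1 tournament_1] by simp

lemma low_42: "\<exists>ws. low_starter 42 ws"
  by (rule exI[of _
   "[36,17,23,37,19,39,27,11,6,41,2,3,34,24,18,6,21,4,25,32,30,5,9,40,38,13,14,18,3,26,10,8,35,29,
     27,13,25,1,7,33,2,5,9,24,14,8,20,15,33,20]"])
    code_simp

lemma low_43: "\<exists>ws. low_starter 43 ws"
  by (rule exI[of _
   "[6,41,33,40,31,42,36,25,12,15,16,20,18,16,4,33,8,22,3,21,20,4,30,0,27,38,22,13,17,34,28,3,
     0,39,5,37,17,7,1,32,27,26,24,1,26,2,6,34,30,15]"])
    code_simp

lemma low_44: "\<exists>ws. low_starter 44 ws"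
  by (rule exI[of _
   "[18,1,39,18,2,22,29,11,11,10,43,28,9,37,40,5,6,19,13,27,15,9,32,24,38,7,28,13,23,36,3,0,42,21,
     14,41,29,31,12,1,34,8,15,27,30,26,31,24,26,21,16,25]"])
    code_simp

lemma low_45: "\<exists>ws. low_starter 45 ws"
  by (rule exI[of _
   "[40,21,43,29,31,33,21,42,7,24,4,0,25,9,9,8,38,19,15,34,3,44,5,35,35,26,41,15,39,23,29,4,6,12,
     28,14,18,3,11,37,20,17,7,14,6,16,16,11,32,12,25,36]"])
    code_simp

lemma starter_45_1_0_1: "starter 45 1 1 1 False
    [31,18,7,35,40,28,18,33,13,21,37,16,30,10,9,44,5,24,14,32,8,45,39,38,11,2,23,20,44,13,42,40,
     20,36,35,39,38,15,27,22,32,25,28,34,12,1] []"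
  by code_simp

lemma sols_46: "tournament 46 46"
  using tournament_starters[OF starter_45_1_0_1 tournament_1] by simp

lemma low_46: "\<exists>ws. low_starter 46 ws"
  by (rule exI[of _
   "[36,19,20,44,40,11,12,7,42,14,33,6,5,45,28,34,43,23,19,33,24,38,2,1,37,17,41,30,31,12,10,3,
     21,39,11,2,29,26,0,30,25,13,37,15,5,1,15,17,29,6,22,32,21,34]"])
    code_simp

lemma starter_47_1_0_0: "starter 47 1 1 0 False
    [36,30,34,27,22,41,26,13,14,15,1,12,30,18,46,2,13,21,43,14,19,39,8,45,20,3,7,31,35,10,32,37,
     23,44,44,11,18,34,45,36,3,5,39,24,24,28] []"
  by code_simp

lemma sols_47: "tournament 47 47"
  using tournament_starters[OF starter_47_1_0_0 tournament_0] by simp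

lemma low_47: "\<exists>ws. low_starter 47 ws"
  by (rule exI[of _
   "[21,30,20,42,25,21,13,43,19,11,5,4,34,19,0,41,3,6,1,40,11,44,46,5,16,35,2,37,31,7,9,2,15,25,
     4,17,45,29,28,10,23,17,1,24,24,36,13,27,36,7,15,35,12,14]"])
    code_simp

lemma low_48: "\<exists>ws. low_starter 48 ws"
  by (rule exI[of _
   "[43,21,47,9,46,28,39,6,5,3,33,19,44,17,18,38,11,1,22,31,36,40,1,20,6,7,19,11,41,30,31,4,3,45,
     26,22,35,42,16,34,32,9,14,17,13,24,37,12,23,29,18,23,24,0,39,27]"])
    code_simp

lemma low_49: "\<exists>ws. low_starter 49 ws"
  by (rule exI[of _
   "[15,36,19,41,6,44,25,48,9,42,37,28,13,8,3,32,31,19,34,0,20,2,38,11,5,47,27,43,30,23,7,10,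
     29,40,45,29,4,5,16,18,18,46,35,12,1,26,30,2,20,14,7,17,16,0,25,21]"])
    code_simp

lemma starter_49_1_0_1: "starter 49 1 1 1 False
    [23,45,34,33,14,44,46,40,8,25,25,48,37,1,24,20,19,31,48,8,39,29,16,23,27,2,26,5,5,36,13,18,
     9,24,33,47,32,34,6,49,28,17,10,26,17,9,30,27,21,1] []"
  by code_simp

lemma sols_50: "tournament 50 50"
  using tournament_starters[OF starter_49_1_0_1 tournament_1] by simp

lemma low_50: "\<exists>ws. low_starter 50 ws"
  by (rule exI[of _
   "[47,34,38,33,45,13,46,27,15,31,41,7,8,4,19,43,4,39,27,8,14,32,17,23,48,6,36,19,29,40,34,2,
     44,20,2,30,6,42,32,49,0,41,28,16,38,18,15,24,25,22,16,37,0,13,9,7,24,9]"])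
    code_simp

lemma low_51: "\<exists>ws. low_starter 51 ws"
  by (rule exI[of _
   "[21,8,45,35,37,43,5,50,12,37,15,23,47,32,44,30,42,18,48,12,11,40,31,28,49,4,20,42,0,16,26,22,
     19,14,43,26,24,13,14,24,13,39,46,17,41,27,11,34,15,3,21,23,3,10,27,36,31,30]"])
    code_simp

lemma low_52: "\<exists>ws. low_starter 52 ws"
  by (rule exI[of _
   "[38,16,6,19,24,1,50,34,41,26,3,43,32,18,14,8,18,11,27,45,46,31,26,48,8,20,16,33,47,24,31,29,
     49,12,12,23,51,3,44,42,34,10,10,7,40,35,35,1,0,25,28,36,30,4,22,23,27,43,5,40]"])
    code_simp

lemma low_53: "\<exists>ws. low_starter 53 ws"
  by (rule exI[of _
   "[43,34,48,14,44,40,8,31,16,19,39,37,34,45,25,49,30,18,17,12,47,0,15,32,6,26,42,9,28,1,52,10,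
     50,35,23,8,21,43,4,25,51,24,46,44,29,22,23,7,20,19,16,10,38,0,15,1,29,11,36,26]"])
    code_simp

lemma low_54: "\<exists>ws. low_starter 54 ws"
  by (rule exI[of _
   "[31,44,50,2,53,41,24,22,52,17,21,39,14,26,51,1,6,25,9,38,27,31,23,3,40,47,5,40,11,14,46,33,
     29,19,48,21,25,34,30,24,7,29,22,8,36,49,5,10,28,13,18,41,4,34,9,1,23,44,35,42,36,35]"])
    code_simp

lemma low_55: "\<exists>ws. low_starter 55 ws"
  by (rule exI[of _
   "[9,6,21,13,49,28,47,36,43,51,20,7,38,42,29,39,39,16,12,18,36,0,24,26,18,48,46,37,26,9,15,35,
     34,10,10,52,53,4,40,33,54,27,3,24,50,45,17,3,44,28,34,16,1,44,23,4,22,0,46,45,15,30]"])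
    code_simp

lemma low_56: "\<exists>ws. low_starter 56 ws"
  by (rule exI[of _
   "[19,55,48,25,10,6,21,16,47,40,50,23,51,45,7,5,4,14,40,8,20,41,54,36,25,39,29,28,53,46,27,44,
     44,2,37,34,0,49,42,31,41,52,43,13,8,32,2,10,0,22,1,36,24,15,3,18,35,6,37,1,38,13,4,32]"])
    code_simp

lemma low_57: "\<exists>ws. low_starter 57 ws"
  by (rule exI[of _
   "[54,22,16,2,37,49,2,8,17,37,7,53,27,4,44,46,14,32,34,38,39,40,18,51,55,18,40,7,9,30,11,35,
     33,42,1,9,12,50,45,23,31,41,35,56,52,31,13,0,22,17,11,36,21,6,19,30,3,10,27,24,15,49,29,48]"])
    code_simp

lemma starter_51_1_0_7: "starter 51 1 1 7 False
    [53,7,57,26,42,30,48,14,20,23,11,51,2,1,43,47,25,43,4,48,17,42,30,52,35,21,50,27,54,31,33,2,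
     46,40,29,50,22,12,28,9,3,19,5,55,21,13,56,38,15,37,10,19,25,36,4,9,20,7,28,1,32,47,24,26] []"
  by code_simp

lemma sols_58: "tournament 58 58"
  using tournament_starters[OF starter_51_1_0_7 tournament_7] by simp

lemma low_58: "\<exists>ws. low_starter 58 ws"
  by (rule exI[of _
   "[9,50,17,18,37,4,33,25,47,20,49,9,38,19,57,3,41,39,5,33,48,22,22,2,43,51,52,0,28,49,2,41,24,6,
     14,53,31,27,18,24,55,21,56,16,20,5,35,54,10,17,44,6,38,13,26,29,40,26,14,27,1,46,23,7,28,19]"])
    code_simp

lemma low_59: "\<exists>ws. low_starter 59 ws"
  by (rule exI[of _
   "[51,9,48,37,2,42,49,19,7,14,58,28,47,20,12,41,20,57,37,24,27,21,44,35,43,47,53,15,6,8,56,44,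
     18,36,4,7,25,49,32,52,46,54,55,33,40,39,24,29,38,23,36,3,34,3,31,17,5,21,22,42,48,31,26,0,
     18,26]"])
    code_simp

lemma low_60: "\<exists>ws. low_starter 60 ws"
  by (rule exI[of _
   "[31,14,47,32,28,37,37,5,29,3,48,0,5,29,10,8,19,58,17,28,6,59,3,26,7,57,41,1,36,41,2,36,4,49,
     35,55,23,44,16,19,27,11,44,31,11,53,56,15,54,13,52,23,12,45,18,8,9,15,16,38,35,21,51,24,
     20,12,34,33]"])
    code_simp

lemma low_61: "\<exists>ws. low_starter 61 ws"
  by (rule exI[of _
   "[34,13,51,12,38,52,20,48,31,4,46,41,25,36,8,1,17,15,60,6,13,30,4,28,56,50,45,44,36,24,57,38,
     26,54,7,39,58,37,43,20,55,22,15,25,59,11,2,10,28,19,33,53,24,5,34,5,45,41,29,11,14,52,27,14,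
     17,23,42,39]"])
    code_simp

lemma low_62: "\<exists>ws. low_starter 62 ws"
  by (rule exI[of _
   "[51,60,30,42,29,53,12,9,3,19,19,59,8,30,20,0,4,27,58,47,25,39,61,46,16,45,47,56,54,2,0,4,
     38,23,35,16,48,43,2,10,26,20,33,7,9,57,49,6,22,55,13,15,7,44,37,1,48,21,32,31,22,15,18,27,
     31,10,35,45,24,11]"])
    code_simp

lemma low_63: "\<exists>ws. low_starter 63 ws"
  by (rule exI[of _
   "[47,21,40,45,29,52,15,43,35,22,38,40,56,10,2,17,33,23,28,59,44,0,51,2,11,36,18,60,0,57,8,14,
     37,13,62,42,61,25,48,6,36,37,53,16,26,8,12,51,32,29,5,1,58,34,55,47,12,1,53,13,49,22,19,10,
     55,21,9,30,5,25]"])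
    code_simp

lemma low_64: "\<exists>ws. low_starter 64 ws"
  by (rule exI[of _
   "[31,27,0,17,48,12,25,22,5,51,21,7,10,35,56,5,57,49,24,61,62,41,36,8,38,40,47,28,12,18,6,50,
     37,2,50,37,20,42,33,59,17,43,58,26,54,36,7,23,35,11,32,55,63,38,60,16,9,16,44,45,48,43,4,51,
     19,8,29,2,34,49,47,39]"])
    code_simp

lemma low_65: "\<exists>ws. low_starter 65 ws"
  by (rule exI[of _
   "[57,52,4,59,44,50,3,39,37,22,53,29,55,15,32,35,19,64,43,8,41,61,5,34,10,14,54,28,28,21,2,23,
     13,46,49,58,39,37,24,36,26,60,33,43,50,1,63,18,31,12,42,26,62,9,12,53,9,17,0,38,45,15,3,34,
     49,48,7,20,25,11,19,30]"])
    code_simp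

lemma starter_65_1_0_1: "starter 65 1 1 1 False
    [2,9,30,64,28,63,56,24,59,53,18,43,52,38,35,15,27,5,50,35,32,34,34,29,33,49,47,6,45,37,12,58,
     63,26,15,2,51,7,14,23,24,50,13,60,64,16,16,13,39,51,5,4,46,65,10,39,6,48,41,31,21,10,40,36,
     17,55] []"
  by code_simp

lemma sols_66: "tournament 66 66"
  using tournament_starters[OF starter_65_1_0_1 tournament_1] by simp

lemma low_66: "\<exists>ws. low_starter 66 ws"
  by (rule exI[of _
   "[59,2,61,10,30,13,42,49,46,48,13,22,28,29,25,64,24,20,4,16,0,34,63,50,60,57,15,43,18,51,20,14,
     49,9,55,45,62,24,39,54,54,28,33,36,58,26,12,23,2,44,21,8,32,65,53,18,41,55,6,35,56,17,31,51,
     30,52,40,9,0,37,42,47,39,31]"])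
    code_simp

lemma starter_67_1_0_0: "starter 67 1 1 0 False
    [56,60,32,37,1,28,63,47,29,10,62,36,45,62,51,48,58,12,26,51,64,31,53,18,57,26,36,64,23,9,
     17,35,31,61,22,32,18,29,16,54,42,20,39,33,2,3,37,45,27,7,9,11,46,34,33,40,4,27,15,58,54,39,
     38,25,48,57] []"
  by code_simp

lemma sols_67: "tournament 67 67"
  using tournament_starters[OF starter_67_1_0_0 tournament_0] by simp

lemma low_67: "\<exists>ws. low_starter 67 ws"
  by (rule exI[of _
   "[27,63,5,44,12,53,43,18,59,46,47,14,26,35,16,47,38,12,31,32,61,6,34,30,20,58,52,50,6,65,4,10,
     19,34,15,25,64,28,40,43,48,56,33,15,0,24,57,45,56,49,25,55,60,4,51,66,62,40,30,16,5,10,17,49,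
     42,58,1,44,13,2,52,32,36,13]"])
    code_simp

lemma low_68: "\<exists>ws. low_starter 68 ws"
  by (rule exI[of _
   "[38,55,66,51,62,16,27,13,14,8,11,2,18,49,48,47,34,19,20,22,41,36,16,35,59,39,65,54,0,48,15,63,
     17,7,45,53,1,50,46,18,52,67,36,43,24,64,44,17,61,57,29,32,8,24,60,15,2,6,28,52,44,19,38,4,
     12,30,21,51,34,55,28,5,56,43,29,7]"])
    code_simp

lemma low_69: "\<exists>ws. low_starter 69 ws"
  by (rule exI[of _
   "[48,16,0,51,13,55,9,34,38,66,10,1,31,39,44,15,62,25,23,29,65,3,61,54,67,40,41,22,24,6,2,50,
     37,38,46,63,51,12,17,64,28,43,36,0,14,52,20,18,4,21,68,44,26,30,1,11,60,26,47,42,50,37,8,5,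
     45,33,23,39,56,25,46,11,2,43,57,35]"])
    code_simp

lemma starter_69_1_0_1: "starter 69 1 1 1 False
    [6,28,57,48,29,34,49,51,3,61,55,22,60,43,64,25,12,39,48,60,32,7,13,64,22,15,18,58,23,29,40,54,
     33,18,20,63,25,69,62,14,41,31,59,46,58,62,43,59,37,17,4,41,8,11,68,33,28,36,26,27,54,13,
     42,66,21,52,9,32,30,11] []"
  by code_simp

lemma sols_70: "tournament 70 70"
  using tournament_starters[OF starter_69_1_0_1 tournament_1] by simp

lemma low_70: "\<exists>ws. low_starter 70 ws"
  by (rule exI[of _
   "[51,28,33,19,48,55,46,9,8,66,42,46,62,30,3,14,36,20,14,23,68,7,37,13,57,10,54,24,30,17,16,67,
     19,41,4,38,56,51,7,59,50,6,61,60,34,64,25,52,65,8,63,47,43,69,0,26,41,22,35,56,12,18,35,15,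
     53,22,61,53,32,44,54,9,21,18,58,29,33,31]"])
    code_simp

lemma low_71: "\<exists>ws. low_starter 71 ws"
  by (rule exI[of _
   "[50,17,46,4,54,65,44,26,12,64,20,5,13,68,40,12,42,39,47,27,31,29,5,1,7,36,32,70,38,54,19,0,
     6,62,27,10,0,52,67,61,59,8,21,46,34,60,52,15,8,19,10,24,57,56,69,13,15,25,66,2,1,59,11,35,
     31,61,22,43,16,25,55,14,41,9,42,35,21,26]"])
    code_simp

lemma low_72: "\<exists>ws. low_starter 72 ws"
  by (rule exI[of _
   "[4,63,17,62,68,5,24,39,71,57,56,17,66,43,34,67,21,47,45,25,53,60,7,13,14,16,47,56,64,21,57,36,
     5,46,8,4,63,28,22,30,27,51,65,38,31,70,0,18,59,37,69,58,37,53,51,19,61,48,44,7,28,0,23,11,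
     27,13,31,48,49,39,45,46,22,25,24,54,29,18,9,40]"])
    code_simp

lemma low_73: "\<exists>ws. low_starter 73 ws"
  by (rule exI[of _
   "[61,6,35,28,62,58,2,35,0,43,16,17,21,67,7,31,58,39,22,50,47,70,19,72,45,71,3,20,63,19,25,45,
     68,27,44,8,60,34,24,56,9,22,8,2,65,51,64,0,49,66,13,38,18,47,43,69,54,46,53,63,52,13,37,16,
     51,1,30,39,29,14,44,41,3,57,62,27,11,59,37,32]"])
    code_simp

lemma low_74: "\<exists>ws. low_starter 74 ws"
  by (rule exI[of _
   "[55,7,58,16,64,10,34,53,44,58,41,37,71,33,39,32,28,44,4,70,32,63,72,13,67,18,20,22,60,27,
     15,12,46,59,0,40,61,1,16,50,10,46,63,68,9,4,29,51,45,36,43,28,73,15,66,47,38,69,13,14,3,24,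
     23,3,56,0,25,17,26,65,34,51,2,57,64,21,8,36,43,18,11,40]"])
    code_simp

lemma low_75: "\<exists>ws. low_starter 75 ws"
  by (rule exI[of _
   "[17,22,7,48,43,66,42,43,13,72,24,0,59,29,68,44,35,19,2,50,26,62,44,31,33,73,23,42,60,4,53,36,
     34,55,32,70,12,74,50,21,27,35,45,12,18,7,9,24,15,11,5,67,8,71,67,57,69,27,16,34,56,10,65,28,
     6,13,31,3,59,25,51,49,46,3,64,61,2,11,1,55,56,30]"])
    code_simp

lemma low_76: "\<exists>ws. low_starter 76 ws"
  by (rule exI[of _
   "[17,31,68,28,18,49,44,69,60,61,35,8,42,74,64,32,61,10,43,38,72,27,36,25,33,4,32,14,57,1,73,37,
     62,71,12,5,65,22,10,34,7,30,41,7,40,2,4,23,31,70,38,41,66,75,25,47,20,0,51,57,6,53,58,66,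
     29,44,37,11,9,5,67,8,60,50,63,23,13,48,36,52,50,63,51,49]"])
    code_simp

lemma low_77: "\<exists>ws. low_starter 77 ws"
  by (rule exI[of _
   "[50,15,12,73,56,43,36,33,65,63,54,59,25,13,5,47,1,8,67,23,27,41,47,31,59,20,2,25,26,7,0,70,
     45,69,42,12,17,39,34,61,57,65,75,26,60,66,74,34,28,76,48,19,33,72,71,51,9,45,24,9,31,27,
     61,40,37,55,35,2,21,38,21,46,44,55,5,15,17,18,30,68,42,51,52,32]"])
    code_simp

lemma low_78: "\<exists>ws. low_starter 78 ws"
  by (rule exI[of _
   "[32,28,36,71,17,7,62,20,38,68,45,32,61,53,18,36,50,17,69,11,58,77,52,6,42,74,30,25,0,38,53,30,
     13,12,37,43,75,62,72,61,67,73,57,70,10,44,5,27,7,56,68,76,24,49,33,2,51,8,20,0,6,15,56,21,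
     34,23,29,3,48,50,63,47,26,12,9,2,18,35,64,9,4,55,69,66,48,19]"])
    code_simp

lemma low_79: "\<exists>ws. low_starter 79 ws"
  by (rule exI[of _
   "[20,25,15,2,3,75,64,18,41,9,53,22,40,12,12,45,47,43,33,39,35,54,6,62,72,69,7,32,63,61,45,44,
     32,53,52,41,59,1,62,14,67,7,1,76,19,16,8,50,30,21,74,37,25,10,13,30,77,28,17,52,78,8,27,63,
     60,31,51,6,61,11,39,73,49,57,58,38,71,9,64,10,20,69,55,21,35,42]"])
    code_simp

lemma low_80: "\<exists>ws. low_starter 80 ws"
  by (rule exI[of _
   "[39,67,3,60,75,56,48,0,17,57,41,11,35,30,47,69,15,33,55,19,29,68,63,34,76,62,77,9,30,22,64,47,
     74,25,71,64,26,46,79,20,1,5,45,32,40,65,34,40,51,13,69,8,78,70,14,41,28,54,44,42,20,29,36,50,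
     72,66,21,24,38,37,19,73,49,65,63,32,36,59,27,6,16,4,21,11,31,50,2,37]"])
    code_simp

lemma low_81: "\<exists>ws. low_starter 81 ws"
  by (rule exI[of _
   "[47,65,44,47,43,26,57,10,21,55,56,3,28,38,78,19,24,80,2,71,38,6,32,4,3,68,9,7,40,63,0,36,
     34,33,52,30,54,61,29,37,33,48,73,13,72,31,74,8,68,39,75,1,13,62,76,0,7,70,10,45,79,56,37,11,
     62,18,19,73,63,57,77,32,30,14,44,1,24,5,41,4,2,26,72,60,22,18,23,36]"])
    code_simp

lemma low_82: "\<exists>ws. low_starter 82 ws"
  by (rule exI[of _
   "[63,37,65,14,74,24,75,64,28,6,37,46,45,17,0,34,7,25,71,59,30,13,48,76,24,69,32,7,25,44,58,54,
     80,39,51,53,46,30,55,5,5,4,42,0,64,3,6,12,73,43,41,2,13,21,27,47,4,68,23,26,14,29,3,81,9,78,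
     77,65,43,79,33,70,53,32,40,47,28,61,52,66,1,44,55,8,9,20,22,17,51,15]"])
    code_simp

lemma low_83: "\<exists>ws. low_starter 83 ws"
  by (rule exI[of _
   "[79,1,69,27,14,5,58,56,55,9,31,15,41,74,3,44,1,16,45,73,54,55,70,49,51,24,75,30,18,75,24,28,
     48,23,64,82,32,72,40,66,38,6,5,76,81,19,42,4,66,48,68,45,29,40,49,80,39,0,59,65,15,39,65,53,
     27,14,20,78,10,57,62,69,77,32,26,12,63,43,47,30,52,74,37,34,22,17,7,73,36,28]"])
    code_simp

lemma low_84: "\<exists>ws. low_starter 84 ws"
  by (rule exI[of _
   "[79,62,67,53,29,36,62,24,26,55,7,75,15,30,47,19,63,68,8,9,46,67,44,81,65,48,30,83,74,10,9,50,
     13,66,3,73,68,64,32,34,72,40,60,82,52,27,5,41,70,43,37,28,41,17,43,77,36,56,24,2,1,47,38,20,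
     28,80,21,31,58,13,40,78,42,0,6,76,60,10,37,53,22,25,33,0,3,22,18,57,25,12,42,31]"])
    code_simp

lemma low_85: "\<exists>ws. low_starter 85 ws"
  by (rule exI[of _
   "[35,8,74,45,19,37,25,68,56,71,80,10,61,4,49,47,12,46,63,77,81,22,29,12,13,36,73,62,50,30,
     21,75,72,27,14,9,26,20,68,38,45,76,54,58,46,84,57,66,78,42,51,70,41,57,6,52,47,11,31,28,
     83,39,27,64,77,49,65,26,20,19,79,29,9,65,53,43,22,82,60,52,40,33,13,38,6,58,69,3,2,40,67,2]"])
    code_simp

lemma low_86: "\<exists>ws. low_starter 86 ws"
  by (rule exI[of _
   "[10,42,4,81,43,68,77,19,1,27,18,65,6,20,33,31,39,43,31,71,72,63,36,59,54,62,78,69,73,44,76,4,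
     74,75,35,82,56,28,79,10,32,5,60,49,46,53,12,48,71,36,3,33,16,13,26,47,51,18,2,15,57,45,84,32,
     25,80,48,72,21,85,70,8,40,1,45,35,83,56,29,44,54,37,39,20,51,69,52,8,6,28,0,5,16,53]"])
    code_simp

lemma low_87: "\<exists>ws. low_starter 87 ws"
  by (rule exI[of _
   "[82,7,49,44,61,21,39,0,51,28,20,69,46,84,10,19,15,23,27,9,22,48,45,25,66,78,70,5,2,55,43,41,
     16,71,67,80,55,31,1,81,29,10,73,52,0,70,36,68,38,42,52,74,7,4,31,1,26,85,9,86,74,29,28,65,
     83,30,50,66,5,38,19,18,21,72,75,62,4,15,72,20,40,34,22,64,73,59,75,58,24,68,34,41,54,8]"])
    code_simp

lemma low_88: "\<exists>ws. low_starter 88 ws"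
  by (rule exI[of _
   "[85,59,69,34,55,47,36,37,27,53,26,77,22,11,41,29,3,26,73,69,12,49,68,81,30,64,56,0,54,7,86,35,
     80,27,79,16,24,79,39,66,65,46,14,23,74,25,15,21,75,82,34,76,63,84,42,57,83,38,61,75,43,4,
     20,60,57,70,62,18,76,87,49,54,35,45,31,10,7,55,70,40,2,5,65,47,3,67,62,40,58,6,9,11,6,13,
     43,23]"])
    code_simp

lemma low_89: "\<exists>ws. low_starter 89 ws"
  by (rule exI[of _
   "[30,23,82,30,2,60,85,18,87,11,65,39,20,6,83,40,76,12,52,19,68,46,47,62,67,20,4,41,1,53,54,33,
     51,43,16,64,86,74,8,2,29,52,58,14,84,21,34,77,12,44,5,88,0,51,11,76,10,7,75,48,40,28,36,47,
     59,78,23,25,72,31,39,79,42,58,70,75,63,1,56,27,41,66,17,71,56,66,50,49,49,62,22,13,15,61,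
     73,77]"])
    code_simp

lemma low_90: "\<exists>ws. low_starter 90 ws"
  by (rule exI[of _
   "[88,34,67,23,60,18,53,5,52,0,47,85,49,72,23,24,22,48,26,87,79,1,62,75,40,12,44,89,9,6,11,4,
     25,36,71,46,56,62,55,28,76,56,24,14,30,9,50,11,2,70,51,10,86,33,0,45,46,22,59,40,12,79,64,52,
     31,67,3,38,14,64,27,78,36,44,57,83,84,71,18,82,61,39,43,38,69,78,74,58,58,41,66,37,3,5,31,13,
     21,54]"])
    code_simp

lemma low_91: "\<exists>ws. low_starter 91 ws"
  by (rule exI[of _
   "[41,82,33,38,17,42,48,36,50,43,21,35,64,56,11,61,57,79,15,81,4,37,75,49,65,76,72,23,56,28,
     16,12,25,72,5,65,74,11,0,19,42,33,18,16,69,30,77,86,45,60,20,89,52,22,6,50,19,83,59,4,85,39,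
     2,87,67,10,43,1,82,59,3,84,44,13,40,88,66,67,46,90,23,75,31,69,70,73,32,68,18,1,26,10,24,14,
     17,30,68,62]"])
    code_simp

lemma low_92: "\<exists>ws. low_starter 92 ws"
  by (rule exI[of _
   "[31,36,75,68,58,35,63,18,24,25,90,54,83,57,86,24,4,32,43,70,61,44,5,53,55,11,79,61,38,67,
     13,83,57,14,22,12,29,27,54,41,42,8,10,84,51,13,76,17,1,43,26,89,6,38,2,74,7,15,36,45,68,3,
     19,66,72,78,80,64,0,91,65,1,53,85,64,75,44,48,62,88,39,69,87,31,20,69,7,40,47,25,51,27,80,59,
     56,3,2,17,9,12]"])
    code_simp

lemma low_93: "\<exists>ws. low_starter 93 ws"
  by (rule exI[of _
   "[81,20,61,10,88,48,11,89,30,45,77,41,26,3,5,57,15,18,80,52,64,35,52,72,12,67,44,81,46,2,16,54,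
     86,79,69,74,2,58,37,4,33,27,13,56,57,46,63,42,72,76,31,33,71,24,20,91,65,82,41,29,32,90,
     21,61,59,43,50,32,4,28,0,8,74,64,25,66,48,21,14,87,17,84,55,92,22,23,49,36,15,1,14,78,22,76,
     38,47,68,75,63,3]"])
    code_simp

lemma low_94: "\<exists>ws. low_starter 94 ws"
  by (rule exI[of _
   "[1,86,37,83,52,21,26,29,72,24,14,82,57,65,85,79,27,11,12,40,45,80,13,58,73,54,28,17,7,63,
     20,81,42,68,31,90,80,91,35,64,60,53,64,85,8,62,54,92,68,46,53,10,11,74,66,88,77,5,93,73,
     83,41,22,32,49,37,79,26,87,33,9,89,40,6,50,55,59,44,38,36,6,75,61,57,29,66,69,56,23,24,56,36,
     31,67,28,75,9,33,7,16,47,74]"])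
    code_simp

lemma low_95: "\<exists>ws. low_starter 95 ws"
  by (rule exI[of _
   "[57,22,12,0,52,34,92,55,19,64,83,80,88,29,54,87,30,17,34,91,82,36,85,48,72,41,53,27,3,35,
     70,85,42,63,68,5,90,23,63,61,32,70,37,89,14,83,66,72,5,65,35,69,29,19,6,67,47,38,81,37,61,20,
     76,28,27,16,24,1,87,3,67,74,33,53,45,40,65,13,44,58,73,93,11,12,17,33,94,6,81,10,60,1,8,0,
     75,26,45,15,47,23,86,64]"])
    code_simp

lemma low_96: "\<exists>ws. low_starter 96 ws"
  by (rule exI[of _
   "[45,63,88,3,85,12,57,84,4,10,61,81,11,14,76,24,43,33,31,32,87,36,69,60,64,26,72,40,74,66,
     81,39,59,85,95,28,60,2,12,56,3,67,49,54,66,73,30,79,47,45,94,15,17,64,35,49,58,93,14,86,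
     89,25,40,9,52,71,34,13,92,74,73,77,18,52,90,46,70,5,63,38,28,83,53,91,2,62,79,50,1,44,48,0,
     16,27,17,29,18,84,20,33,30,83,61,78]"])
    code_simp

lemma low_97: "\<exists>ws. low_starter 97 ws"
  by (rule exI[of _
   "[15,91,29,73,23,48,75,66,1,39,83,76,35,68,48,61,79,89,55,34,5,87,54,9,96,5,39,12,31,33,85,79,
     17,49,0,31,69,1,12,62,47,46,57,52,8,59,46,64,38,90,10,30,51,4,19,2,73,92,81,58,41,6,50,54,
     86,11,11,37,58,29,74,63,7,43,33,47,14,88,59,83,44,7,78,93,94,80,52,95,60,32,55,21,41,89,
     56,26,17,20,21,2,57,16,78,66]"])
    code_simp

lemma low_98: "\<exists>ws. low_starter 98 ws"
  by (rule exI[of _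
   "[80,8,29,2,1,46,30,22,16,13,62,1,76,29,69,74,33,93,65,66,46,16,91,0,77,4,57,96,94,47,50,9,
     70,59,28,70,13,87,41,78,2,36,92,82,71,32,63,72,53,90,44,25,95,54,72,52,35,3,79,89,17,86,4,81,
     38,73,84,40,20,45,87,20,54,14,25,23,51,58,47,85,14,80,12,38,36,97,21,15,23,37,42,73,31,88,
     30,34,19,31,33,11,41,26,57,3,65,37]"])
    code_simp

lemma low_99: "\<exists>ws. low_starter 99 ws"
  by (rule exI[of _
   "[6,38,1,78,38,34,74,16,50,66,21,63,19,55,93,17,42,90,14,77,58,52,85,59,53,41,11,54,18,85,
     72,13,26,21,36,97,69,79,73,11,86,51,95,8,2,23,66,86,35,32,90,29,34,72,56,83,75,1,96,57,91,39,
     24,37,17,6,54,26,49,25,13,88,20,22,87,48,63,82,92,19,68,98,44,58,32,31,94,67,33,74,22,0,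
     43,88,30,39,87,79,62,25,61,15,36,59,44,51]"])
    code_simp

lemma low_100: "\<exists>ws. low_starter 100 ws"
  by (rule exI[of _
   "[64,53,14,11,32,31,76,92,53,66,89,75,15,82,13,90,86,20,19,57,63,59,42,19,57,18,60,32,49,14,
     81,60,93,79,51,43,73,21,21,16,27,58,22,80,33,89,74,28,1,42,98,81,29,62,41,51,65,67,24,69,
     30,74,95,78,59,94,26,88,70,41,8,76,0,49,31,24,56,73,67,25,79,61,87,22,80,99,84,47,68,96,
     50,97,71,90,3,83,87,71,7,16,70,10,39,45,15,85,56,36]"])
    code_simp

lemma low_101: "\<exists>ws. low_starter 101 ws"
  by (rule exI[of _
   "[65,57,91,15,15,9,70,67,59,52,75,27,92,38,64,65,41,43,80,42,48,28,38,7,5,71,74,41,28,98,9,36,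
     33,88,100,19,82,23,99,93,35,11,77,62,43,22,10,94,8,76,72,49,29,82,62,74,69,96,36,97,18,50,
     50,5,12,59,87,45,86,29,14,39,22,33,95,83,83,92,30,25,49,78,42,58,60,30,25,35,66,47,0,4,78,91,
     90,76,10,68,3,54,24,7,68,24,1,61,61,39]"])
    code_simp

lemma low_102: "\<exists>ws. low_starter 102 ws"
  by (rule exI[of _
   "[73,47,16,12,62,96,93,49,40,6,95,8,85,37,27,34,97,45,74,43,13,92,3,91,65,1,23,81,42,23,91,44,
     101,80,76,99,24,73,49,39,43,38,75,93,12,54,60,7,56,17,29,67,68,71,48,21,92,84,5,87,61,82,
     78,79,37,28,50,98,94,11,69,56,9,26,6,76,35,57,90,74,15,13,25,0,100,65,11,48,21,10,64,32,
     72,86,88,14,60,88,15,58,24,53,40,0,42,7,55,32,51,84]"])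
    code_simp

lemma low_103: "\<exists>ws. low_starter 103 ws"
  by (rule exI[of _
   "[46,25,31,93,87,97,84,69,20,52,23,88,0,14,83,100,52,62,88,95,30,70,21,16,61,55,1,49,51,21,
     22,102,98,44,76,35,10,101,77,76,75,99,45,61,50,59,92,39,14,53,73,38,67,64,5,22,95,37,80,3,
     9,5,34,10,63,65,94,31,29,11,40,91,44,94,62,51,25,77,11,33,26,96,68,32,3,28,19,46,58,86,66,79,
     43,63,48,1,34,71,42,54,41,18,18,60,72,64,12,79,8,78]"])
    code_simp

lemma low_104: "\<exists>ws. low_starter 104 ws"
  by (rule exI[of _
   "[37,6,62,25,101,72,96,7,87,98,77,16,91,23,67,21,92,63,65,38,8,56,51,94,102,69,19,8,85,45,33,0,
     48,51,68,24,66,41,38,37,36,13,70,77,57,73,43,33,27,3,83,85,39,58,0,103,95,40,44,32,75,97,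
     24,81,1,10,76,99,63,49,7,11,41,90,20,35,32,54,18,80,42,62,72,27,100,95,64,26,25,91,89,29,
     26,9,4,46,79,84,87,12,92,86,61,29,86,60,22,35,53,61,65,47]"])
    code_simp

lemma low_105: "\<exists>ws. low_starter 105 ws"
  by (rule exI[of _
   "[81,90,75,95,90,82,25,43,49,17,31,30,54,26,53,99,45,29,95,78,78,63,3,72,77,14,83,35,86,104,
     57,50,35,54,67,22,26,75,30,60,44,68,100,40,8,59,2,56,87,53,16,19,43,3,9,55,22,34,6,98,51,13,
     59,65,66,5,103,1,101,46,73,94,76,51,38,93,50,81,46,4,69,58,94,32,85,102,23,9,13,8,84,61,
     41,31,7,48,48,15,70,72,84,97,86,10,24,96,96,92,12,71,2,29]"])
    code_simp

lemma low_106: "\<exists>ws. low_starter 106 ws"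
  by (rule exI[of _
   "[68,53,3,85,11,44,45,103,61,49,94,30,2,24,53,81,88,95,27,76,104,43,38,102,74,55,36,42,19,48,
     76,3,22,33,20,0,84,97,51,20,40,58,56,86,59,35,35,73,97,80,5,89,48,52,43,90,67,23,98,84,
     90,100,46,92,1,37,23,68,15,6,75,83,91,94,89,47,96,69,13,50,39,62,101,9,8,74,105,16,58,18,
     18,75,87,28,14,99,81,46,27,6,82,72,7,50,91,93,12,7,29,77,25,26,10,82]"])
    code_simp

lemma low_107: "\<exists>ws. low_starter 107 ws"
  by (rule exI[of _
   "[76,44,12,88,84,62,47,49,103,66,20,19,98,57,92,105,30,96,69,80,48,74,91,36,2,22,99,3,46,38,
     83,54,10,13,68,95,67,46,7,100,37,42,28,51,104,8,44,82,52,61,82,34,0,69,75,60,5,40,93,9,72,35,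
     15,72,35,23,49,0,33,106,62,102,55,97,39,52,31,12,57,11,101,94,95,45,1,7,34,70,16,86,78,68,
     25,64,81,99,88,55,74,30,28,56,25,65,4,97,5,19,77,94,29,54,65,18]"])
    code_simp

lemma low_108: "\<exists>ws. low_starter 108 ws"
  by (rule exI[of _
   "[66,74,52,98,7,75,34,54,92,26,22,89,46,103,105,68,45,84,4,41,82,11,56,52,94,72,2,0,61,31,
     12,55,93,80,42,61,14,102,87,73,23,85,28,63,79,106,38,15,70,23,29,93,62,59,33,12,54,47,27,101,
     74,99,10,27,90,34,51,40,36,48,57,7,97,13,58,82,9,104,48,66,5,10,25,53,107,51,30,79,37,22,
     55,49,89,62,100,33,81,29,88,28,69,24,18,49,91,65,77,19,37,47,19,20,90,99,58,17]"])
    code_simp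

lemma low_109: "\<exists>ws. low_starter 109 ws"
  by (rule exI[of _
   "[39,103,0,32,59,66,66,22,8,69,15,108,25,20,5,84,19,94,96,83,32,46,97,64,57,107,104,48,86,35,
     69,70,3,55,65,28,4,75,31,5,27,76,105,15,81,59,23,77,99,54,83,43,106,13,21,39,94,4,6,42,48,19,
     62,102,82,73,79,33,24,96,26,23,71,82,33,27,70,80,1,36,78,14,50,7,44,52,60,81,47,67,16,12,
     72,89,7,26,100,40,46,93,51,79,68,92,29,14,24,49,41,2,90,74,60,58,50,84]"])
    code_simp

lemma low_110: "\<exists>ws. low_starter 110 ws"
  by (rule exI[of _
   "[21,59,54,34,93,108,40,65,29,99,67,71,34,109,90,83,12,73,86,101,83,91,42,8,30,14,19,88,84,85,
     82,51,97,60,81,55,14,74,62,53,53,100,31,7,24,38,104,21,48,105,73,95,66,49,39,96,2,46,45,33,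
     50,31,16,106,49,77,92,81,102,43,103,92,101,48,107,44,26,98,25,68,23,79,18,28,78,12,100,37,
     63,50,52,29,72,54,89,22,9,4,41,70,96,0,67,27,40,13,13,10,2,4,10,60,57,36,94,46,26,77]"])
    code_simp

lemma low_111: "\<exists>ws. low_starter 111 ws"
  by (rule exI[of _
   "[98,13,11,43,71,2,9,59,13,77,108,92,18,41,45,54,93,73,50,3,96,86,100,35,63,110,94,82,106,15,
     26,105,31,65,104,28,77,26,69,7,66,42,61,47,80,102,54,48,95,90,90,46,43,12,51,55,19,62,2,109,
     35,61,56,27,102,34,40,56,52,19,37,83,8,95,59,100,92,67,78,79,3,107,67,78,87,60,76,0,15,89,
     82,103,14,63,42,101,32,29,101,99,38,20,29,22,93,85,96,81,33,70,52,4,31,83,18,5,72,6]"])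
    code_simp

section \<open>Existence\<close>

definition exceptional :: "(nat \<times> nat) set" where
  "exceptional =
      {(2,2),(3,3),(4,2),(6,6)} \<union> {(5,3),(6,2),(12,2),(12,6),(12,8),(13,3),(13,7),(14,2),(14,6),(15,3),
                     (15,7),(15,9),(16,2),(16,10),(17,3),(17,7),(17,11),(18,2),(18,10),(19,3),
                     (19,11),(20,2),(20,14),(21,3),(21,11),(22,2),(22,14),(23,15),(24,2),
                     (24,14),(25,15)}"

text \<open>The numbers of spouse pairs realised by the starters for n \<le> 31.\<close>

definition spouse_table :: "(nat \<times> nat list) list" where
  "spouse_table =
   [(0, [0]),
    (1, [1]),
    (2, [0]),
    (3, [1]),
    (4, [0, 4]),
    (5, [1, 5]),
    (6, [0, 4]),
    (7, [1, 3, 5, 7]),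
    (8, [0, 2, 4, 6, 8]),
    (9, [1, 3, 5, 7, 9]),
    (10, [0, 2, 4, 6, 8, 10]),
    (11, [1, 3, 5, 7, 9, 11]),
    (12, [0, 4, 10, 12]),
    (13, [1, 3, 5, 7, 9, 11, 13]),
    (14, [0, 4, 8, 10, 12, 14]),
    (15, [1, 5, 11, 13, 15]),
    (16, [0, 4, 6, 8, 10, 12, 14, 16]),
    (17, [1, 5, 9, 13, 15, 17]),
    (18, [0, 4, 6, 8, 12, 14, 16, 18]),
    (19, [1, 5, 7, 9, 13, 15, 17, 19]),
    (20, [0, 4, 6, 8, 10, 12, 16, 18, 20]),
    (21, [1, 3, 5, 7, 9, 13, 15, 17, 19, 21]),
    (22, [0, 4, 6, 8, 10, 12, 16, 18, 20, 22]),
    (23, [1, 3, 5, 7, 9, 11, 13, 15, 17, 19, 21, 23]),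
    (24, [0, 2, 4, 6, 8, 10, 12, 14, 16, 18, 20, 22, 24]),
    (25, [1, 3, 5, 7, 9, 11, 13, 17, 19, 21, 23, 25]),
    (26, [0, 2, 4, 6, 8, 10, 12, 14, 16, 18, 20, 22, 24, 26]),
    (27, [1, 3, 5, 7, 9, 11, 13, 15, 17, 19, 21, 23, 25, 27]),
    (28, [0, 2, 4, 6, 8, 10, 12, 14, 16, 18, 20, 22, 24, 26, 28]),
    (29, [1, 3, 5, 7, 9, 11, 13, 15, 17, 19, 21, 23, 25, 27, 29]),
    (30, [0, 2, 4, 6, 8, 10, 12, 14, 16, 18, 20, 22, 24, 26, 28, 30]),
    (31, [1, 3, 5, 7, 9, 11, 13, 15, 17, 19, 21, 23, 25, 27, 29, 31])]"

text \<open>The implication goes one way only: the table also realises pairs such as (13, 3), (16,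
  10) and (24, 2), which belong to \<open>exceptional\<close>.\<close>

lemma spouse_table_complete:
  "\<forall>n\<in>set [0..<32]. \<forall>k\<in>set [0..<Suc n]. (even k \<longleftrightarrow> even n) \<longrightarrow> (n, k) \<notin> exceptional \<longrightarrow>
     (\<exists>(m, ks)\<in>set spouse_table. m = n \<and> k \<in> set ks)"
  by code_simp

lemma tournament_spouse_table: "\<forall>(n, ks)\<in>set spouse_table. \<forall>k\<in>set ks. tournament n k"
  using tournament_0 tournament_1 tournament_2 tournament_3 tournament_4 tournament_5 tournament_6
    tournament_7 tournament_8 tournament_9 tournament_10 tournament_11 tournament_12
    tournament_13 tournament_14 tournament_15 tournament_16 tournament_17 tournament_18
    tournament_19 tournament_20 tournament_21 tournament_22 tournament_23 tournament_24
    tournament_25 tournament_26 tournament_27 tournament_28 tournament_29 tournament_30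
    tournament_31
  by (simp add: spouse_table_def)

lemma tournament_small:
  assumes "n \<le> 31" and "k \<le> n" and "even k \<longleftrightarrow> even n" and "(n, k) \<notin> exceptional"
  shows "tournament n k"
proof -
  have "n \<in> set [0..<32]" "k \<in> set [0..<Suc n]" using assms(1,2) by auto
  thus ?thesis using assms(3,4) spouse_table_complete tournament_spouse_table by fast
qed


section \<open>Few spouse pairs in the orders from 41 to 111\<close>

lemma tournament_low_starter:
  assumes "low_starter n ws"
  shows "\<forall>k\<in>(if even n then {0, 2, 4, 6, 8} else {1, 3, 5, 7}). tournament n k"
proof (cases "even n")
  case True
  hence st: "starter (int n - 8) 1 0 8 False ws []" using assms by (simp add: low_starter_def)
  have eq: "nat ((int n - 8) * 1 + 8) = n" by simp
  show ?thesis
    using tournament_starters[OF st tournament_8 of_nat_numeral[symmetric]] True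
      unfolding eq by simp
next
  case False
  hence st: "starter (int n - 7) 1 0 7 False ws []" using assms by (simp add: low_starter_def)
  have eq: "nat ((int n - 7) * 1 + 7) = n" by simp
  show ?thesis
    using tournament_starters[OF st tournament_7 of_nat_numeral[symmetric]] False
      unfolding eq by simp
qed

lemma tournament_low_range:
  "\<forall>n\<in>set [41..<112]. \<forall>k\<in>(if even n then {0, 2, 4, 6, 8} else {1, 3, 5, 7}). tournament n k"
proof -
  have "list_all (\<lambda>n. \<exists>ws. low_starter n ws) [41..<112]"
    using low_41 low_42 low_43 low_44 low_45 low_46 low_47 low_48 low_49 low_50 low_51 low_52 low_53
    low_54 low_55 low_56 low_57 low_58 low_59 low_60 low_61 low_62 low_63 low_64 low_65 low_66
    low_67 low_68 low_69 low_70 low_71 low_72 low_73 low_74 low_75 low_76 low_77 low_78 low_79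
    low_80 low_81 low_82 low_83 low_84 low_85 low_86 low_87 low_88 low_89 low_90 low_91 low_92
    low_93 low_94 low_95 low_96 low_97 low_98 low_99 low_100 low_101 low_102 low_103 low_104
    low_105 low_106 low_107 low_108 low_109 low_110 low_111
    by simp
  thus ?thesis using tournament_low_starter unfolding list_all_iff by blast
qed

lemma tournament_low:
  assumes "n \<in> {41..111}" and "k \<le> 8" and "even k \<longleftrightarrow> even n"
  shows "tournament n k"
proof -
  have "k = 0 \<or> k = 1 \<or> k = 2 \<or> k = 3 \<or> k = 4 \<or> k = 5 \<or> k = 6 \<or> k = 7 \<or> k = 8"
    using assms(2) by linarith
  hence "k \<in> (if even n then {0, 2, 4, 6, 8} else {1, 3, 5, 7})" using assms(3) by (elim disjE) auto
  moreover have "n \<in> set [41..<112]" using assms(1) by (simp only: set_upt) simp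
  ultimately show ?thesis using tournament_low_range by blast
qed

text \<open>\<open>K\<close> is what the four full groups of a transversal design contribute
  together; the truncated group is chosen separately.\<close>

definition sum_of_four :: "nat \<Rightarrow> nat \<Rightarrow> bool" where
  "sum_of_four m K \<longleftrightarrow> (\<exists>a b c d. tournament m a \<and> tournament m b \<and> tournament m c \<and> tournament m d \<and>
     a + b + c + d = K)"

lemma sum_of_fourI:
  "tournament m a \<Longrightarrow> tournament m b \<Longrightarrow> tournament m c \<Longrightarrow> tournament m d \<Longrightarrow>
    K = a + b + c + d \<Longrightarrow> sum_of_four m K"
  by (auto simp: sum_of_four_def)

text \<open>Each group receives the forced \<open>m mod 2\<close> spouse pairs, and the rest of
  \<open>K\<close> is spread in steps of 2 as evenly as possible; the four values then differ by at
  most 2.\<close>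

lemma sum_of_four_full:
  assumes full: "\<And>k. k \<le> m \<Longrightarrow> even k \<longleftrightarrow> even m \<Longrightarrow> tournament m k"
    and K: "even K" "4 * (m mod 2) \<le> K" "K \<le> 4 * m"
  shows "sum_of_four m K"
proof -
  define e where "e = m mod 2"
  define h where "h = m div 2"
  define L where "L = (K - 4 * e) div 2"
  have m: "m = 2 * h + e" by (simp add: h_def e_def)
  have L: "K = 2 * L + 4 * e" using K by (simp add: L_def e_def)
  have L4: "L \<le> 4 * h" using K m L by simp
  have t: "tournament m (2 * l + e)" if "l \<le> h" for l
    using that by (intro full) (auto simp: m)
  define q r where "q = L div 4" and "r = L mod 4"
  have Lq: "L = 4 * q + r" by (simp add: q_def r_def)
  have "r < 4" by (simp add: r_def)
  then consider "r = 0" | "r = 1" | "r = 2" | "r = 3" by linarith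
  thus ?thesis
  proof cases
    case 1
    hence "q \<le> h" using L4 Lq by simp
    thus ?thesis using L Lq 1 by (intro sum_of_fourI[OF t[of q] t[of q] t[of q] t[of q]]) simp_all
  next
    case 2
    hence "q + 1 \<le> h" using L4 Lq by simp
    thus ?thesis
      using L Lq 2 by (intro sum_of_fourI[OF t[of "q + 1"] t[of q] t[of q] t[of q]]) simp_all
  next
    case 3
    hence "q + 1 \<le> h" using L4 Lq by simp
    thus ?thesis
      using L Lq 3 by (intro sum_of_fourI[OF t[of "q + 1"] t[of "q + 1"] t[of q] t[of q]]) simp_all
  next
    case 4
    hence "q + 1 \<le> h" using L4 Lq by simp
    thus ?thesis using L Lq 4
      by (intro sum_of_fourI[OF t[of "q + 1"] t[of "q + 1"] t[of "q + 1"] t[of q]]) simp_all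
  qed
qed

text \<open>For sizes 16 and 20 single values are missing, which spoils an even distribution. Two
  groups together still reach every even total except 2, so \<open>K\<close> is split into two
  totals different from 2.\<close>

lemma sum_of_four_pairs:
  assumes pairs: "\<And>s. even s \<Longrightarrow> s \<le> 2 * m \<Longrightarrow> s \<noteq> 2 \<Longrightarrow> \<exists>a b. tournament m a \<and> tournament m b \<and>
      a + b = s"
    and m: "even m" "8 \<le> m" and K: "even K" "4 \<le> K" "K \<le> 4 * m"
  shows "sum_of_four m K"
proof -
  have "\<exists>s t. even s \<and> even t \<and> s \<le> 2 * m \<and> t \<le> 2 * m \<and> s \<noteq> 2 \<and> t \<noteq> 2 \<and> s + t = K"
  proof (cases "K \<le> 2 * m")
    case True
    thus ?thesis using K by (intro exI[of _ K] exI[of _ 0]) auto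
  next
    case False
    show ?thesis
    \<comment> \<open>Taking \<open>2 * m\<close> out would leave the forbidden 2 here, hence
      \<open>2 * m - 4\<close> and 6; \<open>8 \<le> m\<close> keeps both in range and different
      from 2.\<close>
    proof (cases "K = 2 * m + 2")
      case True
      thus ?thesis using m by (intro exI[of _ "2 * m - 4"] exI[of _ 6]) auto
    next
      case False
      thus ?thesis using K m \<open>\<not> K \<le> 2 * m\<close> by (intro exI[of _ "2 * m"] exI[of _ "K - 2 * m"]) auto
    qed
  qed
  then obtain s t where "even s" "even t" "s \<le> 2 * m" "t \<le> 2 * m" "s \<noteq> 2" "t \<noteq> 2"
    and st: "s + t = K"
    by blast
  then obtain a b c d where t: "tournament m a" "tournament m b" "tournament m c" "tournament m d"
    and "a + b = s" "c + d = t"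
    using pairs by metis
  thus ?thesis using st by (intro sum_of_fourI[OF t]) simp
qed

lemma sum_of_four_16:
  assumes "even K" and "4 \<le> K" and "K \<le> 64"
  shows "sum_of_four 16 K"
proof (rule sum_of_four_pairs)
  have t: "tournament 16 s" if "even s" "s \<le> 16" "s \<noteq> 2" for s
  \<comment> \<open>(16, 10) belongs to \<open>exceptional\<close>, but a starter realises
    it.\<close>
  proof (cases "s = 10")
    case True thus ?thesis using tournament_16 by simp
  next
    case False thus ?thesis using that by (intro tournament_small) (auto simp: exceptional_def)
  qed
  fix s :: nat assume s: "even s" "s \<le> 2 * 16" "s \<noteq> 2"
  show "\<exists>a b. tournament 16 a \<and> tournament 16 b \<and> a + b = s"
  \<comment> \<open>18 cannot be taken as 16 + 2 and is split as 4 + 14.\<close>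
  proof (cases "s \<le> 16 \<or> s = 18")
    case True
    thus ?thesis using s t[of s] t[of 0] t[of 4] t[of 14] by auto
  next
    case False
    thus ?thesis using s t[of "s - 16"] t[of 16] by (intro exI[of _ "s - 16"] exI[of _ 16]) auto
  qed
qed (use assms in auto)

lemma sum_of_four_20:
  assumes "even K" and "4 \<le> K" and "K \<le> 80"
  shows "sum_of_four 20 K"
proof (rule sum_of_four_pairs)
  have t: "tournament 20 s" if "even s" "s \<le> 20" "s \<noteq> 2" "s \<noteq> 14" for s
    using that by (intro tournament_small) (auto simp: exceptional_def)
  fix s :: nat assume s: "even s" "s \<le> 2 * 20" "s \<noteq> 2"
  \<comment> \<open>The splittings 14 + 0, 20 + 2 and 20 + 14 would use the missing values 2 and 14,
    so 14, 22 and 34 are split by hand.\<close>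
  have "\<exists>a b. tournament 20 a \<and> tournament 20 b \<and> a + b = 14" using t[of 4] t[of 10] by force
  moreover have "\<exists>a b. tournament 20 a \<and> tournament 20 b \<and> a + b = 22"
    using t[of 6] t[of 16] by force
  moreover have "\<exists>a b. tournament 20 a \<and> tournament 20 b \<and> a + b = 34"
    using t[of 16] t[of 18] by force
  moreover have "\<exists>a b. tournament 20 a \<and> tournament 20 b \<and> a + b = s" if "s \<notin> {14, 22, 34}"
  proof (cases "s \<le> 20")
    case True
    thus ?thesis using s that t[of s] t[of 0] by (intro exI[of _ s] exI[of _ 0]) auto
  next
    case False
    thus ?thesis
      using s that t[of "s - 20"] t[of 20] by (intro exI[of _ "s - 20"] exI[of _ 20]) auto
  qed
  ultimately show "\<exists>a b. tournament 20 a \<and> tournament 20 b \<and> a + b = s" by blast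
qed (use assms in auto)

lemma tournament_4_4: "tournament 4 4" and tournament_5_5: "tournament 5 5"
  using tournament_4 tournament_5 by simp_all

lemma tournament_sum_of_four:
  assumes "td5 m" "x \<le> m" "sum_of_four m K" "tournament x j"
  shows "tournament (4 * m + x) (K + j)"
  using assms tournament_td5[OF assms(1,2) _ _ _ _ assms(4) tournament_4_4 tournament_5_5]
  unfolding sum_of_four_def by blast

text \<open>The truncated group takes \<open>j\<close> spouse pairs, and the full groups take
  \<open>k - j\<close>, which has to lie between \<open>l\<close> and \<open>4 * m\<close>. For
  small \<open>k\<close> the least \<open>j\<close> works, for large \<open>k\<close> the choice
  \<open>j = x\<close>, unless there is no all-married tournament with \<open>x\<close> men.\<close>

lemma tournament_step:
  assumes td: "td5 m" and x: "x \<le> m" and n: "n = 4 * m + x"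
    and four: "\<And>K. even K \<Longrightarrow> l \<le> K \<Longrightarrow> K \<le> 4 * m \<Longrightarrow> sum_of_four m K"
    and l: "l \<le> 3 * m" and k: "k \<le> n" "even k \<longleftrightarrow> even n" "l + x mod 2 \<le> k"
    and last: "\<And>j. j \<le> x \<Longrightarrow> even j \<longleftrightarrow> even x \<Longrightarrow> (x, j) \<notin> exceptional \<Longrightarrow> tournament x j"
    and top: "k < n \<or> x \<notin> {2, 3, 6}"
  shows "tournament n k"
proof -
  have step: "tournament n k"
    if "j \<le> k" "k - j \<le> 4 * m" "l \<le> k - j" "even j \<longleftrightarrow> even x" "tournament x j" for j
  proof -
    have "even (k - j)" using that k(2) n by simp
    hence "tournament (4 * m + x) (k - j + j)"
      using that by (intro tournament_sum_of_four[OF td x] four)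
    thus ?thesis using that n by simp
  qed
  show ?thesis
  proof (cases "k \<le> 4 * m + x mod 2")
    case True
    have "x mod 2 \<le> x" by simp
    moreover have "(x, x mod 2) \<notin> exceptional" by (auto simp: exceptional_def)
    ultimately show ?thesis using True k by (intro step[of "x mod 2"] last) auto
  next
    case False
    show ?thesis
    proof (cases "x \<in> {2, 3, 6}")
      case True
      hence kn: "k < n" using top by blast
      \<comment> \<open>For \<open>x\<close> equal to 2 or 3, parity leaves no value of
        \<open>k\<close> strictly between \<open>4 * m + x mod 2\<close> and
        \<open>n\<close>.\<close>
      have "x = 6"
      proof (rule ccontr)
        assume "x \<noteq> 6"
        hence "x = 2 \<or> x = 3" using True by auto
        thus False
        proof
          assume "x = 2"
          hence "k = 4 * m + 1" using kn n False by simp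
          thus False using k(2) n \<open>x = 2\<close> by simp
        next
          assume "x = 3"
          hence "k = 4 * m + 2" using kn n False by simp
          thus False using k(2) n \<open>x = 3\<close> by simp
        qed
      qed
      moreover from this have "k \<noteq> 4 * m + 5" using k(2) n by auto
      \<comment> \<open>Now \<open>k\<close> is \<open>4 * m + 2\<close> or
        \<open>4 * m + 4\<close>, and 4 spouse pairs among 6 men are possible.\<close>
      ultimately show ?thesis using kn n False l x
        by (intro step[of 4] last) (auto simp: exceptional_def)
    next
      case x6: False
      hence "(x, x) \<notin> exceptional" by (auto simp: exceptional_def)
      hence "tournament x x" by (intro last) auto
      \<comment> \<open>The full groups can take the rest, since \<open>k > 4 * m\<close> and
        \<open>x \<le> m\<close> give \<open>k - x > 3 * m \<ge> l\<close>.\<close>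
      thus ?thesis using False x n k(1) l by (intro step[of x]) auto
    qed
  qed
qed

lemma sols_step:
  assumes "td5 m" "x \<le> m" "n = 4 * m + x" "tournament m m" "tournament x x"
  shows "tournament n n"
proof -
  have eq: "m + m + m + m + x = 4 * m + x" by simp
  show ?thesis
    using tournament_td5[OF assms(1,2,4,4,4,4,5) tournament_4_4 tournament_5_5]
      unfolding eq assms(3) .
qed

lemma td5_coprime_6:
  assumes "odd u" and "u mod 3 \<noteq> 0"
  shows "td5 u"
proof (rule td5_coprime)
  have "gcd u 3 = gcd (u mod 3) 3" by (metis gcd.commute gcd_red_nat)
  moreover have "u mod 3 = 1 \<or> u mod 3 = 2" using assms(2) by linarith
  ultimately have "coprime u 3" by (auto simp: coprime_iff_gcd_eq_1 gcd_non_0_nat)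
  hence "coprime u (2 * 3)" using assms(1) by (simp only: coprime_mult_right_iff) simp
  thus "coprime u 6" by simp
qed

lemma sum_of_four_8:
  assumes "even K" and "0 \<le> K" and "K \<le> 4 * 8"
  shows "sum_of_four 8 K"
proof (rule sum_of_four_full)
  show "tournament 8 j" if "j \<le> 8" "even j \<longleftrightarrow> even (8 :: nat)" for j
    using that by (intro tournament_small) (auto simp: exceptional_def)
qed (use assms in auto)

lemma sum_of_four_9:
  assumes "even K" and "4 \<le> K" and "K \<le> 4 * 9"
  shows "sum_of_four 9 K"
proof (rule sum_of_four_full)
  show "tournament 9 j" if "j \<le> 9" "even j \<longleftrightarrow> even (9 :: nat)" for j
    using that by (intro tournament_small) (auto simp: exceptional_def)
qed (use assms in auto)

lemma sum_of_four_11: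
  assumes "even K" and "4 \<le> K" and "K \<le> 4 * 11"
  shows "sum_of_four 11 K"
proof (rule sum_of_four_full)
  show "tournament 11 j" if "j \<le> 11" "even j \<longleftrightarrow> even (11 :: nat)" for j
    using that by (intro tournament_small) (auto simp: exceptional_def)
qed (use assms in auto)

lemma sum_of_four_13:
  assumes "even K" and "4 \<le> K" and "K \<le> 4 * 13"
  shows "sum_of_four 13 K"
proof (rule sum_of_four_full)
  show "tournament 13 j" if "j \<le> 13" "even j \<longleftrightarrow> even (13 :: nat)" for j
  \<comment> \<open>(13, 3) and (13, 7) belong to \<open>exceptional\<close>, but starters realise
    them, so an even distribution remains possible.\<close>
  proof (cases "j = 3 \<or> j = 7")
    case True thus ?thesis using tournament_13 by auto
  next
    case False thus ?thesis using that by (intro tournament_small) (auto simp: exceptional_def)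
  qed
qed (use assms in auto)

lemma sum_of_four_23:
  assumes "even K" and "4 \<le> K" and "K \<le> 4 * 23"
  shows "sum_of_four 23 K"
proof (rule sum_of_four_full)
  show "tournament 23 j" if "j \<le> 23" "even j \<longleftrightarrow> even (23 :: nat)" for j
  \<comment> \<open>(23, 15) belongs to \<open>exceptional\<close>, but a starter realises
    it.\<close>
  proof (cases "j = 15")
    case True thus ?thesis using tournament_23 by auto
  next
    case False thus ?thesis using that by (intro tournament_small) (auto simp: exceptional_def)
  qed
qed (use assms in auto)

text \<open>The truncated group has a forced spouse pair only if its size is odd, and then
  \<open>n\<close> and \<open>k\<close> are odd too.\<close>

lemma parity_le:
  fixes n k m :: nat
  assumes "even k \<longleftrightarrow> even n"
  shows "(n - 4 * m) mod 2 \<le> k"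
proof (cases "even n")
  case True
  hence "even (n - 4 * m)" by simp
  thus ?thesis by (simp add: even_iff_mod_2_eq_zero)
next
  case False
  hence "1 \<le> k" using assms by (cases k) auto
  moreover have "(n - 4 * m) mod 2 < 2" by simp
  ultimately show ?thesis by linarith
qed

text \<open>Writing \<open>n = 4 * m + x\<close> with \<open>x \<le> m\<close> reduces
  \<open>n\<close> to the smaller orders \<open>m\<close> and \<open>x\<close>, so one group size
  covers all \<open>n\<close> from \<open>4 * m\<close> to \<open>5 * m\<close>. The chosen sizes
  overlap enough to cover everything; only \<open>k = n\<close> with remainder 2, 3 or 6 asks for a
  second size or a starter.\<close>

lemma tournament_exists:
  assumes "k \<le> n" and "even k \<longleftrightarrow> even n" and "(n, k) \<notin> exceptional"
  shows "tournament n k"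
  using assms
proof (induction n arbitrary: k rule: less_induct)
  case (less n)
  note k = less.prems(1,2)
  have last: "tournament x j" if "x < n" "j \<le> x" "even j \<longleftrightarrow> even x" "(x, j) \<notin> exceptional" for x j
    using less.IH that by blast
  have sols: "tournament x x" if "x < n" "6 < x" for x
    using that by (intro last) (auto simp: exceptional_def)
  \<comment> \<open>Another group size with \<open>x > 6\<close> lets all five groups be fully
    married when the usual size leaves an unsuitable remainder.\<close>
  have sols_case: "tournament n n" if "td5 m" "7 \<le> m" "x \<le> m" "6 < x" "n = 4 * m + x" for m x
    using that(1,3,5) by (rule sols_step) (use that in \<open>auto intro!: sols\<close>)
  have step: "tournament n k"
    if "td5 m" "4 * m \<le> n" "n \<le> 5 * m" "7 \<le> m" "k < n \<or> n - 4 * m \<notin> {2, 3, 6}"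
      "l \<le> 4" "l + (n - 4 * m) mod 2 \<le> k"
      "\<And>K. even K \<Longrightarrow> l \<le> K \<Longrightarrow> K \<le> 4 * m \<Longrightarrow> sum_of_four m K" for m l
  proof (rule tournament_step[of m "n - 4 * m" n l])
    show "tournament (n - 4 * m) j"
      if "j \<le> n - 4 * m" "even j \<longleftrightarrow> even (n - 4 * m)" "(n - 4 * m, j) \<notin> exceptional" for j
      using that \<open>7 \<le> m\<close> \<open>4 * m \<le> n\<close> by (intro last) simp_all
    show "td5 m" "k < n \<or> n - 4 * m \<notin> {2, 3, 6}" "l + (n - 4 * m) mod 2 \<le> k" by fact+
    show "n - 4 * m \<le> m" "n = 4 * m + (n - 4 * m)" "l \<le> 3 * m" using that(2-4,6) by simp_all
    show "k \<le> n" "even k \<longleftrightarrow> even n" by fact+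
    show "sum_of_four m K" if "even K" "l \<le> K" "K \<le> 4 * m" for K
      using that by fact
  qed
  \<comment> \<open>Orders from 28 on are above all exceptional ones, and an even group may have no
    spouse pair, so every even total \<open>K\<close> up to \<open>4 * m\<close> occurs.\<close>
  have even_step: "tournament n k"
    if "td5 m" "4 * m \<le> n" "n \<le> 5 * m" "28 \<le> m" "even m" "k < n \<or> n - 4 * m \<notin> {2, 3, 6}" for m
  proof (rule step[of m 0])
    show "sum_of_four m K" if "even K" "K \<le> 4 * m" for K
    proof (rule sum_of_four_full)
      show "tournament m j" if "j \<le> m" "even j \<longleftrightarrow> even m" for j
      proof (rule last)
        show "m < n" using \<open>28 \<le> m\<close> \<open>4 * m \<le> n\<close> by linarith
        show "(m, j) \<notin> exceptional" using \<open>28 \<le> m\<close> by (auto simp: exceptional_def)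
      qed (use that in auto)
    qed (use that \<open>even m\<close> in auto)
    show "0 + (n - 4 * m) mod 2 \<le> k" using parity_le[OF k(2)] by simp
  qed (use that in simp_all)
  \<comment> \<open>Values up to 8 come from the starters; beyond them \<open>k\<close> exceeds the
    4 spouse pairs required of the full groups and the one that may be forced in the truncated
    group.\<close>
  have low_step: "tournament n k"
    if "td5 m" "4 * m \<le> n" "n \<le> 5 * m" "7 \<le> m" "41 \<le> n" "n \<le> 111" "k < n \<or> n - 4 * m \<notin> {2, 3, 6}"
      "\<And>K. even K \<Longrightarrow> 4 \<le> K \<Longrightarrow> K \<le> 4 * m \<Longrightarrow> sum_of_four m K" for m
  proof (cases "k \<le> 8")
    case True
    show ?thesis by (rule tournament_low[OF _ True k(2)]) (use that in simp)
  next
    case False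
    have "(n - 4 * m) mod 2 < 2" by simp
    hence "4 + (n - 4 * m) mod 2 \<le> k" using False by linarith
    thus ?thesis using that by (intro step[of m 4]) simp_all
  qed
  note coprime = td5_coprime_6
  have quad: "td5 (4 * u)" if "odd u" "u mod 3 \<noteq> 0" for u
    using that by (intro td5_mult td5_4 td5_coprime_6)
  have top: "k < n \<or> n - 4 * m \<notin> {2, 3, 6}"
    if "\<not> (k = n \<and> (n = 4 * m + 2 \<or> n = 4 * m + 3 \<or> n = 4 * m + 6))" "4 * m \<le> n" for m
    using that k(1) by auto
  \<comment> \<open>From 40 on the intervals end at \<open>5 * m\<close> for the group size
    \<open>m\<close> used, except 63 and 111, where the sizes 16 and 28 take over, and 310, where
    the uniform argument begins.\<close>
  consider "n \<le> 31" | "31 < n" "n \<le> 40" | "40 < n" "n \<le> 45" | "45 < n" "n \<le> 55"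
    | "55 < n" "n \<le> 63" | "63 < n" "n \<le> 80" | "80 < n" "n \<le> 100" | "100 < n" "n \<le> 111"
    | "111 < n" "n \<le> 140" | "140 < n" "n \<le> 160" | "160 < n" "n \<le> 200"
    | "200 < n" "n \<le> 220" | "220 < n" "n \<le> 260" | "260 < n" "n \<le> 280"
    | "280 < n" "n \<le> 310" | "310 < n"
    by (cases "n \<le> 31", simp, cases "n \<le> 40", simp, cases "n \<le> 45", simp, cases "n
      \<le> 55", simp, cases "n \<le> 63", simp, cases "n \<le> 80", simp, cases "n \<le> 100",
      simp, cases "n \<le> 111", simp, cases "n \<le> 140", simp, cases "n \<le> 160", simp,
      cases "n \<le> 200", simp, cases "n \<le> 220", simp, cases "n \<le> 260", simp, cases "n
      \<le> 280", simp, cases "n \<le> 310", simp, simp)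
  thus ?case
  proof cases
    case 1
    thus ?thesis using less.prems by (intro tournament_small)
  next
    case 2
    have "td5 7" by (rule coprime) simp_all
    \<comment> \<open>35 leaves the remainder 3 over 4 * 8, but it is also 4 * 7 + 7.\<close>
    hence "tournament n n" if "n = 35" by (rule sols_case[of 7 7]) (use that in simp_all)
    moreover have "tournament n k" if "\<not> (k = n \<and> (n = 34 \<or> n = 35 \<or> n = 38))"
      by (rule step[OF td5_8, of 0])
        (use 2 that top[of 8] parity_le[OF k(2), of 8] in \<open>simp_all add: sum_of_four_8\<close>)
    ultimately show ?thesis using sols_34 sols_38 by metis
  next
    case 3
    have "tournament n k" if "\<not> (k = n \<and> n = 42)"
      by (rule low_step[OF td5_9]) (use 3 that top[of 9] in \<open>simp_all add: sum_of_four_9\<close>)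
    thus ?thesis using sols_42 by metis
  next
    case 4
    have "td5 11" by (rule coprime) simp_all
    hence "tournament n k" if "\<not> (k = n \<and> (n = 46 \<or> n = 47 \<or> n = 50))"
      by (rule low_step) (use 4 that top[of 11] in \<open>simp_all add: sum_of_four_11\<close>)
    thus ?thesis using sols_46 sols_47 sols_50 by metis
  next
    case 5
    have "td5 13" by (rule coprime) simp_all
    hence "tournament n k" if "\<not> (k = n \<and> n = 58)"
      by (rule low_step) (use 5 that top[of 13] in \<open>simp_all add: sum_of_four_13\<close>)
    thus ?thesis using sols_58 by metis
  next
    case 6
    have "td5 16" using td5_mult[OF td5_4 td5_4] by simp
    hence "tournament n k" if "\<not> (k = n \<and> (n = 66 \<or> n = 67 \<or> n = 70))"
      by (rule low_step) (use 6 that top[of 16] in \<open>simp_all add: sum_of_four_16\<close>)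
    thus ?thesis using sols_66 sols_67 sols_70 by metis
  next
    case 7
    have "td5 17" "td5 19" by (rule coprime; simp)+
    \<comment> \<open>These leave 2, 3 and 6 over 4 * 20, but are also 4 * 17 + 14, 4 * 17 + 15 and
      4 * 19 + 10. The cases of group sizes 28 and 40 have the same repair.\<close>
    hence "tournament n n" if "n = 82 \<or> n = 83 \<or> n = 86"
      using that sols_case[of 17 14] sols_case[of 17 15] sols_case[of 19 10] by auto
    moreover have "td5 20" using quad[of 5] by simp
    hence "tournament n k" if "\<not> (k = n \<and> (n = 82 \<or> n = 83 \<or> n = 86))"
      by (rule low_step) (use 7 that top[of 20] in \<open>simp_all add: sum_of_four_20\<close>)
    ultimately show ?thesis by metis
  next
    case 8
    have "td5 23" by (rule coprime) simp_all
    thus ?thesis by (rule low_step) (use 8 top[of 23] in \<open>simp_all add: sum_of_four_23\<close>)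
  next
    case 9
    have "td5 23" "td5 25" by (rule coprime; simp)+
    hence "tournament n n" if "n = 114 \<or> n = 115 \<or> n = 118"
      using that sols_case[of 23 22] sols_case[of 23 23] sols_case[of 25 18] by auto
    moreover have "td5 28" using quad[of 7] by simp
    hence "tournament n k" if "\<not> (k = n \<and> (n = 114 \<or> n = 115 \<or> n = 118))"
      by (rule even_step) (use 9 that top[of 28] in simp_all)
    ultimately show ?thesis by metis
  next
    case 10
    have "td5 32" using td5_mult[OF td5_4 td5_8] by simp
    thus ?thesis by (rule even_step) (use 10 top[of 32] in simp_all)
  next
    case 11
    have "td5 35" by (rule coprime) simp_all
    hence "tournament n n" if "n = 162 \<or> n = 163 \<or> n = 166"
      using that sols_case[of 35 22] sols_case[of 35 23] sols_case[of 35 26] by auto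
    moreover have "td5 40" using td5_mult[OF td5_8 coprime[of 5]] by simp
    hence "tournament n k" if "\<not> (k = n \<and> (n = 162 \<or> n = 163 \<or> n = 166))"
      by (rule even_step) (use 11 that top[of 40] in simp_all)
    ultimately show ?thesis by metis
  next
    case 12
    have "td5 44" using quad[of 11] by simp
    thus ?thesis by (rule even_step) (use 12 top[of 44] in simp_all)
  next
    case 13
    have "td5 52" using quad[of 13] by simp
    thus ?thesis by (rule even_step) (use 13 top[of 52] in simp_all)
  next
    case 14
    have "td5 56" using td5_mult[OF td5_8 coprime[of 7]] by simp
    thus ?thesis by (rule even_step) (use 14 top[of 56] in simp_all)
  next
    case 15
    have "td5 64" using td5_mult[OF td5_8 td5_8] by simp
    thus ?thesis by (rule even_step) (use 15 top[of 64] in simp_all)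
  next
    case 16
    \<comment> \<open>With group size \<open>4 * u\<close> and \<open>u \<le> q\<close> the
      remainder \<open>n - 16 * u\<close> is at least 7, which avoids 2, 3 and 6. Numbers coprime to
      6 have gaps of at most 4, so some such \<open>u\<close> satisfies \<open>q \<le> u + 3\<close>
      and \<open>n \<le> 16 * u + 70\<close>. This is at most \<open>20 * u\<close> from
      \<open>u = 19\<close> on, and 16 * 19 + 7 = 311 is where the case starts.\<close>
    define q where "q = (n - 7) div 16"
    have q: "16 * q + 7 \<le> n" "n < 16 * q + 23" using 16 unfolding q_def by presburger+
    have "19 \<le> q" using q(2) 16 by linarith
    hence "\<exists>u\<ge>19. u \<le> q \<and> q \<le> u + 3 \<and> odd u \<and> u mod 3 \<noteq> 0" by presburger
    then obtain u where u: "19 \<le> u" "u \<le> q" "q \<le> u + 3" "odd u" "u mod 3 \<noteq> 0" by blast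
    show ?thesis
      by (rule even_step[OF quad[OF u(4,5)]]) (use u(1-3) q top[of "4 * u"] in auto)
  qed
qed

section \<open>Nonexistence\<close>

text \<open>A schedule may store the two teams of a game in either order; the disjunction removes
  this choice.\<close>

definition plays :: "game set \<Rightarrow> nat \<Rightarrow> nat \<Rightarrow> nat \<Rightarrow> nat \<Rightarrow> bool" where
  "plays G i a j b \<longleftrightarrow> (i, a, j, b) \<in> G \<or> (j, b, i, a) \<in> G"

lemma plays_sym: "plays G i a j b \<longleftrightarrow> plays G j b i a"
  by (auto simp: plays_def)

section \<open>Meetings in a given CMDRR\<close>

lemma card_eq_1_unique:
  assumes "card {g \<in> G. Q g} = 1" and "g \<in> G" "Q g" "h \<in> G" "Q h"
  shows "g = h"
proof -
  obtain z where z: "{g \<in> G. Q g} = {z}" using assms(1) by (rule card_1_singletonE)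
  have "g \<in> {g \<in> G. Q g}" "h \<in> {g \<in> G. Q g}" using assms(2-5) by simp_all
  thus ?thesis unfolding z by simp
qed

lemma plays_wf:
  assumes "is_CMDRR n k S G" and "plays G i a j b"
  shows "i < n" "a < n" "j < n" "b < n" "i \<noteq> j" "a \<noteq> b"
    "(i, a) \<notin> S" "(i, b) \<notin> S" "(j, a) \<notin> S" "(j, b) \<notin> S"
  using assms by (fastforce simp: is_CMDRR_def plays_def wf_game_def)+

lemma plays_partner:
  assumes cm: "is_CMDRR n k S G" and g: "plays G i a j b" and h: "plays G i a j' b'"
  shows "j = j' \<and> b = b'"
proof -
  let ?Q = "\<lambda>g. case g of (p, q, r, s) \<Rightarrow> p = i \<and> q = a \<or> r = i \<and> s = a"
  have one: "card {g \<in> G. ?Q g} = 1"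
    using cm plays_wf[OF cm g] by (auto simp: is_CMDRR_def partners_count_def)
  obtain g' where g': "g' \<in> G" "g' = (i, a, j, b) \<or> g' = (j, b, i, a)"
    using g by (auto simp: plays_def)
  obtain h' where h': "h' \<in> G" "h' = (i, a, j', b') \<or> h' = (j', b', i, a)"
    using h by (auto simp: plays_def)
  have "g' = h'" using g' h' by (intro card_eq_1_unique[OF one]) auto
  thus ?thesis using g' h' plays_wf[OF cm g] plays_wf[OF cm h] by auto
qed

lemma plays_opponent:
  assumes cm: "is_CMDRR n k S G" and g: "plays G i a j b" and h: "plays G i' a j b'"
  shows "i = i' \<and> b = b'"
proof -
  let ?Q = "\<lambda>g. case g of (p, q, r, s) \<Rightarrow> p = j \<and> s = a \<or> r = j \<and> q = a"
  have one: "card {g \<in> G. ?Q g} = 1"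
    using cm plays_wf[OF cm g] by (auto simp: is_CMDRR_def mw_opp_count_def)
  obtain g' where g': "g' \<in> G" "g' = (i, a, j, b) \<or> g' = (j, b, i, a)"
    using g by (auto simp: plays_def)
  obtain h' where h': "h' \<in> G" "h' = (i', a, j, b') \<or> h' = (j, b', i', a)"
    using h by (auto simp: plays_def)
  have "g' = h'" using g' h' by (intro card_eq_1_unique[OF one]) auto
  thus ?thesis using g' h' plays_wf[OF cm g] plays_wf[OF cm h] by auto
qed

text \<open>The opposition count of two women is symmetric, and it is 1 as soon as one of them has a
  spouse.\<close>

lemma plays_women:
  assumes cm: "is_CMDRR n k S G" and g: "plays G i a j b" and h: "plays G i' a j' b"
    and sp: "a \<in> snd ` S \<or> b \<in> snd ` S"
  shows "i = i' \<and> j = j'"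
proof -
  have comm: "women_opp_count G a b = women_opp_count G b a"
    unfolding women_opp_count_def by (rule arg_cong[where f = card]) auto
  let ?Q = "\<lambda>g. case g of (p, q, r, s) \<Rightarrow> q = a \<and> s = b \<or> q = b \<and> s = a"
  have ok: "\<forall>x<n. x \<in> snd ` S \<longrightarrow> (\<forall>y<n. y \<noteq> x \<longrightarrow> women_opp_count G x y = 1)"
    using cm by (simp add: is_CMDRR_def same_sex_ok_def)
  have "women_opp_count G a b = 1"
  proof (cases "a \<in> snd ` S")
    case True
    thus ?thesis using ok plays_wf(2,4,6)[OF cm g] by metis
  next
    case False
    hence "b \<in> snd ` S" using sp by simp
    thus ?thesis unfolding comm using ok plays_wf(2,4,6)[OF cm g] by metis
  qed
  hence one: "card {g \<in> G. ?Q g} = 1" by (simp add: women_opp_count_def)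
  obtain g' where g': "g' \<in> G" "g' = (i, a, j, b) \<or> g' = (j, b, i, a)"
    using g by (auto simp: plays_def)
  obtain h' where h': "h' \<in> G" "h' = (i', a, j', b) \<or> h' = (j', b, i', a)"
    using h by (auto simp: plays_def)
  have "g' = h'" using g' h' by (intro card_eq_1_unique[OF one]) auto
  thus ?thesis using g' h' plays_wf[OF cm g] plays_wf[OF cm h] by auto
qed

lemma plays_exists:
  assumes cm: "is_CMDRR n k S G" and ij: "i < n" "j < n" "i \<noteq> j"
  shows "\<exists>a b. plays G i a j b"
proof -
  have ok: "same_sex_ok n (fst ` S) (men_opp_count G)" using cm by (simp add: is_CMDRR_def)
  have "men_opp_count G i j \<in> {1, 2}"
  proof (cases "i \<in> fst ` S")
    case True thus ?thesis using ok ij by (auto simp: same_sex_ok_def)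
  next
    case False
    then obtain z where "men_opp_count G i z = 2" "\<forall>y<n. y \<noteq> i \<and> y \<noteq> z \<longrightarrow> men_opp_count G i y = 1"
      using ok ij unfolding same_sex_ok_def by blast
    thus ?thesis using ij by (cases "j = z") auto
  qed
  hence "{g \<in> G. case g of (a, b, c, d) \<Rightarrow> a = i \<and> c = j \<or> a = j \<and> c = i} \<noteq> {}"
    unfolding men_opp_count_def
      by (metis card.empty insert_iff singletonD zero_neq_numeral zero_neq_one)
  thus ?thesis by (auto simp: plays_def)
qed

text \<open>A tuple (i, j, a, b) stands for the game of man i with woman a against man j with woman b. The nested
  conditionals keep the simplifier from evaluating branches that are already refuted.\<close>

fun compatible :: "nat \<Rightarrow> nat \<times> nat \<times> nat \<times> nat \<Rightarrow> nat \<times> nat \<times> nat \<times> nat \<Rightarrow> bool" where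
  "compatible k (i, j, a, b) (x, y, c, d) \<longleftrightarrow>
     (if a = c then if b = d then i \<noteq> x \<and> j \<noteq> y \<and> k \<le> a \<and> k \<le> b else i \<noteq> x \<and> j \<noteq> y
      else if b = d then i \<noteq> x \<and> j \<noteq> y
      else if a = d then if b = c then i \<noteq> y \<and> j \<noteq> x \<and> k \<le> a \<and> k \<le> b else i \<noteq> y \<and> j \<noteq> x
      else if b = c then i \<noteq> y \<and> j \<noteq> x else True)"

fun all_compatible ::
  "nat \<Rightarrow> nat \<times> nat \<times> nat \<times> nat \<Rightarrow> (nat \<times> nat \<times> nat \<times> nat) list \<Rightarrow> bool" where
  "all_compatible k g [] \<longleftrightarrow> True"
| "all_compatible k g (h # hs) \<longleftrightarrow> (if compatible k g h then all_compatible k g hs else False)"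

text \<open>Runs through the given pairs of opposing men and tries all women for each. Only
  necessary conditions are tested, namely that spouses stay apart and no meeting is repeated, so
  success does not yet give a tournament but failure excludes one.\<close>

fun find_games :: "nat \<Rightarrow> nat \<Rightarrow> (nat \<times> nat) list \<Rightarrow> (nat \<times> nat \<times> nat \<times> nat) list \<Rightarrow> bool" where
  "find_games n k [] acc \<longleftrightarrow> True"
| "find_games n k ((i, j) # ps) acc \<longleftrightarrow>
     list_ex (\<lambda>a. if i < k \<and> i = a \<or> j < k \<and> j = a then False else
       list_ex (\<lambda>b. if a = b \<or> i < k \<and> i = b \<or> j < k \<and> j = b then False else
         if all_compatible k (i, j, a, b) acc then find_games n k ps ((i, j, a, b) # acc)
         else False) [0..<n]) [0..<n]"

lemma all_compatible_iff: "all_compatible k g hs \<longleftrightarrow> (\<forall>h\<in>set hs. compatible k g h)"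
  by (induction hs) auto

text \<open>A list of pairwise compatible games is a path through the search tree. Compatibility is
  demanded with the later game first because a new game is tested against those in
  \<open>acc\<close>.\<close>

lemma find_games_complete:
  assumes "\<forall>(i, j, a, b)\<in>set gs. a < n \<and> b < n \<and> a \<noteq> b \<and>
      (i < k \<longrightarrow> i \<noteq> a \<and> i \<noteq> b) \<and> (j < k \<longrightarrow> j \<noteq> a \<and> j \<noteq> b)"
    and "\<forall>g\<in>set gs. \<forall>h\<in>set acc. compatible k g h"
    and "sorted_wrt (\<lambda>h g. compatible k g h) gs"
  shows "find_games n k (map (\<lambda>(i, j, a, b). (i, j)) gs) acc"
  using assms
proof (induction gs arbitrary: acc)
  case (Cons g gs)
  obtain i j a b where g: "g = (i, j, a, b)" by (cases g)
  have "find_games n k (map (\<lambda>(i, j, a, b). (i, j)) gs) (g # acc)"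
    using Cons.prems by (intro Cons.IH) auto
  moreover have "all_compatible k (i, j, a, b) acc"
    using Cons.prems(2) by (auto simp: all_compatible_iff g)
  ultimately have inner: "if a = b \<or> i < k \<and> i = b \<or> j < k \<and> j = b then False else
      if all_compatible k (i, j, a, b) acc
      then find_games n k (map (\<lambda>(i, j, a, b). (i, j)) gs) ((i, j, a, b) # acc) else False"
    using Cons.prems(1) by (auto simp: g)
  have ab: "a \<in> set [0..<n]" "b \<in> set [0..<n]" "\<not> (i < k \<and> i = a \<or> j < k \<and> j = a)"
    using Cons.prems(1) by (auto simp: g)
  show ?case
    unfolding g list.map prod.case find_games.simps list_ex_iff
    by (rule bexI[OF _ ab(1)], subst if_not_P[OF ab(3)], rule bexI[OF _ ab(2)]) (rule inner)
qed simp

text \<open>\<open>P\<close> and \<open>W\<close> renumber men and women so that the spouse pairs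
  become \<open>(i, i)\<close> with \<open>i < k\<close>, the convention built into the
  search.\<close>

locale labelled_tournament =
  fixes n k :: nat and S :: "(nat \<times> nat) set" and G :: "game set" and P W :: "nat \<Rightarrow> nat"
  assumes cm: "is_CMDRR n k S G"
    and P: "bij_betw P {..<n} {..<n}" and W: "bij_betw W {..<n} {..<n}"
    and spouse: "i < n \<Longrightarrow> j < n \<Longrightarrow> (P i, W j) \<in> S \<longleftrightarrow> i = j \<and> i < k"
begin

definition game where
  "game i a j b \<longleftrightarrow> i < n \<and> a < n \<and> j < n \<and> b < n \<and> plays G (P i) (W a) (P j) (W b)"

lemma game_sym: "game i a j b \<longleftrightarrow> game j b i a"
  unfolding game_def using plays_sym by blast

lemma P_eq: "i < n \<Longrightarrow> j < n \<Longrightarrow> P i = P j \<longleftrightarrow> i = j"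
  using P by (auto simp: bij_betw_def dest: inj_onD)

lemma W_eq: "i < n \<Longrightarrow> j < n \<Longrightarrow> W i = W j \<longleftrightarrow> i = j"
  using W by (auto simp: bij_betw_def dest: inj_onD)

lemma game_wf:
  assumes "game i a j b"
  shows "i \<noteq> j \<and> a \<noteq> b \<and> (i < k \<longrightarrow> i \<noteq> a \<and> i \<noteq> b) \<and> (j < k \<longrightarrow> j \<noteq> a \<and> j \<noteq> b)"
proof -
  have lt: "i < n" "a < n" "j < n" "b < n" and pl: "plays G (P i) (W a) (P j) (W b)"
    using assms by (auto simp: game_def)
  show ?thesis using plays_wf(5-)[OF cm pl] spouse lt by auto
qed

lemma game_partner: "game i a j b \<Longrightarrow> game i a j' b' \<Longrightarrow> j = j' \<and> b = b'"
  unfolding game_def using plays_partner[OF cm] P_eq W_eq by blast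

lemma game_opponent: "game i a j b \<Longrightarrow> game i' a j b' \<Longrightarrow> i = i' \<and> b = b'"
  unfolding game_def using plays_opponent[OF cm] P_eq W_eq by blast

lemma game_women:
  assumes g: "game i a j b" and h: "game i' a j' b" and sp: "a < k \<or> b < k"
  shows "i = i' \<and> j = j'"
proof -
  have lt: "a < n" "b < n" using g by (auto simp: game_def)
  have "W a \<in> snd ` S \<or> W b \<in> snd ` S"
    using sp spouse[of a a] spouse[of b b] lt by force
  thus ?thesis using g h plays_women[OF cm] P_eq unfolding game_def by blast
qed

lemma game_exists:
  assumes "i < n" "j < n" "i \<noteq> j"
  shows "\<exists>a b. game i a j b"
proof -
  have "P i < n" "P j < n" "P i \<noteq> P j" using assms P P_eq by (auto simp: bij_betw_def)
  from plays_exists[OF cm this] obtain a b where ab: "plays G (P i) a (P j) b" by blast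
  hence "a < n" "b < n" using plays_wf[OF cm] by blast+
  hence "a \<in> W ` {..<n}" "b \<in> W ` {..<n}" using W by (auto simp: bij_betw_def)
  thus ?thesis using ab assms by (auto simp: game_def)
qed

text \<open>A man of both games may not be twice the partner or twice the opponent of a recurring
  woman. If both women recur they oppose each other twice, so both are unmarried. The order of the
  men rules out that the second tuple is the first with its teams exchanged.\<close>

lemma game_compatible:
  assumes g: "game i a j b" and h: "game x c y d"
    and lt: "i < j" "x < y" and neq: "(i, j, a, b) \<noteq> (x, y, c, d)"
  shows "compatible k (i, j, a, b) (x, y, c, d)"
proof -
  note g' = g[unfolded game_sym[of i]] and h' = h[unfolded game_sym[of x]]
  have 1: "i \<noteq> x \<and> j \<noteq> y" if "a = c"
    using game_partner[of i a j b y d] game_opponent[of i a j b x d] g h that neq by auto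
  have 2: "i \<noteq> x \<and> j \<noteq> y" if "b = d"
    using game_partner[of j b i a x c] game_opponent[of j b i a y c] g' h' that neq by auto
  have 3: "i \<noteq> y \<and> j \<noteq> x" if "a = d"
    using game_partner[of i a j b x c] game_opponent[of i a j b y c] g h' that lt by auto
  have 4: "i \<noteq> y \<and> j \<noteq> x" if "b = c"
    using game_partner[of j b i a y d] game_opponent[of j b i a x d] g' h that lt by auto
  have 5: "k \<le> a \<and> k \<le> b" if "a = c" "b = d"
    using game_women[of i a j b x y] g h that neq 1 by (cases "k \<le> a \<and> k \<le> b") auto
  have 6: "k \<le> a \<and> k \<le> b" if "a = d" "b = c"
    using game_women[of i a j b y x] g h' that lt by (cases "k \<le> a \<and> k \<le> b") auto
  show ?thesis using 1 2 3 4 5 6 by auto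
qed

lemma find_games_if_games:
  assumes "\<forall>(i, j, a, b)\<in>set gs. i < j \<and> game i a j b" and "distinct gs"
    and "\<forall>(i, j, a, b)\<in>set acc. i < j \<and> game i a j b" and "set gs \<inter> set acc = {}"
  shows "find_games n k (map (\<lambda>(i, j, a, b). (i, j)) gs) acc"
proof (rule find_games_complete)
  show "\<forall>(i, j, a, b)\<in>set gs. a < n \<and> b < n \<and> a \<noteq> b \<and>
      (i < k \<longrightarrow> i \<noteq> a \<and> i \<noteq> b) \<and> (j < k \<longrightarrow> j \<noteq> a \<and> j \<noteq> b)"
  proof -
    have "a < n \<and> b < n \<and> a \<noteq> b \<and> (i < k \<longrightarrow> i \<noteq> a \<and> i \<noteq> b) \<and> (j < k \<longrightarrow> j \<noteq> a \<and> j \<noteq> b)"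
      if "(i, j, a, b) \<in> set gs" for i j a b
    proof -
      have "game i a j b" using assms(1) that by auto
      thus ?thesis using game_wf[of i a j b] by (simp add: game_def)
    qed
    thus ?thesis by blast
  qed
  have comp: "compatible k g h" if "g \<in> set gs" "h \<in> set gs \<union> set acc" "g \<noteq> h" for g h
  proof -
    obtain i j a b x y c d where [simp]: "g = (i, j, a, b)" "h = (x, y, c, d)" by (metis surj_pair)
    have "i < j \<and> game i a j b" "x < y \<and> game x c y d" using assms(1,3) that by auto
    thus ?thesis using game_compatible[of i a j b x c y d] that by simp
  qed
  thus "\<forall>g\<in>set gs. \<forall>h\<in>set acc. compatible k g h" using assms(4) by blast
  have "sorted_wrt (\<noteq>) gs" using assms(2) by (induction gs) auto
  show "sorted_wrt (\<lambda>h g. compatible k g h) gs"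
  proof (rule sorted_wrt_mono_rel)
    show "sorted_wrt (\<noteq>) gs" by fact
    fix h g assume "h \<in> set gs" "g \<in> set gs" "h \<noteq> g"
    thus "compatible k g h" using comp[of g h] by simp
  qed
qed

end

text \<open>The men 2 and 3 are the unmarried ones and oppose each other twice, which is why their
  pair occurs twice.\<close>

lemma find_games_4_2: "\<not> find_games 4 2 [(0,1),(0,2),(0,3),(1,2),(1,3),(2,3),(2,3)] []"
  by code_simp

text \<open>Numbering the men suitably fixes the game of the men 0 and 1.\<close>

lemma find_games_6_6:
  "\<not> find_games 6 6 [(0,2),(0,3),(0,4),(0,5),(1,2),(1,3),(1,4),(1,5),(2,3),(2,4),(2,5),(3,4),(3,5),(4,5)]
     [(0,1,2,3)]"
  by code_simp

lemma bij_betw_nth_list: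
  assumes "distinct xs" and "set xs = {..<n}"
  shows "bij_betw ((!) xs) {..<n} {..<n}"
proof -
  have "length xs = n" using assms by (metis card_lessThan distinct_card)
  thus ?thesis by (intro bij_betw_nth[OF assms(1)]) (simp_all add: assms(2))
qed

section \<open>The four impossible pairs\<close>

lemma no_CMDRR_fewer_than_4:
  assumes n: "n < 4" and k: "2 \<le> k"
  shows "\<not> CMDRR_exists n k"
proof
  assume "CMDRR_exists n k"
  then obtain S G where cm: "is_CMDRR n k S G" by (auto simp: CMDRR_exists_def)
  hence S: "S \<subseteq> {..<n} \<times> {..<n}" "card S = k"
    and inj: "\<And>m w w'. (m, w) \<in> S \<Longrightarrow> (m, w') \<in> S \<Longrightarrow> w = w'" "\<And>m m' w. (m, w) \<in> S \<Longrightarrow> (m', w) \<in> S \<Longrightarrow>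
        m = m'"
    unfolding is_CMDRR_def spouse_matching_def by blast+
  obtain T where T: "T \<subseteq> S" "card T = 2"
    by (rule obtain_subset_with_card_n[of 2 S]) (use S(2) k in simp)
  obtain p q where pq: "p \<in> S" "q \<in> S" "p \<noteq> q" using T unfolding card_2_iff by blast
  obtain x u y v where p: "p = (x, u)" and q: "q = (y, v)" by (cases p; cases q)
  have xy: "(x, u) \<in> S" "(y, v) \<in> S" "x \<noteq> y" "u \<noteq> v"
    using pq inj(1)[of x u v] inj(2)[of x u y] unfolding p q by blast+
  have "x < n" "y < n" "u < n" "v < n" using S(1) xy(1,2) by auto
  from plays_exists[OF cm this(1,2) xy(3)] obtain a b where ab: "plays G x a y b" by blast
  note wf = plays_wf[OF cm ab]
  \<comment> \<open>When two husbands oppose each other, neither of their wives can play, so two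
    further women are needed.\<close>
  have "a \<noteq> u" "a \<noteq> v" "b \<noteq> u" "b \<noteq> v" using xy wf by auto
  hence "card {a, b, u, v} = 4" using wf(6) xy(4) by simp
  moreover have "card {a, b, u, v} \<le> card {..<n}" using wf \<open>u < n\<close> \<open>v < n\<close> by (intro card_mono) auto
  ultimately show False using n by simp
qed

text \<open>Married players are numbered 0 and 1, unmarried ones 2 and 3. One game for each pair of
  men and the second game of men 2 and 3 are handed to the search.\<close>

lemma no_CMDRR_4_2: "\<not> CMDRR_exists 4 2"
proof
  assume "CMDRR_exists 4 2"
  then obtain S G where cm: "is_CMDRR 4 2 S G" by (auto simp: CMDRR_exists_def)
  hence S: "S \<subseteq> {..<4} \<times> {..<4}" "card S = 2"
    and inj: "\<And>m w w'. (m, w) \<in> S \<Longrightarrow> (m, w') \<in> S \<Longrightarrow> w = w'" "\<And>m m' w. (m, w) \<in> S \<Longrightarrow> (m', w) \<in> S \<Longrightarrow>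
        m = m'"
    unfolding is_CMDRR_def spouse_matching_def by blast+
  from S(2) obtain p q where "S = {p, q}" "p \<noteq> q" by (auto simp: card_2_iff)
  then obtain m1 w1 m2 w2 where mw: "S = {(m1, w1), (m2, w2)}" "m1 \<noteq> m2" "w1 \<noteq> w2"
    using inj by (metis insertI1 insertI2 surj_pair)
  hence lt: "m1 < 4" "m2 < 4" "w1 < 4" "w2 < 4" using S by auto
  have rest: "\<exists>x y. x \<noteq> y \<and> {..<4} - {m, m'} = {x, y}" if "m < 4" "m' < 4" "m \<noteq> m'" for m m' :: nat
  proof -
    have "card ({..<4} - {m, m'}) = 2" using that by (subst card_Diff_subset) auto
    thus ?thesis by (auto simp: card_2_iff)
  qed
  obtain x y where xy: "x \<noteq> y" "{..<4} - {m1, m2} = {x, y}" using rest[OF lt(1,2) mw(2)] by blast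
  obtain u v where uv: "u \<noteq> v" "{..<4} - {w1, w2} = {u, v}" using rest[OF lt(3,4) mw(3)] by blast
  have P: "bij_betw ((!) [m1, m2, x, y]) {..<4} {..<4}"
    and W: "bij_betw ((!) [w1, w2, u, v]) {..<4} {..<4}"
    by (rule bij_betw_nth_list; use mw xy uv lt in auto)+
  have nxy: "x \<notin> {m1, m2}" "y \<notin> {m1, m2}" "u \<notin> {w1, w2}" "v \<notin> {w1, w2}" using xy uv by auto
  interpret labelled_tournament 4 2 S G "(!) [m1, m2, x, y]" "(!) [w1, w2, u, v]"
  proof
    show "is_CMDRR 4 2 S G" by (rule cm)
    show "bij_betw ((!) [m1, m2, x, y]) {..<4} {..<4}" by (rule P)
    show "bij_betw ((!) [w1, w2, u, v]) {..<4} {..<4}" by (rule W)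
    fix i j :: nat assume "i < 4" "j < 4"
    hence "i = 0 \<or> i = 1 \<or> i = 2 \<or> i = 3" "j = 0 \<or> j = 1 \<or> j = 2 \<or> j = 3" by linarith+
    thus "([m1, m2, x, y] ! i, [w1, w2, u, v] ! j) \<in> S \<longleftrightarrow> i = j \<and> i < 2"
      using mw nxy by (elim disjE) simp_all
  qed
  have "same_sex_ok 4 (fst ` S) (men_opp_count G)" "x < 4" "x \<notin> fst ` S" "fst ` S = {m1, m2}"
    using cm nxy xy mw by (auto simp: is_CMDRR_def)
  then obtain z where z: "z < 4" "z \<noteq> x" "z \<notin> {m1, m2}" "men_opp_count G x z = 2"
    unfolding same_sex_ok_def by metis
  hence "z = y" using xy by blast
  with z(4) obtain g h
    where gh: "g \<noteq> h" "{g \<in> G. case g of (a, b, c, d) \<Rightarrow> a = x \<and> c = y \<or> a = y \<and> c = x} = {g, h}"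
    unfolding men_opp_count_def card_2_iff by blast
  have ex: "\<exists>a b. (g = (x, a, y, b) \<or> g = (y, b, x, a)) \<and> plays G x a y b"
    if "g \<in> {g \<in> G. case g of (a, b, c, d) \<Rightarrow> a = x \<and> c = y \<or> a = y \<and> c = x}" for g
    using that by (auto simp: plays_def)
  obtain a b where ab: "g = (x, a, y, b) \<or> g = (y, b, x, a)" "plays G x a y b" 
    using ex[of g] unfolding gh(2) by blast
  obtain a' b' where ab': "h = (x, a', y, b') \<or> h = (y, b', x, a')" "plays G x a' y b'" 
    using ex[of h] unfolding gh(2) by blast
  \<comment> \<open>Different tuples could still describe one game with its teams exchanged, but
    then man \<open>x\<close> would be partner of \<open>a\<close> in two elements of
    \<open>G\<close>.\<close>
  have "(a, b) \<noteq> (a', b')"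
  proof
    assume "(a, b) = (a', b')"
    hence "plays G x a y b" "(x, a, y, b) \<in> G" "(y, b, x, a) \<in> G" using ab ab' gh by auto
    have "card {g \<in> G. case g of (p, q, r, s) \<Rightarrow> p = x \<and> q = a \<or> r = x \<and> s = a} = 1"
      using cm plays_wf[OF cm ab(2)] by (auto simp: is_CMDRR_def partners_count_def)
    from card_eq_1_unique[OF this \<open>(x, a, y, b) \<in> G\<close> _ \<open>(y, b, x, a) \<in> G\<close>] show False
      using xy(1) by auto
  qed
  have lab: "\<exists>l<4. [w1, w2, u, v] ! l = w" if "w < 4" for w
  proof -
    have "w \<in> (!) [w1, w2, u, v] ` {..<4}" using W that by (simp add: bij_betw_def)
    thus ?thesis by auto
  qed
  obtain la lb where "la < 4" "lb < 4" "[w1, w2, u, v] ! la = a" "[w1, w2, u, v] ! lb = b"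
    using lab plays_wf[OF cm ab(2)] by metis
  hence g1: "game 2 la 3 lb" using ab(2) by (simp add: game_def)
  obtain la' lb' where "la' < 4" "lb' < 4" "[w1, w2, u, v] ! la' = a'" "[w1, w2, u, v] ! lb' = b'"
    using lab plays_wf[OF cm ab'(2)] by metis
  hence g2: "game 2 la' 3 lb'" using ab'(2) by (simp add: game_def)
  have ne: "(la, lb) \<noteq> (la', lb')"
    using \<open>(a, b) \<noteq> (a', b')\<close> \<open>[w1, w2, u, v] ! la = a\<close> \<open>[w1, w2, u, v] ! lb = b\<close>
      \<open>[w1, w2, u, v] ! la' = a'\<close> \<open>[w1, w2, u, v] ! lb' = b'\<close> by auto
  obtain fa fb where f: "\<And>i j. i < 4 \<Longrightarrow> j < 4 \<Longrightarrow> i \<noteq> j \<Longrightarrow> game i (fa i j) j (fb i j)"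
    using game_exists by metis
  define gs where "gs = map (\<lambda>(i, j). (i, j, fa i j, fb i j)) [(0,1),(0,2),(0,3),(1,2),(1,3)] @
    [(2, 3, la, lb), (2, 3, la', lb')]"
  have "find_games 4 2 (map (\<lambda>(i, j, a, b). (i, j)) gs) []"
    by (rule find_games_if_games) (use f g1 g2 ne in \<open>auto simp: gs_def\<close>)
  thus False using find_games_4_2 by (simp add: gs_def)
qed

text \<open>Everyone is married, so the women can be numbered by their husbands and one permutation
  of the men renames all players.\<close>

lemma no_CMDRR_6_6: "\<not> CMDRR_exists 6 6"
proof
  assume "CMDRR_exists 6 6"
  then obtain S G where cm: "is_CMDRR 6 6 S G" by (auto simp: CMDRR_exists_def)
  hence S: "S \<subseteq> {..<6} \<times> {..<6}" "card S = 6"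
    and inj: "\<And>m w w'. (m, w) \<in> S \<Longrightarrow> (m, w') \<in> S \<Longrightarrow> w = w'" "\<And>m m' w. (m, w) \<in> S \<Longrightarrow> (m', w) \<in> S \<Longrightarrow>
        m = m'"
    unfolding is_CMDRR_def spouse_matching_def by blast+
  have "inj_on fst S" using inj by (auto intro!: inj_onI)
  hence "card (fst ` S) = 6" using S(2) by (simp add: card_image)
  moreover have "fst ` S \<subseteq> {..<6}" using S(1) by auto
  ultimately have dom: "fst ` S = {..<6}" by (simp add: card_subset_eq)
  have "\<exists>w. (m, w) \<in> S" if "m < 6" for m
  proof -
    have "m \<in> fst ` S" using dom that by simp
    thus ?thesis by force
  qed
  then obtain sp where sp: "\<And>m. m < 6 \<Longrightarrow> (m, sp m) \<in> S" by metis
  have bij: "bij_betw sp {..<6} {..<6}"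
    unfolding bij_betw_def
  proof
    show inj_sp: "inj_on sp {..<6}"
    proof (rule inj_onI)
      fix x y assume "x \<in> {..<6}" "y \<in> {..<6}" "sp x = sp y"
      thus "x = y" using sp[of x] sp[of y] inj(2)[of x "sp x" y] by simp
    qed
    have "sp m < 6" if "m < 6" for m using sp[OF that] S(1) by auto
    thus "sp ` {..<6} = {..<6}" using inj_sp by (intro card_subset_eq) (auto simp: card_image)
  qed
  obtain a b where ab: "plays G 0 a 1 b" using plays_exists[OF cm, of 0 1] by auto
  note wf = plays_wf[OF cm ab]
  have "a \<in> sp ` {..<6}" "b \<in> sp ` {..<6}" using bij wf(2,4) by (simp_all add: bij_betw_def)
  then obtain p q where pq: "p < 6" "q < 6" "sp p = a" "sp q = b" by auto
  have s01: "(0, sp 0) \<in> S" "(1, sp 1) \<in> S" by (rule sp, simp)+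
  \<comment> \<open>Neither woman in the game of men 0 and 1 is a wife of theirs. So these two men
    and the husbands \<open>p\<close>, \<open>q\<close> of the women are four different men, which
    become numbers 0 to 3.\<close>
  have d4: "p \<noteq> q" "p \<noteq> 0" "p \<noteq> 1" "q \<noteq> 0" "q \<noteq> 1"
    using wf(6-10) pq(3,4) s01 by metis+
  have "card ({..<6} - {0, 1, p, q}) = 2" using pq d4 by (subst card_Diff_subset) auto
  then obtain r s where rs: "r \<noteq> s" "{..<6} - {0, 1, p, q} = {r, s}" by (auto simp: card_2_iff)
  define P where "P = (!) [0, 1, p, q, r, s]"
  have "{r, s} \<inter> {0, 1, p, q} = {}" using rs by blast
  hence "distinct [0, 1, p, q, r, s]" using rs(1) d4 by simp
  moreover have "set [0, 1, p, q, r, s] = {0, 1, p, q} \<union> {r, s}" by (simp add: insert_commute)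
  hence "set [0, 1, p, q, r, s] = {..<6}" unfolding rs(2)[symmetric] 
    using pq(1,2) by (simp add: insert_absorb)
  ultimately have P: "bij_betw P {..<6} {..<6}" unfolding P_def by (rule bij_betw_nth_list)
  have Pinj: "P i = P j \<longleftrightarrow> i = j" if "i < 6" "j < 6" for i j
    using P that by (auto simp: bij_betw_def dest: inj_onD)
  have P6: "P i < 6" if "i < 6" for i using P that by (auto simp: bij_betw_def)
  interpret labelled_tournament 6 6 S G P "sp \<circ> P"
  proof
    show "is_CMDRR 6 6 S G" by (rule cm)
    show "bij_betw P {..<6} {..<6}" by (rule P)
    show "bij_betw (sp \<circ> P) {..<6} {..<6}" by (rule bij_betw_trans[OF P bij])
    fix i j :: nat assume ij: "i < 6" "j < 6"
    show "(P i, (sp \<circ> P) j) \<in> S \<longleftrightarrow> i = j \<and> i < 6"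
      using sp[OF P6[OF ij(2)]] inj(2)[of "P i" "sp (P j)" "P j"] Pinj[OF ij] ij by auto
  qed
  have "P 0 = 0" "P 1 = 1" "P 2 = p" "P 3 = q" by (simp_all add: P_def)
  hence g0: "game 0 2 1 3" unfolding game_def using ab pq by simp
  obtain fa fb where f: "\<And>i j. i < 6 \<Longrightarrow> j < 6 \<Longrightarrow> i \<noteq> j \<Longrightarrow> game i (fa i j) j (fb i j)"
    using game_exists by metis
  define gs where "gs = map (\<lambda>(i, j). (i, j, fa i j, fb i j))
    [(0,2),(0,3),(0,4),(0,5),(1,2),(1,3),(1,4),(1,5),(2,3),(2,4),(2,5),(3,4),(3,5),(4,5)]"
  have "find_games 6 6 (map (\<lambda>(i, j, a, b). (i, j)) gs) [(0, 1, 2, 3)]"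
    by (rule find_games_if_games) (use f g0 in \<open>auto simp: gs_def\<close>)
  thus False using find_games_6_6 by (simp add: gs_def)
qed

theorem theorem5:
  fixes n k :: nat
  assumes "2 \<le> n" and "k \<le> n" and "even (n - k)"
  shows "((n, k) \<in> {(2,2),(3,3),(4,2),(6,6)} \<longrightarrow> \<not> CMDRR_exists n k) \<and>
         ((n, k) \<notin> {(2,2),(3,3),(4,2),(6,6)} \<and>
          (n, k) \<notin> {(5,3),(6,2),(12,2),(12,6),(12,8),(13,3),(13,7),(14,2),(14,6),(15,3),
                     (15,7),(15,9),(16,2),(16,10),(17,3),(17,7),(17,11),(18,2),(18,10),(19,3),
                     (19,11),(20,2),(20,14),(21,3),(21,11),(22,2),(22,14),(23,15),(24,2),
                     (24,14),(25,15)}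
          \<longrightarrow> CMDRR_exists n k)"
proof (intro conjI impI)
  assume "(n, k) \<in> {(2,2),(3,3),(4,2),(6,6)}"
  thus "\<not> CMDRR_exists n k"
    using no_CMDRR_fewer_than_4[of 2 2] no_CMDRR_fewer_than_4[of 3 3] no_CMDRR_4_2 no_CMDRR_6_6
      by auto
next
  assume "(n, k) \<notin> {(2,2),(3,3),(4,2),(6,6)} \<and>
          (n, k) \<notin> {(5,3),(6,2),(12,2),(12,6),(12,8),(13,3),(13,7),(14,2),(14,6),(15,3),
                     (15,7),(15,9),(16,2),(16,10),(17,3),(17,7),(17,11),(18,2),(18,10),(19,3),
                     (19,11),(20,2),(20,14),(21,3),(21,11),(22,2),(22,14),(23,15),(24,2),
                     (24,14),(25,15)}"
  hence "(n, k) \<notin> exceptional" by (simp only: exceptional_def Un_iff) simp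
  moreover have "even k \<longleftrightarrow> even n" using assms(2,3) by (simp add: even_diff_nat)
  ultimately show "CMDRR_exists n k"
    using assms(2) by (intro tournament_imp_CMDRR_exists tournament_exists)
qed

end
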